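(* Let $N\ge 6$. Every tracial central linear functional on $\mathrm{Pol}(S_N^+)$ is a linear combination of the counit $\varepsilon$ and the Haar state $h$, and therefore extends to a bounded functional on $C^u(S_N^+)$.
   Context: For a compact quantum group $\mathbb{G}$ with Hopf $*$-algebra $\mathrm{Pol}(\mathbb{G})$ and unitary irreducible representatives $U^\alpha=(U^\alpha_{ij})_{i,j=1}^{d_\alpha}$, $\alpha\in\mathrm{Irr}(\mathbb{G})$: a linear functional $\phi:\mathrm{Pol}(\mathbb{G})\to\mathbb{C}$ is tracial if $\phi(ab)=\phi(ba)$ for all $a,b$, and central if for each $\alpha$ there is $c_\alpha\in\mathbb{C}$ with $\phi(U^\alpha_{ij})=c_\alpha\delta_{ij}$ for all $i,j$. The counit satisfies $\varepsilon(U^\alpha_{ij})=\delta_{ij}$; the Haar state $h$ satisfies $h(1)=1$ and $h(U^\alpha_{ij})=0$ for all nontrivial $\alpha$. $C^u(\mathbb{G})$ is the universal $C^*$-completion of $\mathrm{Pol}(\mathbb{G})$. The quantum permutation group $S_N^+$: $\mathrm{Pol}(S_N^+)$ is the universal unital $*$-algebra generated by elements $p_{ij}$, $1\le i,j\le N$, with $p_{ij}=p_{ij}^*$, $p_{ij}p_{il}=\delta_{jl}p_{ij}$, $p_{ij}p_{lj}=\delta_{il}p_{ij}$, $\sum_k p_{kj}=1=\sum_k p_{ik}$ for all $i,j,l$, with coproduct $\Delta(p_{ij})=\sum_k p_{ik}\otimes p_{kj}$. *)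

theory Defs
  imports
    "HOL-Library.Poly_Mapping"
    "HOL-Library.Cardinality"
    "HOL-Library.Nonpos_Ints"
    "Jordan_Normal_Form.Matrix"
    Complex_Main
begin

section \<open>Unital complex star-algebras\<close>

class scaleC =
  fixes scaleC :: "complex \<Rightarrow> 'a \<Rightarrow> 'a"  (infixr \<open>*\<^sub>C\<close> 75)

class complex_vector = scaleC + ab_group_add +
  assumes scaleC_add_right: "c *\<^sub>C (x + y) = c *\<^sub>C x + c *\<^sub>C y"
    and scaleC_add_left: "(c + d) *\<^sub>C x = c *\<^sub>C x + d *\<^sub>C x"
    and scaleC_scaleC: "c *\<^sub>C (d *\<^sub>C x) = (c * d) *\<^sub>C x"
    and scaleC_one: "1 *\<^sub>C x = x"

class complex_algebra_1 = complex_vector + ring + monoid_mult +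
  assumes scaleC_mult_left: "(c *\<^sub>C x) * y = c *\<^sub>C (x * y)"
    and scaleC_mult_right: "x * (c *\<^sub>C y) = c *\<^sub>C (x * y)"

class star_algebra = complex_algebra_1 +
  fixes star :: "'a \<Rightarrow> 'a"
  assumes star_star: "star (star x) = x"
    and star_add: "star (x + y) = star x + star y"
    and star_scaleC: "star (c *\<^sub>C x) = cnj c *\<^sub>C star x"
    and star_mult: "star (x * y) = star y * star x"

instantiation complex :: star_algebra
begin
definition "scaleC_complex = ((*) :: complex \<Rightarrow> complex \<Rightarrow> complex)"
definition "star_complex = cnj"
instance
  by standard (simp_all add: scaleC_complex_def star_complex_def algebra_simps)
end

global_interpretation cvec: vector_space "scaleC :: complex \<Rightarrow> 'a::complex_vector \<Rightarrow> 'a"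
  by unfold_locales (simp_all add: scaleC_add_right scaleC_add_left scaleC_scaleC scaleC_one)

abbreviation clinear :: "('a::complex_vector \<Rightarrow> 'b::complex_vector) \<Rightarrow> bool" where
  "clinear \<equiv> Vector_Spaces.linear scaleC scaleC"

lemma clinear_iff:
  "clinear f \<longleftrightarrow> (\<forall>x y. f (x + y) = f x + f y) \<and> (\<forall>c x. f (c *\<^sub>C x) = c *\<^sub>C f x)"
  by (simp add: Vector_Spaces.linear_iff cvec.vector_space_axioms)

definition unital_algebra_hom :: "('a::complex_algebra_1 \<Rightarrow> 'b::complex_algebra_1) \<Rightarrow> bool" where
  "unital_algebra_hom f \<longleftrightarrow> clinear f \<and> f 1 = 1 \<and> (\<forall>x y. f (x * y) = f x * f y)"

lemma star_zero: "star 0 = (0 :: 'a::star_algebra)"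
  using star_add[of "0::'a" 0] by simp

lemma star_minus: "star (- x) = - star (x :: 'a::star_algebra)"
  using star_add[of x "- x"] by (simp add: star_zero minus_unique[symmetric])

lemma star_diff: "star (x - y) = star x - star (y :: 'a::star_algebra)"
  using star_add[of x "- y"] by (simp add: star_minus)

lemma star_one: "star 1 = (1 :: 'a::star_algebra)"
  by (metis mult.right_neutral star_mult star_star mult.left_neutral)


section \<open>Two-sided ideals and monoid algebras\<close>

inductive_set two_sided_ideal :: "'a::{ring,monoid_mult} set \<Rightarrow> 'a set" for R where
  zero: "0 \<in> two_sided_ideal R"
| gen: "r \<in> R \<Longrightarrow> a * r * b \<in> two_sided_ideal R"
| add: "x \<in> two_sided_ideal R \<Longrightarrow> y \<in> two_sided_ideal R \<Longrightarrow> x + y \<in> two_sided_ideal R"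

lemma two_sided_ideal_mult:
  assumes "x \<in> two_sided_ideal R"
  shows "c * x * d \<in> two_sided_ideal R"
  using assms
proof induction
  case zero
  show ?case by (simp add: two_sided_ideal.zero)
next
  case (gen r a b)
  have "c * (a * r * b) * d = (c * a) * r * (b * d)" by (simp add: mult.assoc)
  then show ?case using gen by (simp add: two_sided_ideal.gen)
next
  case (add x y)
  then show ?case by (simp add: distrib_left distrib_right two_sided_ideal.add)
qed

lemma two_sided_ideal_mult_left: "x \<in> two_sided_ideal R \<Longrightarrow> c * x \<in> two_sided_ideal R"
  using two_sided_ideal_mult[of x R c 1] by simp

lemma two_sided_ideal_mult_right: "x \<in> two_sided_ideal R \<Longrightarrow> x * d \<in> two_sided_ideal R"
  using two_sided_ideal_mult[of x R 1 d] by simp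

lemma two_sided_ideal_base: "r \<in> R \<Longrightarrow> r \<in> two_sided_ideal R"
  using two_sided_ideal.gen[of r R 1 1] by simp

lemma two_sided_ideal_minus: "x \<in> two_sided_ideal R \<Longrightarrow> - x \<in> two_sided_ideal R"
  using two_sided_ideal_mult_left[of x R "- 1"] by simp

lemma two_sided_ideal_diff:
  "x \<in> two_sided_ideal R \<Longrightarrow> y \<in> two_sided_ideal R \<Longrightarrow> x - y \<in> two_sided_ideal R"
  using two_sided_ideal.add[of x R "- y"] two_sided_ideal_minus by fastforce

lemma two_sided_ideal_equivp: "equivp (\<lambda>f g. f - g \<in> two_sided_ideal R)"
proof (rule equivpI)
  show "reflp (\<lambda>f g. f - g \<in> two_sided_ideal R)"
    by (rule reflpI) (simp add: two_sided_ideal.zero)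
  show "symp (\<lambda>f g. f - g \<in> two_sided_ideal R)"
  proof (rule sympI)
    fix f g assume "f - g \<in> two_sided_ideal R"
    from two_sided_ideal_minus[OF this] show "g - f \<in> two_sided_ideal R" by simp
  qed
  show "transp (\<lambda>f g. f - g \<in> two_sided_ideal R)"
  proof (rule transpI)
    fix f g h assume "f - g \<in> two_sided_ideal R" "g - h \<in> two_sided_ideal R"
    from two_sided_ideal.add[OF this] show "f - h \<in> two_sided_ideal R" by simp
  qed
qed

text \<open>For a monoid \<open>'m\<close> (written additively, as \<^theory>\<open>HOL-Library.Poly_Mapping\<close> requires),
  the type \<open>'m \<Rightarrow>\<^sub>0 complex\<close> with convolution is the monoid algebra of \<open>'m\<close>.\<close>

definition monom_scale :: "complex \<Rightarrow> ('m::monoid_add \<Rightarrow>\<^sub>0 complex) \<Rightarrow> ('m \<Rightarrow>\<^sub>0 complex)" where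
  "monom_scale c f = Poly_Mapping.single 0 c * f"

lemma lookup_monom_scale: "Poly_Mapping.lookup (monom_scale c f) k = c * Poly_Mapping.lookup f k"
  by (simp add: monom_scale_def lookup_mult lookup_single when_mult mult_when)

definition lin_ext :: "('k \<Rightarrow> 'a::complex_vector) \<Rightarrow> ('k \<Rightarrow>\<^sub>0 complex) \<Rightarrow> 'a" where
  "lin_ext \<beta> f = (\<Sum>k\<in>Poly_Mapping.keys f. Poly_Mapping.lookup f k *\<^sub>C \<beta> k)"

lemma lin_ext_superset:
  assumes "finite S" "Poly_Mapping.keys f \<subseteq> S"
  shows "lin_ext \<beta> f = (\<Sum>k\<in>S. Poly_Mapping.lookup f k *\<^sub>C \<beta> k)"
  unfolding lin_ext_def using assms
  by (intro sum.mono_neutral_left) (auto simp: in_keys_iff)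

lemma lin_ext_add: "lin_ext \<beta> (f + g) = lin_ext \<beta> f + lin_ext \<beta> g"
proof -
  let ?S = "Poly_Mapping.keys f \<union> Poly_Mapping.keys g"
  have "lin_ext \<beta> h = (\<Sum>k\<in>?S. Poly_Mapping.lookup h k *\<^sub>C \<beta> k)" if "h \<in> {f, g, f + g}" for h
    using that Poly_Mapping.keys_add[of f g] by (intro lin_ext_superset) auto
  then show ?thesis
    by (simp add: lookup_add scaleC_add_left sum.distrib)
qed

lemma lin_ext_single: "lin_ext \<beta> (Poly_Mapping.single k c) = c *\<^sub>C \<beta> k"
  by (simp add: lin_ext_def)

lemma lin_ext_zero: "lin_ext \<beta> 0 = 0"
  by (simp add: lin_ext_def)

lemma lin_ext_minus: "lin_ext \<beta> (- f) = - lin_ext \<beta> f"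
  using lin_ext_add[of \<beta> f "- f"] by (simp add: lin_ext_zero minus_unique)

lemma lin_ext_diff: "lin_ext \<beta> (f - g) = lin_ext \<beta> f - lin_ext \<beta> g"
  using lin_ext_add[of \<beta> f "- g"] by (simp add: lin_ext_minus)

lemma lin_ext_sum: "lin_ext \<beta> (sum F A) = (\<Sum>a\<in>A. lin_ext \<beta> (F a))"
  by (induction A rule: infinite_finite_induct) (simp_all add: lin_ext_add lin_ext_zero)

lemma monom_induct [case_names single add]:
  assumes "\<And>k c. P (Poly_Mapping.single k c)"
    and "\<And>f g. P f \<Longrightarrow> P g \<Longrightarrow> P (f + g)"
  shows "P (f :: 'k \<Rightarrow>\<^sub>0 complex)"
proof -
  have "P (\<Sum>k\<in>A. Poly_Mapping.single k (Poly_Mapping.lookup f k))" if "finite A" for A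
    using that
  proof induction
    case empty
    show ?case using assms(1)[of _ 0] by simp
  next
    case (insert x F)
    then show ?case using assms by simp
  qed
  moreover have "f = (\<Sum>k\<in>Poly_Mapping.keys f. Poly_Mapping.single k (Poly_Mapping.lookup f k))"
    by (rule poly_mapping_eqI) (auto simp: lookup_sum lookup_single when_def in_keys_iff)
  ultimately show ?thesis
    by (metis finite_keys)
qed

lemma lin_ext_scale: "lin_ext \<beta> (monom_scale c f) = c *\<^sub>C lin_ext \<beta> f"
  by (induction f rule: monom_induct)
     (simp_all add: monom_scale_def mult_single lin_ext_single lin_ext_add scaleC_scaleC
       distrib_left scaleC_add_right)

lemma lin_ext_mult:
  fixes \<beta> :: "'m::monoid_add \<Rightarrow> 'a::complex_algebra_1"
  assumes "\<And>k l. \<beta> (k + l) = \<beta> k * \<beta> l"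
  shows "lin_ext \<beta> (f * g) = lin_ext \<beta> f * lin_ext \<beta> g"
proof (induction f rule: monom_induct)
  case (single k c)
  show ?case
    by (induction g rule: monom_induct)
       (simp_all add: mult_single lin_ext_single lin_ext_add assms distrib_left
         scaleC_mult_left scaleC_mult_right scaleC_scaleC scaleC_add_right)
next
  case (add f g)
  then show ?case by (simp add: distrib_right lin_ext_add)
qed

lemma monom_scale_mult_left: "monom_scale c f * g = monom_scale c (f * g)"
  by (simp add: monom_scale_def mult.assoc)

lemma monom_scale_mult_right: "f * monom_scale c g = monom_scale c (f * g)"
proof -
  have "f * Poly_Mapping.single 0 c = Poly_Mapping.single 0 c * f"
    by (induction f rule: monom_induct) (simp_all add: mult_single distrib_left distrib_right mult.commute)
  then show ?thesis
    by (simp add: monom_scale_def mult.assoc[symmetric])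
qed

lemma monom_scale_ideal: "x \<in> two_sided_ideal R \<Longrightarrow> monom_scale c x \<in> two_sided_ideal R"
  by (simp add: monom_scale_def two_sided_ideal_mult_left)

lemma monom_scale_diff: "monom_scale c (x - y) = monom_scale c x - monom_scale c y"
  by (simp add: monom_scale_def right_diff_distrib)


lemma ideal_cong_add:
  "f - f' \<in> two_sided_ideal R \<Longrightarrow> g - g' \<in> two_sided_ideal R \<Longrightarrow> (f + g) - (f' + g') \<in> two_sided_ideal R"
  using two_sided_ideal.add[of "f - f'" R "g - g'"] by (simp add: algebra_simps)

lemma ideal_cong_diff:
  "f - f' \<in> two_sided_ideal R \<Longrightarrow> g - g' \<in> two_sided_ideal R \<Longrightarrow> (f - g) - (f' - g') \<in> two_sided_ideal R"
  using two_sided_ideal_diff[of "f - f'" R "g - g'"] by (simp add: algebra_simps)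

lemma ideal_cong_minus:
  "f - f' \<in> two_sided_ideal R \<Longrightarrow> (- f) - (- f') \<in> two_sided_ideal R"
  using two_sided_ideal_minus[of "f - f'" R] by (simp add: algebra_simps)

lemma ideal_cong_mult:
  assumes "f - f' \<in> two_sided_ideal R" "g - g' \<in> two_sided_ideal R"
  shows "f * g - f' * g' \<in> two_sided_ideal R"
proof -
  have "f * g - f' * g' = (f - f') * g + f' * (g - g')"
    by (simp add: algebra_simps)
  then show ?thesis
    using assms by (simp add: two_sided_ideal.add two_sided_ideal_mult_left two_sided_ideal_mult_right)
qed

lemma ideal_cong_scale:
  "f - f' \<in> two_sided_ideal R \<Longrightarrow> monom_scale c f - monom_scale c f' \<in> two_sided_ideal R"
  using monom_scale_ideal[of "f - f'" R c] by (simp add: monom_scale_diff)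

lemma monom_algebra_laws:
  fixes f g h :: "'m::monoid_add \<Rightarrow>\<^sub>0 complex"
  shows "monom_scale c (f + g) = monom_scale c f + monom_scale c g"
    and "monom_scale (c + d) f = monom_scale c f + monom_scale d f"
    and "monom_scale c (monom_scale d f) = monom_scale (c * d) f"
    and "monom_scale 1 f = f"
  by (rule poly_mapping_eqI, simp add: lookup_monom_scale lookup_add distrib_left distrib_right)+


section \<open>The tensor product of unital complex algebras\<close>

text \<open>The multiplicative monoid \<open>A \<times> B\<close>; its monoid algebra is the free vector space on \<open>A \<times> B\<close>
  with the multiplication \<open>(a, b) (c, d) = (a c, b d)\<close>.\<close>

datatype ('a, 'b) pure = Pure (pure_fst: 'a) (pure_snd: 'b)

instantiation pure :: (monoid_mult, monoid_mult) monoid_add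
begin
definition "zero_pure = Pure 1 1"
definition "plus_pure p q = Pure (pure_fst p * pure_fst q) (pure_snd p * pure_snd q)"
instance
  by standard (simp_all add: zero_pure_def plus_pure_def mult.assoc)
end

definition bilinearity_relations ::
  "(('a::complex_algebra_1, 'b::complex_algebra_1) pure \<Rightarrow>\<^sub>0 complex) set" where
  "bilinearity_relations =
    {Poly_Mapping.single (Pure (a + a') b) 1
       - Poly_Mapping.single (Pure a b) 1 - Poly_Mapping.single (Pure a' b) 1 | a a' b. True} \<union>
    {Poly_Mapping.single (Pure a (b + b')) 1
       - Poly_Mapping.single (Pure a b) 1 - Poly_Mapping.single (Pure a b') 1 | a b b'. True} \<union>
    {Poly_Mapping.single (Pure (c *\<^sub>C a) b) 1 - Poly_Mapping.single (Pure a b) c | c a b. True} \<union>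
    {Poly_Mapping.single (Pure a (c *\<^sub>C b)) 1 - Poly_Mapping.single (Pure a b) c | c a b. True}"

text \<open>The linear span of \<^const>\<open>bilinearity_relations\<close> is already a two-sided ideal, so this quotient is
  the usual vector space tensor product together with its multiplication.\<close>

quotient_type (overloaded) ('a, 'b) tensor =
  "('a::complex_algebra_1, 'b::complex_algebra_1) pure \<Rightarrow>\<^sub>0 complex" /
  "\<lambda>f g. f - g \<in> two_sided_ideal bilinearity_relations"
  by (rule two_sided_ideal_equivp)

instantiation tensor :: (complex_algebra_1, complex_algebra_1) complex_algebra_1
begin

lift_definition zero_tensor :: "('a, 'b) tensor" is 0 .
lift_definition one_tensor :: "('a, 'b) tensor" is 1 .
lift_definition plus_tensor :: "('a, 'b) tensor \<Rightarrow> ('a, 'b) tensor \<Rightarrow> ('a, 'b) tensor" is "(+)"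
  by (rule ideal_cong_add)
lift_definition minus_tensor :: "('a, 'b) tensor \<Rightarrow> ('a, 'b) tensor \<Rightarrow> ('a, 'b) tensor" is "(-)"
  by (rule ideal_cong_diff)
lift_definition uminus_tensor :: "('a, 'b) tensor \<Rightarrow> ('a, 'b) tensor" is uminus
  by (rule ideal_cong_minus)
lift_definition times_tensor :: "('a, 'b) tensor \<Rightarrow> ('a, 'b) tensor \<Rightarrow> ('a, 'b) tensor" is "(*)"
  by (rule ideal_cong_mult)
lift_definition scaleC_tensor :: "complex \<Rightarrow> ('a, 'b) tensor \<Rightarrow> ('a, 'b) tensor" is monom_scale
  by (rule ideal_cong_scale)

instance
proof
  fix x y z :: "('a, 'b) tensor" and c d :: complex
  show "x + y + z = x + (y + z)" by transfer (simp add: add.assoc two_sided_ideal.zero)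
  show "x + y = y + x" by transfer (simp add: add.commute two_sided_ideal.zero)
  show "0 + x = x" by transfer (simp add: two_sided_ideal.zero)
  show "- x + x = 0" by transfer (simp add: two_sided_ideal.zero)
  show "x - y = x + - y" by transfer (simp add: two_sided_ideal.zero)
  show "c *\<^sub>C (x + y) = c *\<^sub>C x + c *\<^sub>C y"
    by transfer (simp add: monom_algebra_laws two_sided_ideal.zero)
  show "(c + d) *\<^sub>C x = c *\<^sub>C x + d *\<^sub>C x"
    by transfer (simp add: monom_algebra_laws two_sided_ideal.zero)
  show "c *\<^sub>C (d *\<^sub>C x) = (c * d) *\<^sub>C x"
    by transfer (simp add: monom_algebra_laws two_sided_ideal.zero)
  show "1 *\<^sub>C x = x" by transfer (simp add: monom_algebra_laws two_sided_ideal.zero)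
  show "x * y * z = x * (y * z)" by transfer (simp add: mult.assoc two_sided_ideal.zero)
  show "1 * x = x" by transfer (simp add: two_sided_ideal.zero)
  show "x * 1 = x" by transfer (simp add: two_sided_ideal.zero)
  show "(x + y) * z = x * z + y * z" by transfer (simp add: distrib_right two_sided_ideal.zero)
  show "x * (y + z) = x * y + x * z" by transfer (simp add: distrib_left two_sided_ideal.zero)
  show "(c *\<^sub>C x) * y = c *\<^sub>C (x * y)"
    by transfer (simp add: monom_scale_mult_left two_sided_ideal.zero)
  show "x * (c *\<^sub>C y) = c *\<^sub>C (x * y)"
    by transfer (simp add: monom_scale_mult_right two_sided_ideal.zero)
qed

end

lift_definition tensor_pure :: "'a::complex_algebra_1 \<Rightarrow> 'b::complex_algebra_1 \<Rightarrow> ('a, 'b) tensor"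
    (infixr \<open>\<otimes>\<^sub>C\<close> 70)
  is "\<lambda>a b. Poly_Mapping.single (Pure a b) 1" .

text \<open>The linear map on the tensor product induced by \<open>\<beta>\<close>, which must be bilinear.\<close>

definition tensor_lift ::
  "('a::complex_algebra_1 \<Rightarrow> 'b::complex_algebra_1 \<Rightarrow> 'c::complex_vector) \<Rightarrow> ('a, 'b) tensor \<Rightarrow> 'c" where
  "tensor_lift \<beta> = (THE g. clinear g \<and> (\<forall>a b. g (a \<otimes>\<^sub>C b) = \<beta> a b))"

lemma tensor_bilinear:
  fixes a a' :: "'a::complex_algebra_1" and b b' :: "'b::complex_algebra_1"
  shows "(a + a') \<otimes>\<^sub>C b = a \<otimes>\<^sub>C b + a' \<otimes>\<^sub>C b"
    and "a \<otimes>\<^sub>C (b + b') = a \<otimes>\<^sub>C b + a \<otimes>\<^sub>C b'"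
    and "(c *\<^sub>C a) \<otimes>\<^sub>C b = c *\<^sub>C (a \<otimes>\<^sub>C b)"
    and "a \<otimes>\<^sub>C (c *\<^sub>C b) = c *\<^sub>C (a \<otimes>\<^sub>C b)"
proof -
  show "(a + a') \<otimes>\<^sub>C b = a \<otimes>\<^sub>C b + a' \<otimes>\<^sub>C b"
    by transfer (rule two_sided_ideal_base, unfold bilinearity_relations_def diff_diff_add[symmetric], blast)
  show "a \<otimes>\<^sub>C (b + b') = a \<otimes>\<^sub>C b + a \<otimes>\<^sub>C b'"
    by transfer (rule two_sided_ideal_base, unfold bilinearity_relations_def diff_diff_add[symmetric], blast)
  have s: "monom_scale c (Poly_Mapping.single k 1) = Poly_Mapping.single k c"
    for k :: "('a, 'b) pure" and c
    by (simp add: monom_scale_def mult_single)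
  show "(c *\<^sub>C a) \<otimes>\<^sub>C b = c *\<^sub>C (a \<otimes>\<^sub>C b)"
    by transfer (unfold s, rule two_sided_ideal_base, unfold bilinearity_relations_def, blast)
  show "a \<otimes>\<^sub>C (c *\<^sub>C b) = c *\<^sub>C (a \<otimes>\<^sub>C b)"
    by transfer (unfold s, rule two_sided_ideal_base, unfold bilinearity_relations_def, blast)
qed

lemma tensor_mult: "(a \<otimes>\<^sub>C b) * (c \<otimes>\<^sub>C d) = (a * c) \<otimes>\<^sub>C (b * d)"
  by transfer (simp add: mult_single plus_pure_def two_sided_ideal.zero)

lemma tensor_one: "1 = 1 \<otimes>\<^sub>C 1"
  by transfer (simp add: zero_pure_def[symmetric] two_sided_ideal.zero)

lemma tensor_induct [case_names pure add]:
  assumes "\<And>a b. P (a \<otimes>\<^sub>C b)" and "\<And>s t. P s \<Longrightarrow> P t \<Longrightarrow> P (s + t)"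
  shows "P t"
proof -
  have "P (abs_tensor f)" for f
  proof (induction f rule: monom_induct)
    case (single k c)
    have "abs_tensor (Poly_Mapping.single k c) = (c *\<^sub>C pure_fst k) \<otimes>\<^sub>C pure_snd k"
      unfolding tensor_bilinear
      by (simp add: tensor_pure.abs_eq scaleC_tensor.abs_eq monom_scale_def mult_single)
    then show ?case using assms(1) by simp
  next
    case (add f g)
    then show ?case using assms(2) by (simp add: plus_tensor.abs_eq[symmetric])
  qed
  from this[of "rep_tensor t"] show ?thesis
    by (simp add: Quotient_abs_rep[OF Quotient_tensor])
qed

lemma tensor_lift_ex1:
  fixes \<beta> :: "'a::complex_algebra_1 \<Rightarrow> 'b::complex_algebra_1 \<Rightarrow> 'c::complex_vector"
  assumes "\<And>b. clinear (\<lambda>a. \<beta> a b)" and "\<And>a. clinear (\<beta> a)"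
  shows "\<exists>!g. clinear g \<and> (\<forall>a b. g (a \<otimes>\<^sub>C b) = \<beta> a b)"
proof -
  define B where "B = lin_ext (\<lambda>k. \<beta> (pure_fst k) (pure_snd k))"
  have lin: "\<beta> (a + a') b = \<beta> a b + \<beta> a' b" "\<beta> a (b + b') = \<beta> a b + \<beta> a b'"
      "\<beta> (c *\<^sub>C a) b = c *\<^sub>C \<beta> a b" "\<beta> a (c *\<^sub>C b) = c *\<^sub>C \<beta> a b" for a a' b b' c
    using assms by (auto simp: clinear_iff)
  have van1: "B (Poly_Mapping.single k c * r * Poly_Mapping.single l d) = 0"
    if "r \<in> bilinearity_relations" for k l c d r
    using that unfolding bilinearity_relations_def
    by (elim UnE CollectE exE conjE; hypsubst;
        simp add: B_def left_diff_distrib right_diff_distrib mult_single lin_ext_diff lin_ext_single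
          plus_pure_def distrib_left distrib_right lin scaleC_mult_left scaleC_mult_right
          scaleC_add_right scaleC_scaleC mult.commute mult.left_commute)
  have van2: "B (x * r * Poly_Mapping.single l d) = 0"
    if "r \<in> bilinearity_relations" for l d r x
    by (induction x rule: monom_induct)
       (use van1[OF that] in \<open>simp_all add: distrib_right B_def lin_ext_add\<close>)
  have van3: "B (x * r * y) = 0" if "r \<in> bilinearity_relations" for r x y
    by (induction y rule: monom_induct)
       (use van2[OF that] in \<open>simp_all add: distrib_left B_def lin_ext_add\<close>)
  have van: "B x = 0" if "x \<in> two_sided_ideal bilinearity_relations" for x
    using that by induction (use van3 in \<open>simp_all add: B_def lin_ext_add lin_ext_zero\<close>)
  define g where "g t = B (rep_tensor t)" for t :: "('a, 'b) tensor"
  have g_abs: "g (abs_tensor f) = B f" for f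
  proof -
    have "rep_tensor (abs_tensor f) - f \<in> two_sided_ideal bilinearity_relations"
      using Quotient_rep_abs[OF Quotient_tensor] by (simp add: two_sided_ideal.zero)
    from van[OF this] show ?thesis by (simp add: g_def B_def lin_ext_diff)
  qed
  have rep: "\<exists>f. t = abs_tensor f" for t :: "('a, 'b) tensor"
    by (rule exI[of _ "rep_tensor t"]) (simp add: Quotient_abs_rep[OF Quotient_tensor])
  have "clinear g"
    unfolding clinear_iff
  proof (intro conjI allI)
    fix x y show "g (x + y) = g x + g y"
      using rep[of x] rep[of y] by (auto simp: plus_tensor.abs_eq g_abs B_def lin_ext_add)
    fix c show "g (c *\<^sub>C x) = c *\<^sub>C g x"
      using rep[of x] by (auto simp: scaleC_tensor.abs_eq g_abs B_def lin_ext_scale)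
  qed
  moreover have "g (a \<otimes>\<^sub>C b) = \<beta> a b" for a b
    by (simp add: tensor_pure.abs_eq g_abs B_def lin_ext_single scaleC_one)
  moreover have "g' = g" if "clinear g'" "\<forall>a b. g' (a \<otimes>\<^sub>C b) = \<beta> a b" for g'
  proof
    fix t show "g' t = g t"
      by (induction t rule: tensor_induct) (use that calculation in \<open>auto simp: clinear_iff\<close>)
  qed
  ultimately show ?thesis by blast
qed

lemma tensor_lift:
  fixes \<beta> :: "'a::complex_algebra_1 \<Rightarrow> 'b::complex_algebra_1 \<Rightarrow> 'c::complex_vector"
  assumes "\<And>b. clinear (\<lambda>a. \<beta> a b)" and "\<And>a. clinear (\<beta> a)"
  shows "clinear (tensor_lift \<beta>)" and "tensor_lift \<beta> (a \<otimes>\<^sub>C b) = \<beta> a b"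
  using theI'[OF tensor_lift_ex1[of \<beta>, OF assms]] by (auto simp: tensor_lift_def)


section \<open>Compact quantum groups\<close>

text \<open>A compact quantum group is given by its Hopf star-algebra, i.e. by a star-algebra \<open>'a\<close> together
  with a coproduct \<open>\<Delta> :: 'a \<Rightarrow> ('a, 'a) tensor\<close>.\<close>

text \<open>Counit and Haar state are unique when they exist, so the definite descriptions below are harmless;
  the Haar state is the bi-invariant state.\<close>

definition is_counit :: "('a::star_algebra \<Rightarrow> ('a, 'a) tensor) \<Rightarrow> ('a \<Rightarrow> complex) \<Rightarrow> bool" where
  "is_counit \<Delta> \<epsilon> \<longleftrightarrow> clinear \<epsilon> \<and>
     (\<forall>a. tensor_lift (\<lambda>x y. \<epsilon> x *\<^sub>C y) (\<Delta> a) = a) \<and>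
     (\<forall>a. tensor_lift (\<lambda>x y. \<epsilon> y *\<^sub>C x) (\<Delta> a) = a)"

definition counit :: "('a::star_algebra \<Rightarrow> ('a, 'a) tensor) \<Rightarrow> 'a \<Rightarrow> complex" where
  "counit \<Delta> = (THE \<epsilon>. is_counit \<Delta> \<epsilon>)"

definition is_haar_state :: "('a::star_algebra \<Rightarrow> ('a, 'a) tensor) \<Rightarrow> ('a \<Rightarrow> complex) \<Rightarrow> bool" where
  "is_haar_state \<Delta> h \<longleftrightarrow> clinear h \<and> h 1 = 1 \<and> (\<forall>a. h (star a * a) \<in> \<real>\<^sub>\<ge>\<^sub>0) \<and>
     (\<forall>a. tensor_lift (\<lambda>x y. h x *\<^sub>C y) (\<Delta> a) = h a *\<^sub>C 1) \<and>
     (\<forall>a. tensor_lift (\<lambda>x y. h y *\<^sub>C x) (\<Delta> a) = h a *\<^sub>C 1)"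

definition haar_state :: "('a::star_algebra \<Rightarrow> ('a, 'a) tensor) \<Rightarrow> 'a \<Rightarrow> complex" where
  "haar_state \<Delta> = (THE h. is_haar_state \<Delta> h)"

definition adjoint_mat :: "'a::star_algebra mat \<Rightarrow> 'a mat" where
  "adjoint_mat A = mat (dim_col A) (dim_row A) (\<lambda>(i, j). star (A $$ (j, i)))"

text \<open>A scalar matrix \<open>T\<close> viewed as \<open>T \<otimes> 1\<close>.\<close>

definition scalar_mat :: "complex mat \<Rightarrow> 'a::complex_algebra_1 mat" where
  "scalar_mat T = map_mat (\<lambda>c. c *\<^sub>C 1) T"

definition unitary_representation ::
  "('a::star_algebra \<Rightarrow> ('a, 'a) tensor) \<Rightarrow> 'a mat \<Rightarrow> bool" where
  "unitary_representation \<Delta> U \<longleftrightarrow>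
     square_mat U \<and> dim_row U \<ge> 1 \<and>
     U * adjoint_mat U = 1\<^sub>m (dim_row U) \<and> adjoint_mat U * U = 1\<^sub>m (dim_row U) \<and>
     (\<forall>i<dim_row U. \<forall>j<dim_row U. \<Delta> (U $$ (i, j)) = (\<Sum>k<dim_row U. U $$ (i, k) \<otimes>\<^sub>C U $$ (k, j)))"

text \<open>Irreducible: no subspace of \<open>\<complex>\<^sup>d\<close>, given by its orthogonal projection \<open>P\<close>, is invariant
  except \<open>0\<close> and \<open>\<complex>\<^sup>d\<close>.\<close>

definition irreducible_unitary ::
  "('a::star_algebra \<Rightarrow> ('a, 'a) tensor) \<Rightarrow> 'a mat \<Rightarrow> bool" where
  "irreducible_unitary \<Delta> U \<longleftrightarrow> unitary_representation \<Delta> U \<and>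
     (\<forall>P \<in> carrier_mat (dim_row U) (dim_row U).
        P * P = P \<and> adjoint_mat P = P \<and>
        U * scalar_mat P = scalar_mat P * U * scalar_mat P \<longrightarrow>
        P = 0\<^sub>m (dim_row U) (dim_row U) \<or> P = 1\<^sub>m (dim_row U))"

definition equivalent_reps :: "'a::star_algebra mat \<Rightarrow> 'a mat \<Rightarrow> bool" where
  "equivalent_reps U V \<longleftrightarrow> dim_row U = dim_row V \<and>
     (\<exists>T \<in> carrier_mat (dim_row U) (dim_row U).
        invertible_mat T \<and> scalar_mat T * U = V * scalar_mat T)"

definition irr_representatives ::
  "('a::star_algebra \<Rightarrow> ('a, 'a) tensor) \<Rightarrow> 'a mat set \<Rightarrow> bool" where
  "irr_representatives \<Delta> Irr \<longleftrightarrow>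
     (\<forall>U\<in>Irr. irreducible_unitary \<Delta> U) \<and>
     (\<forall>V. irreducible_unitary \<Delta> V \<longrightarrow> (\<exists>!U. U \<in> Irr \<and> equivalent_reps U V))"

definition tracial :: "('a::star_algebra \<Rightarrow> complex) \<Rightarrow> bool" where
  "tracial \<phi> \<longleftrightarrow> (\<forall>a b. \<phi> (a * b) = \<phi> (b * a))"

definition central :: "'a::star_algebra mat set \<Rightarrow> ('a \<Rightarrow> complex) \<Rightarrow> bool" where
  "central Irr \<phi> \<longleftrightarrow>
     (\<forall>U\<in>Irr. \<exists>c. \<forall>i<dim_row U. \<forall>j<dim_row U. \<phi> (U $$ (i, j)) = (if i = j then c else 0))"


section \<open>The quantum permutation group\<close>

text \<open>Free unital star-algebra on \<open>p\<^sub>i\<^sub>j\<close>: the monoid algebra of words in the letters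
  \<open>p\<^sub>i\<^sub>j\<close> and \<open>p\<^sub>i\<^sub>j\<^sup>*\<close>.  The index set is the finite type \<open>'n\<close>, so \<open>N = CARD('n)\<close>.\<close>

datatype 'n letter = Gen 'n 'n | Gen_star 'n 'n

datatype 'x word = Word (letters: "'x list")

instantiation word :: (type) monoid_add
begin
definition "zero_word = Word []"
definition "plus_word v w = Word (letters v @ letters w)"
instance by standard (simp_all add: zero_word_def plus_word_def)
end

type_synonym 'n free_star_algebra = "'n letter word \<Rightarrow>\<^sub>0 complex"

fun letter_star :: "'n letter \<Rightarrow> 'n letter" where
  "letter_star (Gen i j) = Gen_star i j"
| "letter_star (Gen_star i j) = Gen i j"

definition word_star :: "'n letter word \<Rightarrow> 'n letter word" where
  "word_star w = Word (rev (map letter_star (letters w)))"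

lemma letter_star_letter_star: "letter_star (letter_star x) = x"
  by (cases x) simp_all

lemma word_star_word_star: "word_star (word_star w) = w"
  by (cases w) (simp add: word_star_def rev_map o_def letter_star_letter_star)

lemma word_star_plus: "word_star (v + w) = word_star w + word_star v"
  by (simp add: word_star_def plus_word_def)

lift_definition free_star :: "'n free_star_algebra \<Rightarrow> 'n free_star_algebra"
  is "\<lambda>f w. cnj (f (word_star w))"
proof -
  fix f :: "'n letter word \<Rightarrow> complex"
  assume "finite {w. f w \<noteq> 0}"
  moreover have "{w. cnj (f (word_star w)) \<noteq> 0} = word_star ` {w. f w \<noteq> 0}"
    by (auto simp: image_iff) (metis word_star_word_star)+
  ultimately show "finite {w. cnj (f (word_star w)) \<noteq> 0}" by simp
qed

lemma free_star_add: "free_star (f + g) = free_star f + free_star g"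
  by (rule poly_mapping_eqI) (simp add: free_star.rep_eq lookup_add)

lemma free_star_diff: "free_star (f - g) = free_star f - free_star g"
  by (rule poly_mapping_eqI) (simp add: free_star.rep_eq lookup_minus)

lemma free_star_free_star: "free_star (free_star f) = f"
  by (rule poly_mapping_eqI) (simp add: free_star.rep_eq word_star_word_star)

lemma free_star_single: "free_star (Poly_Mapping.single w c) = Poly_Mapping.single (word_star w) (cnj c)"
  by (rule poly_mapping_eqI) (auto simp: free_star.rep_eq lookup_single when_def word_star_word_star)

lemma free_star_mult: "free_star (f * g) = free_star g * free_star f"
proof (induction f rule: monom_induct)
  case (single k c)
  show ?case
    by (induction g rule: monom_induct)
       (simp_all add: free_star_single mult_single word_star_plus distrib_left distrib_right
          free_star_add mult.commute)
next
  case (add f g)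
  then show ?case by (simp add: distrib_left distrib_right free_star_add)
qed

lemma free_star_scale: "free_star (monom_scale c f) = monom_scale (cnj c) (free_star f)"
  by (rule poly_mapping_eqI) (simp add: free_star.rep_eq lookup_monom_scale)

definition free_gen :: "'n \<Rightarrow> 'n \<Rightarrow> 'n free_star_algebra" where
  "free_gen i j = Poly_Mapping.single (Word [Gen i j]) 1"

definition magic_unitary_relations :: "'n::finite free_star_algebra set" where
  "magic_unitary_relations =
     {free_gen i j - free_star (free_gen i j) | i j. True} \<union>
     {free_gen i j * free_gen i l - (if j = l then free_gen i j else 0) | i j l. True} \<union>
     {free_gen i j * free_gen l j - (if i = l then free_gen i j else 0) | i j l. True} \<union>
     {(\<Sum>k\<in>UNIV. free_gen k j) - 1 | j. True} \<union>
     {(\<Sum>k\<in>UNIV. free_gen i k) - 1 | i. True}"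

abbreviation magic_unitary_ideal :: "'n::finite free_star_algebra set" where
  "magic_unitary_ideal \<equiv>
     two_sided_ideal (magic_unitary_relations \<union> free_star ` magic_unitary_relations)"

lemma free_star_ideal: "x \<in> magic_unitary_ideal \<Longrightarrow> free_star x \<in> magic_unitary_ideal"
proof (induction rule: two_sided_ideal.induct)
  case zero
  have "free_star (0 :: 'a free_star_algebra) = 0"
    by (rule poly_mapping_eqI) (simp add: free_star.rep_eq)
  then show ?case by (simp add: two_sided_ideal.zero)
next
  case (gen r a b)
  have "free_star r \<in> magic_unitary_relations \<union> free_star ` magic_unitary_relations"
    using gen by (auto simp: free_star_free_star)
  then have "free_star b * free_star r * free_star a \<in> magic_unitary_ideal"
    by (rule two_sided_ideal.gen)
  then show ?case by (simp add: free_star_mult mult.assoc)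
next
  case (add x y)
  then show ?case by (simp add: free_star_add two_sided_ideal.add)
qed

text \<open>\<open>'n qperm\<close> is \<open>Pol(S\<^sub>N\<^sup>+)\<close> for \<open>N = CARD('n)\<close>.\<close>

quotient_type 'n qperm = "'n::finite free_star_algebra" / "\<lambda>f g. f - g \<in> magic_unitary_ideal"
  by (rule two_sided_ideal_equivp)

instantiation qperm :: (finite) star_algebra
begin

lift_definition zero_qperm :: "'a qperm" is 0 .
lift_definition one_qperm :: "'a qperm" is 1 .
lift_definition plus_qperm :: "'a qperm \<Rightarrow> 'a qperm \<Rightarrow> 'a qperm" is "(+)"
  by (rule ideal_cong_add)
lift_definition minus_qperm :: "'a qperm \<Rightarrow> 'a qperm \<Rightarrow> 'a qperm" is "(-)"
  by (rule ideal_cong_diff)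
lift_definition uminus_qperm :: "'a qperm \<Rightarrow> 'a qperm" is uminus
  by (rule ideal_cong_minus)
lift_definition times_qperm :: "'a qperm \<Rightarrow> 'a qperm \<Rightarrow> 'a qperm" is "(*)"
  by (rule ideal_cong_mult)
lift_definition scaleC_qperm :: "complex \<Rightarrow> 'a qperm \<Rightarrow> 'a qperm" is monom_scale
  by (rule ideal_cong_scale)
lift_definition star_qperm :: "'a qperm \<Rightarrow> 'a qperm" is free_star
  using free_star_ideal by (metis free_star_diff)

instance
proof
  fix x y z :: "'a qperm" and c d :: complex
  show "x + y + z = x + (y + z)" by transfer (simp add: add.assoc two_sided_ideal.zero)
  show "x + y = y + x" by transfer (simp add: add.commute two_sided_ideal.zero)
  show "0 + x = x" by transfer (simp add: two_sided_ideal.zero)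
  show "- x + x = 0" by transfer (simp add: two_sided_ideal.zero)
  show "x - y = x + - y" by transfer (simp add: two_sided_ideal.zero)
  show "c *\<^sub>C (x + y) = c *\<^sub>C x + c *\<^sub>C y"
    by transfer (simp add: monom_algebra_laws two_sided_ideal.zero)
  show "(c + d) *\<^sub>C x = c *\<^sub>C x + d *\<^sub>C x"
    by transfer (simp add: monom_algebra_laws two_sided_ideal.zero)
  show "c *\<^sub>C (d *\<^sub>C x) = (c * d) *\<^sub>C x"
    by transfer (simp add: monom_algebra_laws two_sided_ideal.zero)
  show "1 *\<^sub>C x = x" by transfer (simp add: monom_algebra_laws two_sided_ideal.zero)
  show "x * y * z = x * (y * z)" by transfer (simp add: mult.assoc two_sided_ideal.zero)
  show "1 * x = x" by transfer (simp add: two_sided_ideal.zero)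
  show "x * 1 = x" by transfer (simp add: two_sided_ideal.zero)
  show "(x + y) * z = x * z + y * z" by transfer (simp add: distrib_right two_sided_ideal.zero)
  show "x * (y + z) = x * y + x * z" by transfer (simp add: distrib_left two_sided_ideal.zero)
  show "(c *\<^sub>C x) * y = c *\<^sub>C (x * y)"
    by transfer (simp add: monom_scale_mult_left two_sided_ideal.zero)
  show "x * (c *\<^sub>C y) = c *\<^sub>C (x * y)"
    by transfer (simp add: monom_scale_mult_right two_sided_ideal.zero)
  show "star (star x) = x" by transfer (simp add: free_star_free_star two_sided_ideal.zero)
  show "star (x + y) = star x + star y" by transfer (simp add: free_star_add two_sided_ideal.zero)
  show "star (c *\<^sub>C x) = cnj c *\<^sub>C star x"
    by transfer (simp add: free_star_scale two_sided_ideal.zero)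
  show "star (x * y) = star y * star x" by transfer (simp add: free_star_mult two_sided_ideal.zero)
qed

end

lift_definition qperm_gen :: "'n::finite \<Rightarrow> 'n \<Rightarrow> 'n qperm" is free_gen .

lemma magic_relation_zero:
  "r \<in> magic_unitary_relations \<Longrightarrow> r - 0 \<in> (magic_unitary_ideal :: 'n::finite free_star_algebra set)"
  using two_sided_ideal_base[of r "magic_unitary_relations \<union> free_star ` magic_unitary_relations"]
  by simp

lemma abs_qperm_sum:
  "abs_qperm (sum F A) = (\<Sum>a\<in>A. abs_qperm (F a :: 'n::finite free_star_algebra))"
  by (induction A rule: infinite_finite_induct)
     (simp_all add: zero_qperm_def plus_qperm.abs_eq[symmetric])

lemma qperm_gen_relations:
  fixes i j l :: "'n::finite"
  shows "star (qperm_gen i j) = qperm_gen i j"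
    and "qperm_gen i j * qperm_gen i l = (if j = l then qperm_gen i j else 0)"
    and "qperm_gen i j * qperm_gen l j = (if i = l then qperm_gen i j else 0)"
    and "(\<Sum>k\<in>UNIV. qperm_gen k j) = 1"
    and "(\<Sum>k\<in>UNIV. qperm_gen i k) = 1"
proof -
  have rel: "abs_qperm f = abs_qperm g" if "f - g \<in> magic_unitary_relations"
    for f g :: "'n free_star_algebra"
    using magic_relation_zero[OF that] by (simp add: qperm.abs_eq_iff)
  have "abs_qperm (free_gen i j) = abs_qperm (free_star (free_gen i j))"
    by (rule rel) (unfold magic_unitary_relations_def, blast)
  then show "star (qperm_gen i j) = qperm_gen i j"
    by (simp add: qperm_gen.abs_eq star_qperm.abs_eq free_star_free_star)
  have "abs_qperm (free_gen i j * free_gen i l) = abs_qperm (if j = l then free_gen i j else 0)"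
    by (rule rel) (unfold magic_unitary_relations_def, blast)
  then show "qperm_gen i j * qperm_gen i l = (if j = l then qperm_gen i j else 0)"
    by (simp add: qperm_gen.abs_eq times_qperm.abs_eq zero_qperm_def split: if_splits)
  have "abs_qperm (free_gen i j * free_gen l j) = abs_qperm (if i = l then free_gen i j else 0)"
    by (rule rel) (unfold magic_unitary_relations_def, blast)
  then show "qperm_gen i j * qperm_gen l j = (if i = l then qperm_gen i j else 0)"
    by (simp add: qperm_gen.abs_eq times_qperm.abs_eq zero_qperm_def split: if_splits)
  have "abs_qperm (\<Sum>k\<in>UNIV. free_gen k j) = abs_qperm 1"
    by (rule rel) (unfold magic_unitary_relations_def, blast)
  then show "(\<Sum>k\<in>UNIV. qperm_gen k j) = 1"
    by (simp add: qperm_gen.abs_eq one_qperm_def abs_qperm_sum)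
  have "abs_qperm (\<Sum>k\<in>UNIV. free_gen i k) = abs_qperm 1"
    by (rule rel) (unfold magic_unitary_relations_def, blast)
  then show "(\<Sum>k\<in>UNIV. qperm_gen i k) = 1"
    by (simp add: qperm_gen.abs_eq one_qperm_def abs_qperm_sum)
qed

lemma qperm_induct [case_names one gen_mult scale add]:
  assumes "P 1" and "\<And>i j x. P x \<Longrightarrow> P (qperm_gen i j * x)"
    and "\<And>c x. P x \<Longrightarrow> P (c *\<^sub>C x)" and "\<And>x y. P x \<Longrightarrow> P y \<Longrightarrow> P (x + y)"
  shows "P (x :: 'n::finite qperm)"
proof -
  have word: "P (abs_qperm (Poly_Mapping.single (Word xs) 1))" for xs :: "'n letter list"
  proof (induction xs)
    case Nil
    then show ?case using assms(1) by (simp add: one_qperm_def zero_word_def[symmetric])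
  next
    case (Cons a xs)
    have "abs_qperm (Poly_Mapping.single (Word [a]) 1) \<in> range (\<lambda>(i, j). qperm_gen i j)"
    proof (cases a)
      case (Gen i j)
      then show ?thesis by (auto simp: qperm_gen.abs_eq free_gen_def)
    next
      case (Gen_star i j)
      then have "abs_qperm (Poly_Mapping.single (Word [a]) 1) = star (qperm_gen i j)"
        by (simp add: qperm_gen.abs_eq star_qperm.abs_eq free_gen_def free_star_single word_star_def)
      then show ?thesis by (auto simp: qperm_gen_relations)
    qed
    then obtain i j where "abs_qperm (Poly_Mapping.single (Word [a]) 1) = qperm_gen i j" by auto
    moreover have "Poly_Mapping.single (Word (a # xs)) 1 =
        Poly_Mapping.single (Word [a]) 1 * (Poly_Mapping.single (Word xs) 1 :: 'n free_star_algebra)"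
      by (simp add: mult_single plus_word_def)
    ultimately have "abs_qperm (Poly_Mapping.single (Word (a # xs)) 1) =
        qperm_gen i j * abs_qperm (Poly_Mapping.single (Word xs) 1)"
      by (simp add: times_qperm.abs_eq[symmetric])
    then show ?case using assms(2) Cons by simp
  qed
  have "P (abs_qperm f)" for f
  proof (induction f rule: monom_induct)
    case (single k c)
    have "abs_qperm (Poly_Mapping.single k c) = c *\<^sub>C abs_qperm (Poly_Mapping.single k 1)"
      by (simp add: scaleC_qperm.abs_eq monom_scale_def mult_single)
    then show ?case using word[of "letters k"] assms(3) by simp
  next
    case (add f g)
    then show ?case using assms(4) by (simp add: plus_qperm.abs_eq[symmetric])
  qed
  from this[of "rep_qperm x"] show ?thesis
    by (simp add: Quotient_abs_rep[OF Quotient_qperm])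
qed

lemma qperm_universal:
  fixes q :: "'n::finite \<Rightarrow> 'n \<Rightarrow> 'a::complex_algebra_1"
  assumes row: "\<And>i j l. q i j * q i l = (if j = l then q i j else 0)"
    and col: "\<And>i j l. q i j * q l j = (if i = l then q i j else 0)"
    and sums: "\<And>j. (\<Sum>k\<in>UNIV. q k j) = 1" "\<And>i. (\<Sum>k\<in>UNIV. q i k) = 1"
  shows "\<exists>!f. unital_algebra_hom f \<and> (\<forall>i j. f (qperm_gen i j) = q i j)"
proof -
  define v where "v = case_letter q q"
  define E where "E = lin_ext (\<lambda>w. prod_list (map v (letters w)))"
  have E_mult: "E (f * g) = E f * E g" for f g
    unfolding E_def by (rule lin_ext_mult) (simp add: plus_word_def)
  have E_gen: "E (free_gen i j) = q i j" "E (free_star (free_gen i j)) = q i j" for i j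
    by (simp_all add: E_def free_gen_def free_star_single word_star_def lin_ext_single v_def scaleC_one)
  have E_one: "E 1 = 1" "E (free_star 1) = 1"
  proof -
    have "E (Poly_Mapping.single 0 1) = 1" "E (free_star (Poly_Mapping.single 0 1)) = 1"
      by (simp_all add: E_def lin_ext_single zero_word_def scaleC_one free_star_single word_star_def)
    then show "E 1 = 1" "E (free_star 1) = 1" by (simp_all only: single_one)
  qed
  have E_add: "E (f + g) = E f + E g" and E_diff: "E (f - g) = E f - E g" and E_zero: "E 0 = 0"
    and E_sum: "E (sum F A) = (\<Sum>a\<in>A. E (F a))" for f g F and A :: "'n set"
    by (simp_all add: E_def lin_ext_add lin_ext_diff lin_ext_zero lin_ext_sum)
  have star_zero: "free_star 0 = (0 :: 'n free_star_algebra)"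
    using free_star_diff[of 0 "0 :: 'n free_star_algebra"] by simp
  have star_sum: "free_star (sum F A) = (\<Sum>a\<in>A. free_star (F a))"
    for F :: "'n \<Rightarrow> 'n free_star_algebra" and A
    by (induction A rule: infinite_finite_induct) (simp_all add: star_zero free_star_add)
  have van1: "E r = 0 \<and> E (free_star r) = 0" if "r \<in> magic_unitary_relations" for r
    using that unfolding magic_unitary_relations_def
    by (auto simp: E_diff E_gen E_mult E_one E_sum E_zero row col sums free_star_diff free_star_mult
        free_star_free_star star_sum star_zero)
  have van: "E x = 0" if "x \<in> magic_unitary_ideal" for x
    using that
  proof induction
    case (gen r a b)
    then have "E r = 0" using van1 by auto
    then show ?case by (simp add: E_mult)
  qed (simp_all add: E_zero E_add)
  define g where "g x = E (rep_qperm x)" for x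
  have g_abs: "g (abs_qperm f) = E f" for f
  proof -
    have "rep_qperm (abs_qperm f) - f \<in> magic_unitary_ideal"
      using Quotient_rep_abs[OF Quotient_qperm] by (simp add: two_sided_ideal.zero)
    from van[OF this] show ?thesis by (simp add: g_def E_diff)
  qed
  have rep: "\<exists>f. x = abs_qperm f" for x :: "'n qperm"
    by (rule exI[of _ "rep_qperm x"]) (simp add: Quotient_abs_rep[OF Quotient_qperm])
  have "unital_algebra_hom g"
    unfolding unital_algebra_hom_def clinear_iff
  proof (intro conjI allI)
    show "g 1 = 1" by (simp add: one_qperm_def g_abs E_one)
    fix x y
    show "g (x + y) = g x + g y"
      using rep[of x] rep[of y] by (auto simp: plus_qperm.abs_eq g_abs E_add)
    show "g (x * y) = g x * g y"
      using rep[of x] rep[of y] by (auto simp: times_qperm.abs_eq g_abs E_mult)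
    fix c show "g (c *\<^sub>C x) = c *\<^sub>C g x"
      using rep[of x] by (auto simp: scaleC_qperm.abs_eq g_abs E_def lin_ext_scale)
  qed
  moreover have "g (qperm_gen i j) = q i j" for i j
    by (simp add: qperm_gen.abs_eq g_abs E_gen)
  moreover have "g' = g" if "unital_algebra_hom g'" "\<forall>i j. g' (qperm_gen i j) = q i j" for g'
  proof
    fix x show "g' x = g x"
      by (induction x rule: qperm_induct)
         (use that calculation in \<open>simp_all add: unital_algebra_hom_def clinear_iff\<close>)
  qed
  ultimately show ?thesis by blast
qed

text \<open>The \<open>p\<^sub>i\<^sub>j\<close> are self-adjoint and hence generate \<open>'n qperm\<close> as an algebra, so the coproduct is
  already determined as a homomorphism of unital algebras.\<close>

definition qperm_comult :: "'n::finite qperm \<Rightarrow> ('n qperm, 'n qperm) tensor" where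
  "qperm_comult = (THE \<Delta>. unital_algebra_hom \<Delta> \<and>
     (\<forall>i j. \<Delta> (qperm_gen i j) = (\<Sum>k\<in>UNIV. qperm_gen i k \<otimes>\<^sub>C qperm_gen k j)))"

lemma tensor_zero: "0 \<otimes>\<^sub>C b = 0" "a \<otimes>\<^sub>C 0 = 0"
  using tensor_bilinear(1)[of 0 0 b] tensor_bilinear(2)[of a 0 0] by simp_all

lemma tensor_sum:
  "sum F A \<otimes>\<^sub>C b = (\<Sum>i\<in>A. F i \<otimes>\<^sub>C b)" "b \<otimes>\<^sub>C sum F A = (\<Sum>i\<in>A. b \<otimes>\<^sub>C F i)"
  by (induction A rule: infinite_finite_induct; simp add: tensor_zero tensor_bilinear)+

lemma qperm_comult:
  fixes i j :: "'a::finite"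
  shows "unital_algebra_hom (qperm_comult :: 'a qperm \<Rightarrow> _)"
    and "qperm_comult (qperm_gen i j) = (\<Sum>k\<in>UNIV. qperm_gen i k \<otimes>\<^sub>C qperm_gen k j)"
proof -
  let ?q = "\<lambda>i j. \<Sum>k\<in>UNIV. qperm_gen i k \<otimes>\<^sub>C (qperm_gen k j :: 'a qperm)"
  have prod: "?q i j * ?q i' l =
      (\<Sum>k\<in>UNIV. \<Sum>m\<in>UNIV. (qperm_gen i k * qperm_gen i' m) \<otimes>\<^sub>C (qperm_gen k j * qperm_gen m l))"
    for i j i' l
    by (simp add: sum_product tensor_mult)
  have row: "?q i j * ?q i l = (if j = l then ?q i j else 0)" for i j l
  proof -
    have "?q i j * ?q i l = (\<Sum>k\<in>UNIV. \<Sum>m\<in>UNIV.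
        if k = m then qperm_gen i k \<otimes>\<^sub>C (qperm_gen k j * qperm_gen k l) else 0)"
      unfolding prod by (intro sum.cong refl) (auto simp: qperm_gen_relations tensor_zero)
    then show ?thesis by (simp add: qperm_gen_relations tensor_zero)
  qed
  have col: "?q i j * ?q l j = (if i = l then ?q i j else 0)" for i j l
  proof -
    have "?q i j * ?q l j = (\<Sum>k\<in>UNIV. \<Sum>m\<in>UNIV.
        if k = m then (qperm_gen i k * qperm_gen l k) \<otimes>\<^sub>C qperm_gen k j else 0)"
      unfolding prod by (intro sum.cong refl) (auto simp: qperm_gen_relations tensor_zero)
    then show ?thesis by (simp add: qperm_gen_relations tensor_zero)
  qed
  have sums: "(\<Sum>i\<in>UNIV. ?q i j) = 1" "(\<Sum>j\<in>UNIV. ?q i j) = 1" for i j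
    by (subst sum.swap, simp add: tensor_sum[symmetric] qperm_gen_relations tensor_one)+
  note * = theI'[OF qperm_universal[of ?q, OF row col sums], folded qperm_comult_def]
  from * show "unital_algebra_hom (qperm_comult :: 'a qperm \<Rightarrow> _)" ..
  from * show "qperm_comult (qperm_gen i j) = (\<Sum>k\<in>UNIV. qperm_gen i k \<otimes>\<^sub>C (qperm_gen k j :: 'a qperm))"
    by blast
qed


section \<open>The universal C*-completion\<close>

definition (in star_algebra) cstar_seminorm :: "('a \<Rightarrow> real) \<Rightarrow> bool" where
  "cstar_seminorm q \<longleftrightarrow>
     (\<forall>x. 0 \<le> q x) \<and> (\<forall>x y. q (x + y) \<le> q x + q y) \<and> (\<forall>c x. q (c *\<^sub>C x) = cmod c * q x) \<and>
     (\<forall>x y. q (x * y) \<le> q x * q y) \<and> (\<forall>x. q (star x * x) = (q x)\<^sup>2)"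

text \<open>The universal C*-norm is the largest C*-seminorm; this class is where it is finite.\<close>

class cstar_bounded_algebra = star_algebra +
  assumes bdd_above_cstar_seminorms: "bdd_above {q a | q. cstar_seminorm q}"

definition univ_norm :: "'a::cstar_bounded_algebra \<Rightarrow> real" where
  "univ_norm a = Sup {q a | q. cstar_seminorm q}"

lemma cstar_seminorm_le_univ_norm: "cstar_seminorm q \<Longrightarrow> q a \<le> univ_norm a"
  unfolding univ_norm_def by (rule cSup_upper[OF _ bdd_above_cstar_seminorms]) auto

lemma univ_norm_least:
  assumes "\<And>q. cstar_seminorm q \<Longrightarrow> q a \<le> B"
  shows "univ_norm a \<le> B"
proof -
  have "cstar_seminorm (\<lambda>_::'a. 0)" by (simp add: cstar_seminorm_def)
  then show ?thesis
    unfolding univ_norm_def using assms by (intro cSup_least) auto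
qed

lemma cstar_seminorm_univ_norm: "cstar_seminorm (univ_norm :: 'a::cstar_bounded_algebra \<Rightarrow> real)"
  unfolding cstar_seminorm_def
proof (intro conjI allI)
  fix x y :: 'a and c :: complex
  note le = cstar_seminorm_le_univ_norm
  have zero: "cstar_seminorm (\<lambda>_::'a. 0)" by (simp add: cstar_seminorm_def)
  show nonneg: "0 \<le> univ_norm x" for x :: 'a using le[OF zero] .
  show "univ_norm (x + y) \<le> univ_norm x + univ_norm y"
  proof (rule univ_norm_least)
    fix q :: "'a \<Rightarrow> real" assume q: "cstar_seminorm q"
    then have "q (x + y) \<le> q x + q y" by (simp add: cstar_seminorm_def)
    then show "q (x + y) \<le> univ_norm x + univ_norm y" using le[OF q, of x] le[OF q, of y] by simp
  qed
  show "univ_norm (x * y) \<le> univ_norm x * univ_norm y"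
  proof (rule univ_norm_least)
    fix q :: "'a \<Rightarrow> real" assume q: "cstar_seminorm q"
    then have "q (x * y) \<le> q x * q y" by (simp add: cstar_seminorm_def)
    also have "\<dots> \<le> univ_norm x * univ_norm y"
      using q by (intro mult_mono le nonneg) (auto simp: cstar_seminorm_def)
    finally show "q (x * y) \<le> univ_norm x * univ_norm y" .
  qed
  have scale_le: "univ_norm (c *\<^sub>C x) \<le> cmod c * univ_norm x" for c and x :: 'a
  proof (rule univ_norm_least)
    fix q :: "'a \<Rightarrow> real" assume q: "cstar_seminorm q"
    then have "q (c *\<^sub>C x) = cmod c * q x" by (simp add: cstar_seminorm_def)
    then show "q (c *\<^sub>C x) \<le> cmod c * univ_norm x" using le[OF q, of x] by (simp add: mult_left_mono)
  qed
  show "univ_norm (c *\<^sub>C x) = cmod c * univ_norm x"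
  proof (cases "c = 0")
    case True
    then show ?thesis using scale_le[of c x] nonneg[of "c *\<^sub>C x"] by simp
  next
    case False
    have "univ_norm (inverse c *\<^sub>C (c *\<^sub>C x)) \<le> cmod (inverse c) * univ_norm (c *\<^sub>C x)"
      by (rule scale_le)
    then have "cmod c * univ_norm x \<le> univ_norm (c *\<^sub>C x)"
      using False by (simp add: scaleC_scaleC scaleC_one norm_inverse norm_divide field_simps)
    then show ?thesis using scale_le[of c x] by simp
  qed
  show "univ_norm (star x * x) = (univ_norm x)\<^sup>2"
  proof (rule antisym)
    show "univ_norm (star x * x) \<le> (univ_norm x)\<^sup>2"
    proof (rule univ_norm_least)
      fix q :: "'a \<Rightarrow> real" assume q: "cstar_seminorm q"
      then have "q (star x * x) = (q x)\<^sup>2" "0 \<le> q x" by (simp_all add: cstar_seminorm_def)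
      then show "q (star x * x) \<le> (univ_norm x)\<^sup>2" using le[OF q, of x] by (simp add: power_mono)
    qed
    have "univ_norm x \<le> sqrt (univ_norm (star x * x))"
    proof (rule univ_norm_least)
      fix q :: "'a \<Rightarrow> real" assume q: "cstar_seminorm q"
      then have "q (star x * x) = (q x)\<^sup>2" "0 \<le> q x" by (simp_all add: cstar_seminorm_def)
      then show "q x \<le> sqrt (univ_norm (star x * x))"
        using le[OF q, of "star x * x"] by (simp add: real_le_rsqrt)
    qed
    then have "(univ_norm x)\<^sup>2 \<le> (sqrt (univ_norm (star x * x)))\<^sup>2"
      by (intro power_mono nonneg)
    then show "(univ_norm x)\<^sup>2 \<le> univ_norm (star x * x)"
      by (simp add: nonneg)
  qed
qed

lemma univ_norm:
  fixes x y :: "'a::cstar_bounded_algebra"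
  shows univ_norm_nonneg: "0 \<le> univ_norm x"
    and univ_norm_add: "univ_norm (x + y) \<le> univ_norm x + univ_norm y"
    and univ_norm_scale: "univ_norm (c *\<^sub>C x) = cmod c * univ_norm x"
    and univ_norm_mult: "univ_norm (x * y) \<le> univ_norm x * univ_norm y"
    and univ_norm_cstar: "univ_norm (star x * x) = (univ_norm x)\<^sup>2"
  using cstar_seminorm_univ_norm[where 'a = 'a] by (simp_all add: cstar_seminorm_def)

lemma univ_norm_zero: "univ_norm 0 = 0"
  using univ_norm_scale[of 0 "0::'a"] by simp

lemma univ_norm_minus: "univ_norm (- x) = univ_norm x"
  using univ_norm_scale[of "- 1" x] by (simp add: cvec.scale_minus_left scaleC_one)

lemma univ_norm_minus_commute: "univ_norm (x - y) = univ_norm (y - x)"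
  using univ_norm_minus[of "x - y"] by simp

lemma univ_norm_triangle: "univ_norm (x - z) \<le> univ_norm (x - y) + univ_norm (y - z)"
  using univ_norm_add[of "x - y" "y - z"] by simp

lemma univ_norm_diff_le: "\<bar>univ_norm x - univ_norm y\<bar> \<le> univ_norm (x - y)"
  using univ_norm_add[of "x - y" y] univ_norm_add[of "y - x" x] univ_norm_minus_commute[of x y] by simp

lemma univ_norm_star: "univ_norm (star x) = univ_norm x"
proof -
  have le: "univ_norm x \<le> univ_norm (star x)" for x :: 'a
  proof (cases "univ_norm x = 0")
    case False
    have "univ_norm x * univ_norm x \<le> univ_norm (star x) * univ_norm x"
      using univ_norm_mult[of "star x" x] by (simp add: univ_norm_cstar power2_eq_square)
    then show ?thesis using False univ_norm_nonneg[of x] by simp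
  qed (simp add: univ_norm_nonneg)
  show ?thesis using le[of x] le[of "star x"] by (simp add: star_star)
qed

text \<open>The completion, as Cauchy sequences modulo null sequences.\<close>

definition univ_Cauchy :: "(nat \<Rightarrow> 'a::cstar_bounded_algebra) \<Rightarrow> bool" where
  "univ_Cauchy u \<longleftrightarrow> (\<forall>e>0. \<exists>M. \<forall>m\<ge>M. \<forall>n\<ge>M. univ_norm (u m - u n) < e)"

definition univ_null :: "(nat \<Rightarrow> 'a::cstar_bounded_algebra) \<Rightarrow> bool" where
  "univ_null u \<longleftrightarrow> (\<lambda>n. univ_norm (u n)) \<longlonglongrightarrow> 0"

lemma univ_null_bound:
  assumes "F \<longlonglongrightarrow> 0" "\<And>n. univ_norm (u n) \<le> F n"
  shows "univ_null u"
  unfolding univ_null_def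
  by (rule tendsto_sandwich[OF _ _ tendsto_const assms(1)]) (simp_all add: assms(2) univ_norm_nonneg)

lemma univ_null_add:
  assumes "univ_null u" "univ_null v" shows "univ_null (\<lambda>n. u n + v n)"
proof (rule univ_null_bound)
  show "(\<lambda>n. univ_norm (u n) + univ_norm (v n)) \<longlonglongrightarrow> 0"
    using tendsto_add[OF assms[unfolded univ_null_def]] by simp
qed (rule univ_norm_add)

lemma univ_null_scale: "univ_null u \<Longrightarrow> univ_null (\<lambda>n. c *\<^sub>C u n)"
  unfolding univ_null_def univ_norm_scale using tendsto_mult_left[of _ 0 sequentially "cmod c"] by simp

lemma univ_null_minus: "univ_null u \<Longrightarrow> univ_null (\<lambda>n. - u n)"
  by (simp add: univ_null_def univ_norm_minus)

lemma univ_null_star: "univ_null u \<Longrightarrow> univ_null (\<lambda>n. star (u n))"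
  by (simp add: univ_null_def univ_norm_star)

lemma univ_null_zero: "univ_null (\<lambda>n. 0)"
  by (simp add: univ_null_def univ_norm_zero)

lemma univ_Cauchy_const: "univ_Cauchy (\<lambda>n. a)"
  by (simp add: univ_Cauchy_def univ_norm_zero)

lemma univ_Cauchy_bounded:
  assumes "univ_Cauchy u" obtains K where "K > 0" "\<And>n. univ_norm (u n) \<le> K"
proof -
  obtain M where M: "\<And>m n. m \<ge> M \<Longrightarrow> n \<ge> M \<Longrightarrow> univ_norm (u m - u n) < 1"
    using assms[unfolded univ_Cauchy_def, rule_format, of 1] by auto
  define K where "K = (\<Sum>n\<le>M. univ_norm (u n)) + 1"
  have "univ_norm (u n) \<le> K" for n
  proof (cases "n \<le> M")
    case True
    then have "univ_norm (u n) \<le> (\<Sum>n\<le>M. univ_norm (u n))"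
      by (intro member_le_sum) (auto simp: univ_norm_nonneg)
    then show ?thesis by (simp add: K_def)
  next
    case False
    have "univ_norm (u M) \<le> (\<Sum>n\<le>M. univ_norm (u n))"
      by (intro member_le_sum) (auto simp: univ_norm_nonneg)
    moreover have "univ_norm (u n) \<le> univ_norm (u n - u M) + univ_norm (u M)"
      using univ_norm_add[of "u n - u M" "u M"] by simp
    ultimately show ?thesis using M[of n M] False by (simp add: K_def)
  qed
  moreover have "K > 0"
    unfolding K_def by (intro add_nonneg_pos sum_nonneg) (auto simp: univ_norm_nonneg)
  ultimately show thesis using that by blast
qed

lemma univ_Cauchy_bound:
  assumes "univ_Cauchy u" "univ_Cauchy v" "K > 0"
    and "\<And>m n. univ_norm (w m - w n) \<le> K * (univ_norm (u m - u n) + univ_norm (v m - v n))"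
  shows "univ_Cauchy w"
  unfolding univ_Cauchy_def
proof (intro allI impI)
  fix e :: real assume "e > 0"
  then have e: "e / (2 * K) > 0" using assms(3) by simp
  obtain M1 where M1: "\<forall>m\<ge>M1. \<forall>n\<ge>M1. univ_norm (u m - u n) < e / (2 * K)"
    using assms(1) e unfolding univ_Cauchy_def by blast
  obtain M2 where M2: "\<forall>m\<ge>M2. \<forall>n\<ge>M2. univ_norm (v m - v n) < e / (2 * K)"
    using assms(2) e unfolding univ_Cauchy_def by blast
  show "\<exists>M. \<forall>m\<ge>M. \<forall>n\<ge>M. univ_norm (w m - w n) < e"
  proof (intro exI allI impI)
    fix m n assume mn: "m \<ge> max M1 M2" "n \<ge> max M1 M2"
    have "univ_norm (w m - w n) \<le> K * (univ_norm (u m - u n) + univ_norm (v m - v n))"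
      by (rule assms(4))
    also have "\<dots> < K * (e / (2 * K) + e / (2 * K))"
      using M1 M2 mn assms(3) by (intro mult_strict_left_mono add_strict_mono) auto
    also have "\<dots> = e" using assms(3) by (simp add: field_simps)
    finally show "univ_norm (w m - w n) < e" .
  qed
qed

lemma univ_Cauchy_add:
  assumes "univ_Cauchy u" "univ_Cauchy v" shows "univ_Cauchy (\<lambda>n. u n + v n)"
proof (rule univ_Cauchy_bound[OF assms, of 1])
  fix m n
  show "univ_norm (u m + v m - (u n + v n)) \<le> 1 * (univ_norm (u m - u n) + univ_norm (v m - v n))"
    using univ_norm_add[of "u m - u n" "v m - v n"] by (simp add: algebra_simps)
qed simp

lemma univ_Cauchy_scale:
  assumes "univ_Cauchy u" shows "univ_Cauchy (\<lambda>n. c *\<^sub>C u n)"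
proof (rule univ_Cauchy_bound[OF assms assms, of "cmod c + 1"])
  fix m n
  show "univ_norm (c *\<^sub>C u m - c *\<^sub>C u n)
      \<le> (cmod c + 1) * (univ_norm (u m - u n) + univ_norm (u m - u n))"
    using univ_norm_scale[of c "u m - u n"] univ_norm_nonneg[of "u m - u n"]
    by (simp add: cvec.scale_right_diff_distrib distrib_right distrib_left)
qed (simp add: add_nonneg_pos)

lemma univ_Cauchy_minus: "univ_Cauchy u \<Longrightarrow> univ_Cauchy (\<lambda>n. - u n)"
  using univ_Cauchy_scale[of u "- 1"] by (simp add: cvec.scale_minus_left scaleC_one)

lemma univ_Cauchy_star: "univ_Cauchy u \<Longrightarrow> univ_Cauchy (\<lambda>n. star (u n))"
  by (simp add: univ_Cauchy_def star_diff[symmetric] univ_norm_star)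

lemma univ_norm_mult_diff:
  "univ_norm (a * b - a' * b') \<le> univ_norm (a - a') * univ_norm b + univ_norm a' * univ_norm (b - b')"
proof -
  have "a * b - a' * b' = (a - a') * b + a' * (b - b')"
    by (simp add: algebra_simps)
  then show ?thesis
    using univ_norm_add[of "(a - a') * b" "a' * (b - b')"] univ_norm_mult[of "a - a'" b]
      univ_norm_mult[of a' "b - b'"] by simp
qed

lemma univ_Cauchy_mult:
  assumes "univ_Cauchy u" "univ_Cauchy v" shows "univ_Cauchy (\<lambda>n. u n * v n)"
proof -
  obtain K L where K: "K > 0" "\<And>n. univ_norm (u n) \<le> K" and L: "L > 0" "\<And>n. univ_norm (v n) \<le> L"
    using assms univ_Cauchy_bounded by meson
  show ?thesis
  proof (rule univ_Cauchy_bound[OF assms, of "K + L"])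
    fix m n
    have "univ_norm (u m * v m - u n * v n)
        \<le> univ_norm (u m - u n) * univ_norm (v m) + univ_norm (u n) * univ_norm (v m - v n)"
      by (rule univ_norm_mult_diff)
    also have "\<dots> \<le> univ_norm (u m - u n) * (K + L) + (K + L) * univ_norm (v m - v n)"
      using K L by (intro add_mono mult_mono) (auto simp: univ_norm_nonneg add_increasing add_increasing2)
    finally show "univ_norm (u m * v m - u n * v n)
        \<le> (K + L) * (univ_norm (u m - u n) + univ_norm (v m - v n))"
      by (simp add: algebra_simps)
  qed (use K L in simp)
qed

lemma univ_null_mult:
  assumes "univ_Cauchy u'" "univ_Cauchy v" "univ_null (\<lambda>n. u n - u' n)" "univ_null (\<lambda>n. v n - v' n)"
  shows "univ_null (\<lambda>n. u n * v n - u' n * v' n)"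
proof -
  obtain K L where K: "K > 0" "\<And>n. univ_norm (u' n) \<le> K" and L: "L > 0" "\<And>n. univ_norm (v n) \<le> L"
    using assms univ_Cauchy_bounded by meson
  show ?thesis
  proof (rule univ_null_bound)
    show "(\<lambda>n. univ_norm (u n - u' n) * L + K * univ_norm (v n - v' n)) \<longlonglongrightarrow> 0"
      using assms(3,4) unfolding univ_null_def
      by (auto intro!: tendsto_eq_intros)
    fix n
    show "univ_norm (u n * v n - u' n * v' n)
        \<le> univ_norm (u n - u' n) * L + K * univ_norm (v n - v' n)"
      by (rule order.trans[OF univ_norm_mult_diff])
         (use K L in \<open>intro add_mono mult_mono, auto simp: univ_norm_nonneg less_imp_le\<close>)
  qed
qed

quotient_type (overloaded) 'a cstar_completion = "nat \<Rightarrow> 'a::cstar_bounded_algebra" /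
  partial: "\<lambda>u v. univ_Cauchy u \<and> univ_Cauchy v \<and> univ_null (\<lambda>n. u n - v n)"
proof (rule part_equivpI)
  show "\<exists>u :: nat \<Rightarrow> 'a. univ_Cauchy u \<and> univ_Cauchy u \<and> univ_null (\<lambda>n. u n - u n)"
    by (rule exI[of _ "\<lambda>n. 0"]) (simp add: univ_Cauchy_const univ_null_zero)
  show "symp (\<lambda>u v :: nat \<Rightarrow> 'a. univ_Cauchy u \<and> univ_Cauchy v \<and> univ_null (\<lambda>n. u n - v n))"
    by (rule sympI) (auto dest: univ_null_minus)
  show "transp (\<lambda>u v :: nat \<Rightarrow> 'a. univ_Cauchy u \<and> univ_Cauchy v \<and> univ_null (\<lambda>n. u n - v n))"
  proof (rule transpI, safe)
    fix u v w :: "nat \<Rightarrow> 'a"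
    assume "univ_null (\<lambda>n. u n - v n)" "univ_null (\<lambda>n. v n - w n)"
    from univ_null_add[OF this] show "univ_null (\<lambda>n. u n - w n)" by simp
  qed
qed

lemma univ_norm_convergent:
  assumes "univ_Cauchy u" shows "convergent (\<lambda>n. univ_norm (u n))"
proof (rule Cauchy_convergent, rule metric_CauchyI)
  fix e :: real assume "e > 0"
  then obtain M where "\<forall>m\<ge>M. \<forall>n\<ge>M. univ_norm (u m - u n) < e"
    using assms unfolding univ_Cauchy_def by blast
  then show "\<exists>M. \<forall>m\<ge>M. \<forall>n\<ge>M. dist (univ_norm (u m)) (univ_norm (u n)) < e"
    using univ_norm_diff_le by (metis dist_real_def le_less_trans)
qed

lemma univ_norm_tendsto_unique:
  assumes "univ_null (\<lambda>n. u n - v n)" "(\<lambda>n. univ_norm (v n)) \<longlonglongrightarrow> l"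
  shows "(\<lambda>n. univ_norm (u n)) \<longlonglongrightarrow> l"
proof -
  have "(\<lambda>n. univ_norm (u n) - univ_norm (v n)) \<longlonglongrightarrow> 0"
    by (rule tendsto_0_le[OF assms(1)[unfolded univ_null_def], where K = 1])
       (simp add: univ_norm_diff_le univ_norm_nonneg)
  from tendsto_add[OF this assms(2)] show ?thesis by simp
qed

instantiation cstar_completion :: (cstar_bounded_algebra) star_algebra
begin

lift_definition zero_cstar_completion :: "'a cstar_completion" is "\<lambda>n. 0"
  by (simp add: univ_Cauchy_const univ_null_zero)
lift_definition one_cstar_completion :: "'a cstar_completion" is "\<lambda>n. 1"
  by (simp add: univ_Cauchy_const univ_null_zero)
lift_definition plus_cstar_completion ::
    "'a cstar_completion \<Rightarrow> 'a cstar_completion \<Rightarrow> 'a cstar_completion"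
  is "\<lambda>u v n. u n + v n"
  by (auto simp: univ_Cauchy_add add_diff_add intro: univ_null_add)
lift_definition uminus_cstar_completion :: "'a cstar_completion \<Rightarrow> 'a cstar_completion"
  is "\<lambda>u n. - u n"
  by (auto simp: univ_Cauchy_minus dest: univ_null_minus)
lift_definition minus_cstar_completion ::
    "'a cstar_completion \<Rightarrow> 'a cstar_completion \<Rightarrow> 'a cstar_completion"
  is "\<lambda>u v n. u n - v n"
proof -
  fix u u' v v' :: "nat \<Rightarrow> 'a"
  assume 1: "univ_Cauchy u \<and> univ_Cauchy u' \<and> univ_null (\<lambda>n. u n - u' n)"
    and 2: "univ_Cauchy v \<and> univ_Cauchy v' \<and> univ_null (\<lambda>n. v n - v' n)"
  have "univ_null (\<lambda>n. (u n - u' n) + - (v n - v' n))"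
    using 1 2 by (intro univ_null_add univ_null_minus) auto
  moreover have "univ_Cauchy (\<lambda>n. u n + - v n)" "univ_Cauchy (\<lambda>n. u' n + - v' n)"
    using 1 2 by (intro univ_Cauchy_add univ_Cauchy_minus; simp)+
  ultimately show "univ_Cauchy (\<lambda>n. u n - v n) \<and> univ_Cauchy (\<lambda>n. u' n - v' n) \<and>
      univ_null (\<lambda>n. u n - v n - (u' n - v' n))"
    by (simp add: algebra_simps)
qed
lift_definition times_cstar_completion ::
    "'a cstar_completion \<Rightarrow> 'a cstar_completion \<Rightarrow> 'a cstar_completion"
  is "\<lambda>u v n. u n * v n"
  by (auto simp: univ_Cauchy_mult intro: univ_null_mult)
lift_definition scaleC_cstar_completion :: "complex \<Rightarrow> 'a cstar_completion \<Rightarrow> 'a cstar_completion"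
  is "\<lambda>c u n. c *\<^sub>C u n"
  by (auto simp: univ_Cauchy_scale cvec.scale_right_diff_distrib[symmetric] intro: univ_null_scale)
lift_definition star_cstar_completion :: "'a cstar_completion \<Rightarrow> 'a cstar_completion"
  is "\<lambda>u n. star (u n)"
  by (auto simp: univ_Cauchy_star star_diff[symmetric] intro: univ_null_star)

instance
proof
  fix x y z :: "'a cstar_completion" and c d :: complex
  note [simp] = univ_Cauchy_add univ_Cauchy_mult univ_Cauchy_scale univ_Cauchy_star
    univ_Cauchy_minus univ_Cauchy_const univ_null_zero
  show "x + y + z = x + (y + z)" by transfer (simp add: add.assoc)
  show "x + y = y + x" by transfer (simp add: add.commute)
  show "0 + x = x" by transfer simp
  show "- x + x = 0" by transfer simp
  show "x - y = x + - y"
    by transfer (simp add: diff_conv_add_uminus del: add_uminus_conv_diff)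
  show "c *\<^sub>C (x + y) = c *\<^sub>C x + c *\<^sub>C y" by transfer (simp add: scaleC_add_right)
  show "(c + d) *\<^sub>C x = c *\<^sub>C x + d *\<^sub>C x" by transfer (simp add: scaleC_add_left)
  show "c *\<^sub>C (d *\<^sub>C x) = (c * d) *\<^sub>C x" by transfer (simp add: scaleC_scaleC)
  show "1 *\<^sub>C x = x" by transfer (simp add: scaleC_one)
  show "x * y * z = x * (y * z)" by transfer (simp add: mult.assoc)
  show "1 * x = x" by transfer simp
  show "x * 1 = x" by transfer simp
  show "(x + y) * z = x * z + y * z" by transfer (simp add: distrib_right)
  show "x * (y + z) = x * y + x * z" by transfer (simp add: distrib_left)
  show "(c *\<^sub>C x) * y = c *\<^sub>C (x * y)" by transfer (simp add: scaleC_mult_left)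
  show "x * (c *\<^sub>C y) = c *\<^sub>C (x * y)" by transfer (simp add: scaleC_mult_right)
  show "star (star x) = x" by transfer (simp add: star_star)
  show "star (x + y) = star x + star y" by transfer (simp add: star_add)
  show "star (c *\<^sub>C x) = cnj c *\<^sub>C star x" by transfer (simp add: star_scaleC)
  show "star (x * y) = star y * star x" by transfer (simp add: star_mult)
qed

end

instantiation cstar_completion :: (cstar_bounded_algebra) real_normed_algebra
begin

definition scaleR_cstar_completion :: "real \<Rightarrow> 'a cstar_completion \<Rightarrow> 'a cstar_completion" where
  "scaleR_cstar_completion r x = complex_of_real r *\<^sub>C x"

lift_definition norm_cstar_completion :: "'a cstar_completion \<Rightarrow> real"
  is "\<lambda>u. lim (\<lambda>n. univ_norm (u n))"
proof -
  fix u v :: "nat \<Rightarrow> 'a"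
  assume uv: "univ_Cauchy u \<and> univ_Cauchy v \<and> univ_null (\<lambda>n. u n - v n)"
  then have "(\<lambda>n. univ_norm (v n)) \<longlonglongrightarrow> lim (\<lambda>n. univ_norm (v n))"
    using univ_norm_convergent convergent_LIMSEQ_iff by blast
  then show "lim (\<lambda>n. univ_norm (u n)) = lim (\<lambda>n. univ_norm (v n))"
    using univ_norm_tendsto_unique uv by (blast intro: limI)
qed

definition dist_cstar_completion :: "'a cstar_completion \<Rightarrow> 'a cstar_completion \<Rightarrow> real" where
  "dist_cstar_completion x y = norm (x - y)"
definition sgn_cstar_completion :: "'a cstar_completion \<Rightarrow> 'a cstar_completion" where
  "sgn_cstar_completion x = inverse (norm x) *\<^sub>R x"
definition uniformity_cstar_completion ::
    "('a cstar_completion \<times> 'a cstar_completion) filter" where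
  "uniformity_cstar_completion = (INF e\<in>{0 <..}. principal {(x, y). dist x y < e})"
definition open_cstar_completion :: "'a cstar_completion set \<Rightarrow> bool" where
  "open_cstar_completion U \<longleftrightarrow> (\<forall>x\<in>U. eventually (\<lambda>(x', y). x' = x \<longrightarrow> y \<in> U) uniformity)"

lemma univ_norm_lim:
  "univ_Cauchy u \<Longrightarrow> (\<lambda>n. univ_norm (u n)) \<longlonglongrightarrow> lim (\<lambda>n. univ_norm (u n))"
  using univ_norm_convergent convergent_LIMSEQ_iff by blast

instance
proof
  fix x y :: "'a cstar_completion" and a b :: real
  show "a *\<^sub>R (x + y) = a *\<^sub>R x + a *\<^sub>R y"
    by (simp add: scaleR_cstar_completion_def scaleC_add_right)
  show "(a + b) *\<^sub>R x = a *\<^sub>R x + b *\<^sub>R x"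
    by (simp add: scaleR_cstar_completion_def scaleC_add_left)
  show "a *\<^sub>R b *\<^sub>R x = (a * b) *\<^sub>R x"
    by (simp add: scaleR_cstar_completion_def scaleC_scaleC)
  show "1 *\<^sub>R x = x"
    by (simp add: scaleR_cstar_completion_def scaleC_one)
  show "a *\<^sub>R x * y = a *\<^sub>R (x * y)" "x * a *\<^sub>R y = a *\<^sub>R (x * y)"
    by (simp_all add: scaleR_cstar_completion_def scaleC_mult_left scaleC_mult_right)
  show "dist x y = norm (x - y)" by (fact dist_cstar_completion_def)
  show "sgn x = inverse (norm x) *\<^sub>R x" by (fact sgn_cstar_completion_def)
  show "(uniformity :: ('a cstar_completion \<times> 'a cstar_completion) filter) =
      (INF e\<in>{0 <..}. principal {(x, y). dist x y < e})"
    by (fact uniformity_cstar_completion_def)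
  show "open U \<longleftrightarrow> (\<forall>x\<in>U. eventually (\<lambda>(x', y). x' = x \<longrightarrow> y \<in> U) uniformity)"
    for U :: "'a cstar_completion set"
    by (fact open_cstar_completion_def)
  show "norm x = 0 \<longleftrightarrow> x = 0"
  proof transfer
    fix u :: "nat \<Rightarrow> 'a"
    assume "univ_Cauchy u \<and> univ_Cauchy u \<and> univ_null (\<lambda>n. u n - u n)"
    then have "univ_Cauchy u" by simp
    then show "lim (\<lambda>n. univ_norm (u n)) = 0 \<longleftrightarrow>
        univ_Cauchy u \<and> univ_Cauchy (\<lambda>n. 0 :: 'a) \<and> univ_null (\<lambda>n. u n - 0)"
      using univ_norm_lim[of u] by (auto simp: univ_null_def univ_Cauchy_const intro: limI)
  qed
  show "norm (x + y) \<le> norm x + norm y"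
  proof transfer
    fix u v :: "nat \<Rightarrow> 'a"
    assume "univ_Cauchy u \<and> univ_Cauchy u \<and> univ_null (\<lambda>n. u n - u n)"
      and "univ_Cauchy v \<and> univ_Cauchy v \<and> univ_null (\<lambda>n. v n - v n)"
    then have uv: "univ_Cauchy u" "univ_Cauchy v" by simp_all
    show "lim (\<lambda>n. univ_norm (u n + v n)) \<le> lim (\<lambda>n. univ_norm (u n)) + lim (\<lambda>n. univ_norm (v n))"
      by (rule LIMSEQ_le[OF univ_norm_lim[OF univ_Cauchy_add[OF uv]]
            tendsto_add[OF univ_norm_lim[OF uv(1)] univ_norm_lim[OF uv(2)]]])
         (simp add: univ_norm_add)
  qed
  show "norm (x * y) \<le> norm x * norm y"
  proof transfer
    fix u v :: "nat \<Rightarrow> 'a"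
    assume "univ_Cauchy u \<and> univ_Cauchy u \<and> univ_null (\<lambda>n. u n - u n)"
      and "univ_Cauchy v \<and> univ_Cauchy v \<and> univ_null (\<lambda>n. v n - v n)"
    then have uv: "univ_Cauchy u" "univ_Cauchy v" by simp_all
    show "lim (\<lambda>n. univ_norm (u n * v n)) \<le> lim (\<lambda>n. univ_norm (u n)) * lim (\<lambda>n. univ_norm (v n))"
      by (rule LIMSEQ_le[OF univ_norm_lim[OF univ_Cauchy_mult[OF uv]]
            tendsto_mult[OF univ_norm_lim[OF uv(1)] univ_norm_lim[OF uv(2)]]])
         (simp add: univ_norm_mult)
  qed
  show "norm (a *\<^sub>R x) = \<bar>a\<bar> * norm x"
    unfolding scaleR_cstar_completion_def
  proof transfer
    fix a and u :: "nat \<Rightarrow> 'a"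
    assume "univ_Cauchy u \<and> univ_Cauchy u \<and> univ_null (\<lambda>n. u n - u n)"
    then have "univ_Cauchy u" by simp
    then show "lim (\<lambda>n. univ_norm (complex_of_real a *\<^sub>C u n)) = \<bar>a\<bar> * lim (\<lambda>n. univ_norm (u n))"
      by (simp add: univ_norm_scale) (intro limI tendsto_mult_left univ_norm_lim)
  qed
qed

end

lift_definition to_completion :: "'a::cstar_bounded_algebra \<Rightarrow> 'a cstar_completion" is "\<lambda>a n. a"
  by (simp add: univ_Cauchy_const univ_null_zero)

lemma norm_cstar: "norm (star x * x) = (norm x)\<^sup>2" for x :: "'a::cstar_bounded_algebra cstar_completion"
proof transfer
  fix u :: "nat \<Rightarrow> 'a"
  assume "univ_Cauchy u \<and> univ_Cauchy u \<and> univ_null (\<lambda>n. u n - u n)"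
  then have "univ_Cauchy u" by simp
  then show "lim (\<lambda>n. univ_norm (star (u n) * u n)) = (lim (\<lambda>n. univ_norm (u n)))\<^sup>2"
    by (simp add: univ_norm_cstar) (intro limI tendsto_power univ_norm_lim)
qed

lemma norm_to_completion: "norm (to_completion a) = univ_norm a"
  by transfer (simp add: limI)

lemma to_completion_diff: "to_completion (a - b) = to_completion a - to_completion b"
  by transfer (simp add: univ_Cauchy_const univ_null_zero)

lemma to_completion_dense: "e > 0 \<Longrightarrow> \<exists>a. norm (x - to_completion a) < e"
proof transfer
  fix u :: "nat \<Rightarrow> 'a" and e :: real
  assume "univ_Cauchy u \<and> univ_Cauchy u \<and> univ_null (\<lambda>n. u n - u n)" "e > 0"
  then have u: "univ_Cauchy u" and e: "e / 2 > 0" by simp_all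
  obtain M where M: "\<forall>m\<ge>M. \<forall>n\<ge>M. univ_norm (u m - u n) < e / 2"
    using u e unfolding univ_Cauchy_def by blast
  have "univ_Cauchy (\<lambda>n. u n + - u M)"
    by (intro univ_Cauchy_add u univ_Cauchy_const)
  then have "univ_Cauchy (\<lambda>n. u n - u M)" by simp
  from univ_norm_lim[OF this] have "lim (\<lambda>n. univ_norm (u n - u M)) \<le> e / 2"
    by (rule LIMSEQ_le_const2) (use M in \<open>auto intro!: exI[of _ M] less_imp_le\<close>)
  then show "\<exists>a. lim (\<lambda>n. univ_norm (u n - a)) < e"
    using e by (intro exI[of _ "u M"]) simp
qed

instance cstar_completion :: (cstar_bounded_algebra) banach
proof
  fix X :: "nat \<Rightarrow> 'a cstar_completion"
  assume X: "Cauchy X"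
  have "\<exists>a. norm (X n - to_completion a) < inverse (real (Suc n))" for n
    by (rule to_completion_dense) simp
  then obtain a where a: "\<And>n. norm (X n - to_completion (a n)) < inverse (real (Suc n))"
    by metis
  define D where "D n = X n - to_completion (a n)" for n
  have D: "D \<longlonglongrightarrow> 0"
    by (rule tendsto_0_le[OF LIMSEQ_inverse_real_of_nat, where K = 1])
       (use a in \<open>auto simp: D_def less_imp_le\<close>)
  have Ca: "Cauchy (\<lambda>n. to_completion (a n))"
  proof (rule CauchyI)
    fix e :: real assume "e > 0"
    then have e: "e / 2 > 0" by simp
    obtain M1 where M1: "\<forall>m\<ge>M1. \<forall>n\<ge>M1. norm (X m - X n) < e / 2"
      using CauchyD[OF X e] by blast
    obtain M2 where M2: "\<forall>m\<ge>M2. \<forall>n\<ge>M2. norm (D m - D n) < e / 2"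
      using CauchyD[OF LIMSEQ_imp_Cauchy[OF D] e] by blast
    show "\<exists>M. \<forall>m\<ge>M. \<forall>n\<ge>M. norm (to_completion (a m) - to_completion (a n)) < e"
    proof (intro exI allI impI)
      fix m n assume mn: "m \<ge> max M1 M2" "n \<ge> max M1 M2"
      have "to_completion (a m) - to_completion (a n) = (X m - X n) - (D m - D n)"
        by (simp add: D_def)
      then have "norm (to_completion (a m) - to_completion (a n)) \<le> norm (X m - X n) + norm (D m - D n)"
        by (simp only: norm_triangle_ineq4)
      moreover have "norm (X m - X n) < e / 2" "norm (D m - D n) < e / 2"
        using M1 M2 mn by auto
      ultimately show "norm (to_completion (a m) - to_completion (a n)) < e" by simp
    qed
  qed
  have aC: "univ_Cauchy a"
    unfolding univ_Cauchy_def
    using CauchyD[OF Ca] by (simp only: to_completion_diff[symmetric] norm_to_completion) simp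
  define L where "L = abs_cstar_completion a"
  have dist_le: "norm (L - to_completion (a m)) \<le> e"
    if le: "\<And>n. n \<ge> m \<Longrightarrow> univ_norm (a n - a m) \<le> e" for m e
  proof -
    have "univ_Cauchy (\<lambda>n. a n + - a m)"
      by (intro univ_Cauchy_add aC univ_Cauchy_const)
    then have C: "univ_Cauchy (\<lambda>n. a n - a m)" by simp
    have "L - to_completion (a m) = abs_cstar_completion (\<lambda>n. a n - a m)"
      unfolding L_def to_completion_def map_fun_def o_def id_def
      by (subst minus_cstar_completion.abs_eq) (simp_all add: aC univ_Cauchy_const univ_null_zero)
    then have "norm (L - to_completion (a m)) = lim (\<lambda>n. univ_norm (a n - a m))"
      using C by (simp add: norm_cstar_completion.abs_eq univ_null_zero)
    moreover have "lim (\<lambda>n. univ_norm (a n - a m)) \<le> e"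
      by (rule LIMSEQ_le_const2[OF univ_norm_lim[OF C]]) (use le in blast)
    ultimately show ?thesis by simp
  qed
  have "(\<lambda>m. L - to_completion (a m)) \<longlonglongrightarrow> 0"
  proof (rule LIMSEQ_I)
    fix r :: real assume r: "r > 0"
    then have "r / 2 > 0" by simp
    then obtain M where M: "\<forall>m\<ge>M. \<forall>n\<ge>M. univ_norm (a m - a n) < r / 2"
      using aC unfolding univ_Cauchy_def by blast
    have "norm (L - to_completion (a m) - 0) < r" if "m \<ge> M" for m
    proof -
      have "norm (L - to_completion (a m)) \<le> r / 2"
        by (rule dist_le) (use M that in \<open>auto intro: less_imp_le\<close>)
      then show ?thesis using r by simp
    qed
    then show "\<exists>M. \<forall>m\<ge>M. norm (L - to_completion (a m) - 0) < r" by blast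
  qed
  from tendsto_diff[OF D this] have "(\<lambda>m. X m - L) \<longlonglongrightarrow> 0" by (simp add: D_def)
  then have "X \<longlonglongrightarrow> L" by (rule LIM_zero_cancel)
  then show "convergent X" by (rule convergentI)
qed


section \<open>The C*-algebra of the quantum permutation group\<close>

lemma qperm_cstar_seminorm_bound: "\<exists>B. \<forall>q. cstar_seminorm q \<longrightarrow> q x \<le> B" for x :: "'n::finite qperm"
proof (induction x rule: qperm_induct)
  case one
  have "q 1 \<le> 1" if "cstar_seminorm q" for q :: "'n qperm \<Rightarrow> real"
  proof -
    have "q (star 1 * 1) = (q 1)\<^sup>2" "q 1 \<ge> 0"
      using that unfolding cstar_seminorm_def by blast+
    then have "q 1 = 0 \<or> q 1 = 1" by (simp add: star_one power2_eq_square)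
    then show ?thesis by (elim disjE) simp_all
  qed
  then show ?case by blast
next
  case (gen_mult i j x)
  then obtain B where B: "\<And>q. cstar_seminorm q \<Longrightarrow> q x \<le> B" by blast
  have "q (qperm_gen i j * x) \<le> B" if q: "cstar_seminorm q" for q :: "'n qperm \<Rightarrow> real"
  proof -
    have "q (star (qperm_gen i j) * qperm_gen i j) = (q (qperm_gen i j))\<^sup>2" and pos: "q (qperm_gen i j) \<ge> 0"
      and posx: "q x \<ge> 0" and mult: "q (qperm_gen i j * x) \<le> q (qperm_gen i j) * q x"
      using q unfolding cstar_seminorm_def by blast+
    then have "q (qperm_gen i j) = 0 \<or> q (qperm_gen i j) = 1"
      by (simp add: qperm_gen_relations power2_eq_square)
    then have "q (qperm_gen i j) \<le> 1" by (elim disjE) simp_all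
    then have "q (qperm_gen i j) * q x \<le> 1 * q x" using posx by (rule mult_right_mono)
    then show ?thesis using mult B[OF q] by simp
  qed
  then show ?case by blast
next
  case (scale c x)
  then obtain B where B: "\<And>q. cstar_seminorm q \<Longrightarrow> q x \<le> B" by blast
  have "q (c *\<^sub>C x) \<le> cmod c * B" if q: "cstar_seminorm q" for q :: "'n qperm \<Rightarrow> real"
  proof -
    have "q (c *\<^sub>C x) = cmod c * q x" using q by (auto simp: cstar_seminorm_def)
    then show ?thesis using B[OF q] by (simp add: mult_left_mono)
  qed
  then show ?case by blast
next
  case (add x y)
  then obtain B C where B: "\<And>q. cstar_seminorm q \<Longrightarrow> q x \<le> B" and C: "\<And>q. cstar_seminorm q \<Longrightarrow> q y \<le> C"
    by blast
  have "q (x + y) \<le> B + C" if q: "cstar_seminorm q" for q :: "'n qperm \<Rightarrow> real"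
  proof -
    have "q (x + y) \<le> q x + q y" using q by (auto simp: cstar_seminorm_def)
    then show ?thesis using B[OF q] C[OF q] by simp
  qed
  then show ?case by blast
qed

instance qperm :: (finite) cstar_bounded_algebra
proof
  fix x :: "'a qperm"
  obtain B where "\<And>q. cstar_seminorm q \<Longrightarrow> q x \<le> B" using qperm_cstar_seminorm_bound[of x] by blast
  then show "bdd_above {q x | q. cstar_seminorm q}" by (intro bdd_aboveI[of _ B]) auto
qed

end

theory Submission
  imports Defs
begin

text \<open>A vector of the \<open>k\<close>-th tensor power of \<open>\<complex>\<^sup>N\<close> is a function on multi-indices supported on length \<open>k\<close>. The highest
  weight space \<open>highest k\<close> consists of the vectors killed by identifying two adjacent legs and by summing
  over a leg. The span \<open>nc\<close> of the noncrossing partition vectors is stable under these operations and their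
  adjoints, so the orthogonal projections onto it define a functional on \<open>Pol(S\<^sub>N\<^sup>+)\<close>, the Haar state. A
  noncrossing vector acts on \<open>highest k\<close> as a scalar, which gives Schur orthogonality, positivity of the Haar
  state and irreducibility of the representation on \<open>highest k\<close>; the coefficients of these
  representations span \<open>Pol(S\<^sub>N\<^sup>+)\<close>. A central functional is thus determined by its eigenvalues \<open>c k\<close>.
  If it is also tracial, let \<open>a\<close>, \<open>e\<close>, \<open>b\<close> be the differences of the basis vectors with indices \<open>1, 2\<close>, \<open>3, 4\<close>
  and \<open>5, 6\<close>, and let \<open>\<nu> = e \<otimes> a \<otimes> e \<otimes> \<dots> \<otimes> e\<close> have odd length \<open>k\<close>. Rotating \<open>a \<otimes> \<nu> \<otimes> a\<close> and merging its
  outer legs yields an eigenvector \<open>a\<^sup>2 \<otimes> \<nu>\<close> for \<open>c (k + 2)\<close>; summing over its first leg gives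
  \<open>c (k + 2) = c k\<close>, and subtracting the same vector for \<open>b\<close>, which lands in \<open>highest (k + 1)\<close>, gives
  \<open>c (k + 2) = c (k + 1)\<close>. Hence \<open>c\<close> is constant on \<open>k \<ge> 1\<close>.\<close>

section \<open>Orthonormal bases of function spaces\<close>

text \<open>Centrality says that the operator obtained by applying \<open>\<phi>\<close> entrywise
  to the \<open>k\<close>-th tensor power acts on \<open>highest k\<close> as the scalar
  \<open>c k\<close>. Traciality adds that gluing the first and the last leg is compatible with
  these operators, because p_xz p_xy vanishes unless y = z. A glued vector has lower degree and need
  not be in \<open>highest\<close>, so gluing can tie eigenvalues of different degrees together. An
  elementary tensor lies in \<open>highest\<close> once its factors have zero sum and neighbours
  have disjoint supports. The smallest support of such a factor is a pair of points, and the proof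
  uses three disjoint pairs: hence six points. The squares of \<open>a\<close> and \<open>b\<close>
  have the same nonzero sum: nonzero for the first relation, equal so that their difference sums to
  zero. The main obstacle is elsewhere. In an algebra given by generators and relations no element
  is visibly nonzero, yet irreducibility requires nonzero coefficients. The Haar state detects them,
  so it has to be built before any representation theory. Boundedness is then that of a character
  and of a state, the latter through its GNS seminorm.\<close>

definition cinner :: "'a set \<Rightarrow> ('a \<Rightarrow> complex) \<Rightarrow> ('a \<Rightarrow> complex) \<Rightarrow> complex" where
  "cinner I f g = (\<Sum>x\<in>I. cnj (f x) * g x)"

lemma cinner_simps:
  "cinner I f (\<lambda>x. g x + g' x) = cinner I f g + cinner I f g'"
  "cinner I f (\<lambda>x. g x - g' x) = cinner I f g - cinner I f g'"
  "cinner I f (\<lambda>x. c * g x) = c * cinner I f g"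
  "cinner I f (\<lambda>x. 0) = 0"
  "cinner I (\<lambda>x. f x + f' x) g = cinner I f g + cinner I f' g"
  "cinner I (\<lambda>x. f x - f' x) g = cinner I f g - cinner I f' g"
  "cinner I (\<lambda>x. c * f x) g = cnj c * cinner I f g"
  "cinner I (\<lambda>x. 0) g = 0"
  by (simp_all add: cinner_def sum.distrib sum_subtractf sum_distrib_left algebra_simps)

lemma cinner_sum_right: "cinner I f (\<lambda>x. \<Sum>b\<in>B. c b * g b x) = (\<Sum>b\<in>B. c b * cinner I f (g b))"
  unfolding cinner_def by (simp add: sum_distrib_left algebra_simps) (rule sum.swap)

lemma cinner_sum_left: "cinner I (\<lambda>x. \<Sum>b\<in>B. c b * g b x) f = (\<Sum>b\<in>B. cnj (c b) * cinner I (g b) f)"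
  unfolding cinner_def by (simp add: sum_distrib_left sum_distrib_right algebra_simps) (rule sum.swap)

lemma cnj_cinner: "cnj (cinner I f g) = cinner I g f"
  by (simp add: cinner_def mult.commute)

lemma cinner_self: "cinner I f f = complex_of_real (\<Sum>x\<in>I. (cmod (f x))\<^sup>2)"
  by (simp add: cinner_def complex_norm_square[symmetric] mult.commute del: of_real_power)

lemma cinner_self_eq_0: "finite I \<Longrightarrow> cinner I f f = 0 \<longleftrightarrow> (\<forall>x\<in>I. f x = 0)"
  unfolding cinner_self of_real_eq_0_iff by (subst sum_nonneg_eq_0_iff) auto

lemma cinner_delta_left: "finite I \<Longrightarrow> y \<in> I \<Longrightarrow> cinner I (\<lambda>x. if x = y then 1 else 0) f = f y"
  by (simp add: cinner_def if_distrib[of cnj] if_distrib[of "\<lambda>c. c * _"] cong: if_cong)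

lemma cinner_delta_right: "finite I \<Longrightarrow> y \<in> I \<Longrightarrow> cinner I f (\<lambda>x. if x = y then 1 else 0) = cnj (f y)"
  by (simp add: cinner_def if_distrib[of "\<lambda>c. _ * c"] cong: if_cong)

definition fun_subspace :: "'a set \<Rightarrow> ('a \<Rightarrow> complex) set \<Rightarrow> bool" where
  "fun_subspace I N \<longleftrightarrow> (\<lambda>x. 0) \<in> N \<and> (\<forall>f\<in>N. \<forall>g\<in>N. (\<lambda>x. f x + g x) \<in> N) \<and>
     (\<forall>c. \<forall>f\<in>N. (\<lambda>x. c * f x) \<in> N) \<and> (\<forall>f\<in>N. \<forall>x. x \<notin> I \<longrightarrow> f x = 0)"

lemma
  assumes "fun_subspace I N"
  shows fun_subspace_zero: "(\<lambda>x. 0) \<in> N"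
    and fun_subspace_add: "f \<in> N \<Longrightarrow> g \<in> N \<Longrightarrow> (\<lambda>x. f x + g x) \<in> N"
    and fun_subspace_scale: "f \<in> N \<Longrightarrow> (\<lambda>x. c * f x) \<in> N"
    and fun_subspace_support: "f \<in> N \<Longrightarrow> x \<notin> I \<Longrightarrow> f x = 0"
  using assms by (simp_all add: fun_subspace_def)

lemma fun_subspace_sum:
  assumes "fun_subspace I N" "\<And>b. b \<in> B \<Longrightarrow> g b \<in> N"
  shows "(\<lambda>x. \<Sum>b\<in>B. c b * g b x) \<in> N"
  using assms(2)
proof (induction B rule: infinite_finite_induct)
  case (insert b B)
  then have "(\<lambda>x. c b * g b x + (\<Sum>b\<in>B. c b * g b x)) \<in> N"
    by (intro fun_subspace_add[OF assms(1)] fun_subspace_scale[OF assms(1)]) auto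
  then show ?case using insert by simp
qed (simp_all add: fun_subspace_zero[OF assms(1)])

lemma fun_subspace_diff:
  assumes "fun_subspace I N" "f \<in> N" "g \<in> N"
  shows "(\<lambda>x. f x - g x) \<in> N"
  using fun_subspace_add[OF assms(1,2) fun_subspace_scale[OF assms(1,3), of "- 1"]] by simp

definition orthonormal :: "'a set \<Rightarrow> ('a \<Rightarrow> complex) set \<Rightarrow> bool" where
  "orthonormal I B \<longleftrightarrow> finite B \<and> (\<forall>b\<in>B. \<forall>b'\<in>B. cinner I b b' = (if b = b' then 1 else 0))"

definition onb :: "'a set \<Rightarrow> ('a \<Rightarrow> complex) set \<Rightarrow> ('a \<Rightarrow> complex) set \<Rightarrow> bool" where
  "onb I N B \<longleftrightarrow> B \<subseteq> N \<and> orthonormal I B \<and> (\<forall>f\<in>N. f = (\<lambda>x. \<Sum>b\<in>B. cinner I b f * b x))"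

lemma orthonormal_expansion:
  assumes "orthonormal I B" "b \<in> B"
  shows "cinner I b (\<lambda>x. \<Sum>b\<in>B. c b * b x) = c b"
proof -
  have "cinner I b (\<lambda>x. \<Sum>b\<in>B. c b * b x) = (\<Sum>b'\<in>B. if b = b' then c b' else 0)"
    unfolding cinner_sum_right
    using assms by (intro sum.cong) (auto simp: orthonormal_def)
  also have "\<dots> = c b" using assms by (simp add: orthonormal_def)
  finally show ?thesis .
qed

text \<open>The squared distance from the delta at \<open>y\<close> to its projection onto the span
  of \<open>B\<close> is nonnegative, and it equals 1 minus the sum in question.\<close>

lemma Bessel_point:
  assumes "finite I" "orthonormal I B" "y \<in> I"
  shows "(\<Sum>b\<in>B. (cmod (b y))\<^sup>2) \<le> 1"
proof -
  let ?d = "\<lambda>x. if x = y then 1 else (0::complex)"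
  let ?p = "\<lambda>x. \<Sum>b\<in>B. cnj (b y) * b x"
  have "cinner I ?p ?p = (\<Sum>b\<in>B. b y * cnj (b y))"
    unfolding cinner_sum_left using assms by (intro sum.cong) (simp_all add: orthonormal_expansion)
  moreover have "cinner I ?d ?p = (\<Sum>b\<in>B. b y * cnj (b y))"
    using assms by (simp add: cinner_delta_left mult.commute)
  moreover have "cinner I ?p ?d = (\<Sum>b\<in>B. b y * cnj (b y))"
    using assms by (simp add: cinner_delta_right)
  moreover have "cinner I ?d ?d = 1"
    using assms by (simp add: cinner_delta_left)
  ultimately have "cinner I (\<lambda>x. ?d x - ?p x) (\<lambda>x. ?d x - ?p x) = 1 - (\<Sum>b\<in>B. b y * cnj (b y))"
    by (simp only: cinner_simps) simp
  also have "(\<Sum>b\<in>B. b y * cnj (b y)) = complex_of_real (\<Sum>b\<in>B. (cmod (b y))\<^sup>2)"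
    by (simp only: complex_norm_square of_real_sum)
  finally have eq: "complex_of_real (\<Sum>x\<in>I. (cmod (?d x - ?p x))\<^sup>2) = complex_of_real (1 - (\<Sum>b\<in>B. (cmod (b y))\<^sup>2))"
    by (simp only: cinner_self of_real_diff of_real_1)
  have "0 \<le> (\<Sum>x\<in>I. (cmod (?d x - ?p x))\<^sup>2)"
    by (intro sum_nonneg) simp
  then show ?thesis using eq unfolding of_real_eq_iff by simp
qed

text \<open>Summing the squared moduli of all \<open>b x\<close> over \<open>x\<close> first gives
  \<open>card B\<close>, over \<open>b\<close> first at most \<open>card I\<close>. This bound makes
  a maximal orthonormal set available in \<open>ex_onb\<close>.\<close>

lemma orthonormal_card_le:
  assumes "finite I" "orthonormal I B"
  shows "card B \<le> card I"
proof -
  have "(\<Sum>x\<in>I. (cmod (b x))\<^sup>2) = 1" if "b \<in> B" for b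
  proof -
    have "cinner I b b = 1" using that assms(2) by (simp add: orthonormal_def)
    then show ?thesis unfolding cinner_self of_real_eq_1_iff .
  qed
  then have "real (card B) = (\<Sum>b\<in>B. \<Sum>x\<in>I. (cmod (b x))\<^sup>2)" by simp
  also have "\<dots> = (\<Sum>x\<in>I. \<Sum>b\<in>B. (cmod (b x))\<^sup>2)" by (rule sum.swap)
  also have "\<dots> \<le> (\<Sum>x\<in>I. 1)" by (rule sum_mono) (rule Bessel_point[OF assms])
  finally show ?thesis by simp
qed

text \<open>An orthonormal subset of \<open>N\<close> of maximal size must span: otherwise the
  normalised remainder \<open>r\<close> of some \<open>f\<close> could be added to it.\<close>

lemma ex_onb:
  assumes I: "finite I" and N: "fun_subspace I N"
  shows "\<exists>B. onb I N B"
proof -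
  let ?P = "\<lambda>B. B \<subseteq> N \<and> orthonormal I B"
  have "?P {}" by (simp add: orthonormal_def)
  moreover have "\<forall>B. ?P B \<longrightarrow> card B < Suc (card I)" using orthonormal_card_le[OF I] by (simp add: less_Suc_eq_le)
  ultimately obtain B where B: "?P B" and max: "\<And>B'. ?P B' \<Longrightarrow> card B' \<le> card B"
    using ex_has_greatest_nat[of ?P "{}" card "Suc (card I)"] by metis
  have "f = (\<lambda>x. \<Sum>b\<in>B. cinner I b f * b x)" if f: "f \<in> N" for f
  proof (rule ccontr)
    define r where "r = (\<lambda>x. f x - (\<Sum>b\<in>B. cinner I b f * b x))"
    assume "f \<noteq> (\<lambda>x. \<Sum>b\<in>B. cinner I b f * b x)"
    then obtain x where x: "r x \<noteq> 0" by (auto simp: r_def fun_eq_iff)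
    have rN: "r \<in> N" unfolding r_def
      using B by (intro fun_subspace_diff[OF N f] fun_subspace_sum[OF N]) auto
    have rB: "cinner I b r = 0" if "b \<in> B" for b
      using B that unfolding cinner_simps r_def by (simp add: orthonormal_expansion)
    have "x \<in> I" using x fun_subspace_support[OF N rN] by blast
    define s where "s = sqrt (\<Sum>x\<in>I. (cmod (r x))\<^sup>2)"
    have pos: "(\<Sum>x\<in>I. (cmod (r x))\<^sup>2) > 0"
      by (rule sum_pos2[OF I \<open>x \<in> I\<close>]) (use x in auto)
    then have s: "s > 0" "cinner I r r = complex_of_real s * complex_of_real s"
      unfolding s_def cinner_self of_real_mult[symmetric] by simp_all
    define g where "g = (\<lambda>x. complex_of_real (1 / s) * r x)"
    have gg: "cinner I g g = 1"
      unfolding g_def cinner_simps s(2) using s(1) by simp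
    have gB: "cinner I b g = 0" if "b \<in> B" for b
      using rB[OF that] by (simp only: g_def cinner_simps mult_zero_right)
    have Bg: "cinner I g b = 0" if "b \<in> B" for b
      using gB[OF that] cnj_cinner[of I b g] by simp
    have "g \<in> N" unfolding g_def by (rule fun_subspace_scale[OF N rN])
    moreover have "g \<notin> B" using gB[of g] gg by auto
    ultimately have "?P (insert g B)" and "card (insert g B) = Suc (card B)"
      using B gg gB Bg by (auto simp: orthonormal_def)
    with max[of "insert g B"] show False by simp
  qed
  with B show ?thesis by (auto simp: onb_def)
qed

lemma onb_cinner:
  assumes "onb I N B" "f \<in> N" "g \<in> N"
  shows "(\<Sum>b\<in>B. cinner I f b * cinner I b g) = cinner I f g"
proof -
  have "g = (\<lambda>x. \<Sum>b\<in>B. cinner I b g * b x)" using assms unfolding onb_def by blast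
  then have "cinner I f g = cinner I f (\<lambda>x. \<Sum>b\<in>B. cinner I b g * b x)"
    by (rule arg_cong)
  also have "\<dots> = (\<Sum>b\<in>B. cinner I b g * cinner I f b)"
    by (rule cinner_sum_right)
  finally show ?thesis by (simp only: mult.commute)
qed

text \<open>The matrix of the orthogonal projection onto a subspace, as a reproducing kernel.\<close>

definition repro_kernel :: "'a set \<Rightarrow> ('a \<Rightarrow> complex) set \<Rightarrow> 'a \<Rightarrow> 'a \<Rightarrow> complex" where
  "repro_kernel I N x y = (\<Sum>b\<in>(SOME B. onb I N B). b x * cnj (b y))"

lemma cnj_repro_kernel: "cnj (repro_kernel I N x y) = repro_kernel I N y x"
  by (simp add: repro_kernel_def mult.commute)

context
  fixes I :: "'a set" and N
  assumes I: "finite I" and N: "fun_subspace I N"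
begin

lemma onb_some: "onb I N (SOME B. onb I N B)"
  by (rule someI_ex[OF ex_onb[OF I N]])

lemma repro_kernel_mem: "(\<lambda>x. repro_kernel I N x y) \<in> N"
proof -
  have "(\<lambda>x. \<Sum>b\<in>(SOME B. onb I N B). cnj (b y) * b x) \<in> N"
    using onb_some by (intro fun_subspace_sum[OF N]) (auto simp: onb_def)
  then show ?thesis by (simp add: repro_kernel_def mult.commute)
qed

lemma cinner_repro_kernel: "f \<in> N \<Longrightarrow> cinner I (\<lambda>x. repro_kernel I N x y) f = f y"
proof -
  assume f: "f \<in> N"
  let ?B = "SOME B. onb I N B"
  have "cinner I (\<lambda>x. \<Sum>b\<in>?B. cnj (b y) * b x) f = (\<Sum>b\<in>?B. cinner I b f * b y)"
    unfolding cinner_sum_left by (simp add: mult.commute)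
  also have "\<dots> = f y"
  proof -
    have "f = (\<lambda>x. \<Sum>b\<in>?B. cinner I b f * b x)"
      using onb_some f unfolding onb_def by blast
    from fun_cong[OF this, of y] show ?thesis by simp
  qed
  finally have "cinner I (\<lambda>x. \<Sum>b\<in>?B. cnj (b y) * b x) f = f y" .
  moreover have "(\<lambda>x. repro_kernel I N x y) = (\<lambda>x. \<Sum>b\<in>?B. cnj (b y) * b x)"
    by (simp add: repro_kernel_def mult.commute)
  ultimately show ?thesis by simp
qed

text \<open>The difference of the two sides lies in \<open>N\<close> and is orthogonal to
  \<open>N\<close>, in particular to itself. Identities for the projection are proved below by
  recognising the functional on \<open>N\<close> that a vector represents.\<close>

lemma repro_kernel_unique:
  assumes p: "p \<in> N" and rep: "\<And>f. f \<in> N \<Longrightarrow> cinner I p f = cnj c * f y"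
  shows "p x = c * repro_kernel I N x y"
proof -
  let ?K = "\<lambda>x. repro_kernel I N x y"
  let ?r = "\<lambda>x. p x - c * ?K x"
  have r: "?r \<in> N" by (intro fun_subspace_diff[OF N] fun_subspace_scale[OF N] p repro_kernel_mem)
  have "cinner I ?r ?r = cinner I p ?r - cnj c * cinner I ?K ?r"
    unfolding cinner_simps(6)[of I p] cinner_simps(7) ..
  also have "\<dots> = 0" by (simp only: rep[OF r] cinner_repro_kernel[OF r]) simp
  finally have "\<forall>x\<in>I. ?r x = 0" using cinner_self_eq_0[OF I, of ?r] by simp
  moreover have "\<forall>x. x \<notin> I \<longrightarrow> ?r x = 0" using fun_subspace_support[OF N r] by blast
  ultimately have "?r x = 0" by blast
  then show ?thesis by simp
qed

lemma orthogonal_decomposition: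
  obtains w l where "w \<in> N" "\<And>g. g \<in> N \<Longrightarrow> cinner I g l = 0" "\<And>x. f x = w x + l x"
proof -
  obtain B where B: "onb I N B" using ex_onb[OF I N] by blast
  define w where "w = (\<lambda>x. \<Sum>b\<in>B. cinner I b f * b x)"
  have w: "w \<in> N" unfolding w_def using B by (intro fun_subspace_sum[OF N]) (auto simp: onb_def)
  have Bl: "cinner I b (\<lambda>x. f x - w x) = 0" if "b \<in> B" for b
    using B that by (simp add: cinner_simps w_def orthonormal_expansion onb_def)
  have l: "cinner I g (\<lambda>x. f x - w x) = 0" if "g \<in> N" for g
  proof -
    have "g = (\<lambda>x. \<Sum>b\<in>B. cinner I b g * b x)" using B that unfolding onb_def by blast
    then have "cinner I g (\<lambda>x. f x - w x) = cinner I (\<lambda>x. \<Sum>b\<in>B. cinner I b g * b x) (\<lambda>x. f x - w x)"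
      by (rule arg_cong[where f = "\<lambda>g. cinner I g (\<lambda>x. f x - w x)"])
    also have "\<dots> = (\<Sum>b\<in>B. cnj (cinner I b g) * cinner I b (\<lambda>x. f x - w x))"
      by (rule cinner_sum_left)
    finally show ?thesis by (simp add: Bl)
  qed
  show thesis by (rule that[OF w l]) simp_all
qed

end

section \<open>Merging and contracting tensor legs\<close>

definition idx :: "nat \<Rightarrow> 'n list set" where
  "idx k = {xs. length xs = k}"

definition supp :: "nat \<Rightarrow> ('n list \<Rightarrow> complex) \<Rightarrow> bool" where
  "supp k f \<longleftrightarrow> (\<forall>xs. length xs \<noteq> k \<longrightarrow> f xs = 0)"

definition ins :: "nat \<Rightarrow> 'n \<Rightarrow> 'n list \<Rightarrow> 'n list" where
  "ins a i xs = take a xs @ i # drop a xs"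

definition del :: "nat \<Rightarrow> 'n list \<Rightarrow> 'n list" where
  "del a xs = take a xs @ drop (Suc a) xs"

text \<open>The product of the algebra \<open>\<complex>^N\<close> on two neighbouring legs;
  \<open>contract\<close> is its summation functional, and the two operations with suffix
  \<open>_adj\<close> are the adjoints. Positions out of range give 0, so that the inductive
  definitions below can allow every \<open>a\<close>.\<close>

definition merge :: "nat \<Rightarrow> ('n list \<Rightarrow> complex) \<Rightarrow> 'n list \<Rightarrow> complex" where
  "merge a f = (\<lambda>xs. if a < length xs then f (ins a (xs ! a) xs) else 0)"

definition contract :: "nat \<Rightarrow> ('n::finite list \<Rightarrow> complex) \<Rightarrow> 'n list \<Rightarrow> complex" where
  "contract a f = (\<lambda>xs. if a \<le> length xs then \<Sum>i\<in>UNIV. f (ins a i xs) else 0)"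

definition merge_adj :: "nat \<Rightarrow> ('n list \<Rightarrow> complex) \<Rightarrow> 'n list \<Rightarrow> complex" where
  "merge_adj a f = (\<lambda>xs. if Suc a < length xs \<and> xs ! a = xs ! Suc a then f (del a xs) else 0)"

definition contract_adj :: "nat \<Rightarrow> ('n list \<Rightarrow> complex) \<Rightarrow> 'n list \<Rightarrow> complex" where
  "contract_adj a f = (\<lambda>xs. if a < length xs then f (del a xs) else 0)"

lemmas leg_ops_def = merge_def contract_def merge_adj_def contract_adj_def

lemma finite_idx [simp]: "finite (idx k :: 'n::finite list set)"
  using finite_lists_length_eq[of "UNIV :: 'n set" k] by (simp add: idx_def)

lemma idx_0: "idx 0 = {[]}"
  by (auto simp: idx_def)

lemma length_ins [simp]: "length (ins a i xs) = Suc (length xs)"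
  by (simp add: ins_def)

lemma length_del [simp]: "a < length xs \<Longrightarrow> length (del a xs) = length xs - 1"
  by (simp add: del_def)

lemma ins_not_Nil [simp]: "ins a i xs \<noteq> []"
  by (simp add: ins_def)

lemma del_not_Nil [simp]: "Suc a < length xs \<Longrightarrow> del a xs \<noteq> []"
  by (simp add: del_def)

lemma nth_ins:
  "a \<le> length xs \<Longrightarrow> j \<le> length xs \<Longrightarrow>
   ins a i xs ! j = (if j < a then xs ! j else if j = a then i else xs ! (j - 1))"
  by (auto simp: ins_def nth_append nth_Cons' min_def)

lemma nth_del:
  "a < length xs \<Longrightarrow> Suc j < length xs \<Longrightarrow> del a xs ! j = (if j < a then xs ! j else xs ! Suc j)"
  by (auto simp: del_def nth_append min_def)

lemma del_ins: "a \<le> length xs \<Longrightarrow> del a (ins a i xs) = xs"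
  by (simp add: del_def ins_def)

lemma ins_del: "a < length xs \<Longrightarrow> ins a (xs ! a) (del a xs) = xs"
  by (simp add: del_def ins_def id_take_nth_drop[symmetric])

lemma del_ins_less: "b < a \<Longrightarrow> a \<le> length xs \<Longrightarrow> del b (ins a i xs) = ins (a - 1) i (del b xs)"
  by (rule nth_equalityI) (auto simp: nth_ins nth_del)

lemma del_ins_greater: "a < b \<Longrightarrow> b \<le> length xs \<Longrightarrow> del b (ins a i xs) = ins a i (del (b - 1) xs)"
  by (rule nth_equalityI) (auto simp: nth_ins nth_del)

lemma ins_nth_Suc: "a < length xs \<Longrightarrow> ins (Suc a) (xs ! a) xs = ins a (xs ! a) xs"
  by (rule nth_equalityI) (auto simp: nth_ins less_Suc_eq)

lemma del_ins_Suc: "a < length xs \<Longrightarrow> xs ! a = i \<Longrightarrow> del a (ins (Suc a) i xs) = xs"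
  using ins_nth_Suc[of a xs] del_ins[of a xs i] by simp

lemma rev_ins: "a \<le> length xs \<Longrightarrow> rev (ins a i xs) = ins (length xs - a) i (rev xs)"
  by (simp add: ins_def rev_take rev_drop)

lemma take_ins: "take k (ins a i xs) = (if a < k then ins a i (take (k - 1) xs) else take k xs)"
  if "a \<le> length xs"
  using that by (auto simp: ins_def take_Cons' min_def drop_take)

lemma drop_ins: "drop k (ins a i xs) = (if a < k then drop (k - 1) xs else ins (a - k) i (drop k xs))"
  if "a \<le> length xs"
  using that by (auto simp: ins_def drop_Cons' drop_take)

lemma sum_idx_ins:
  fixes F :: "'n::finite list \<Rightarrow> 'a::comm_monoid_add"
  assumes "a \<le> k"
  shows "(\<Sum>xs\<in>idx (Suc k). F xs) = (\<Sum>xs\<in>idx k. \<Sum>i\<in>UNIV. F (ins a i xs))"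
proof -
  have "(\<Sum>xs\<in>idx (Suc k). F xs) = (\<Sum>(xs, i)\<in>idx k \<times> UNIV. F (ins a i xs))"
    by (rule sum.reindex_bij_witness[of _ "\<lambda>(xs, i). ins a i xs" "\<lambda>xs. (del a xs, xs ! a)"])
       (use assms in \<open>auto simp: idx_def del_ins ins_del nth_ins\<close>)
  then show ?thesis by (simp add: sum.cartesian_product)
qed

text \<open>Values in an arbitrary complex vector space let this serve twice: with scalar
  \<open>F\<close> it is the adjointness of \<open>merge\<close> and \<open>merge_adj\<close>, with
  \<open>F\<close> made of matrix entries it computes the rows and columns of a raised
  vector.\<close>

lemma sum_merge_adj:
  fixes F :: "'n::finite list \<Rightarrow> 'a::complex_vector"
  shows "(\<Sum>xs\<in>idx (Suc k). merge_adj a f xs *\<^sub>C F xs) =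
    (if a < k then \<Sum>xs\<in>idx k. f xs *\<^sub>C F (ins a (xs ! a) xs) else 0)"
proof (cases "a < k")
  case True
  then have "(\<Sum>xs\<in>idx (Suc k). merge_adj a f xs *\<^sub>C F xs) =
      (\<Sum>xs\<in>idx k. \<Sum>i\<in>UNIV. merge_adj a f (ins a i xs) *\<^sub>C F (ins a i xs))"
    by (intro sum_idx_ins) simp
  also have "\<dots> = (\<Sum>xs\<in>idx k. \<Sum>i\<in>UNIV. if i = xs ! a then f xs *\<^sub>C F (ins a i xs) else 0)"
    using True by (intro sum.cong refl) (auto simp: merge_adj_def idx_def nth_ins del_ins)
  finally show ?thesis using True by simp
next
  case False
  then show ?thesis by (auto intro!: sum.neutral simp: merge_adj_def idx_def)
qed

lemma sum_contract_adj:
  fixes F :: "'n::finite list \<Rightarrow> 'a::complex_vector"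
  shows "(\<Sum>xs\<in>idx (Suc k). contract_adj a f xs *\<^sub>C F xs) =
    (if a \<le> k then \<Sum>xs\<in>idx k. f xs *\<^sub>C (\<Sum>i\<in>UNIV. F (ins a i xs)) else 0)"
proof (cases "a \<le> k")
  case True
  then have "(\<Sum>xs\<in>idx (Suc k). contract_adj a f xs *\<^sub>C F xs) =
      (\<Sum>xs\<in>idx k. \<Sum>i\<in>UNIV. contract_adj a f (ins a i xs) *\<^sub>C F (ins a i xs))"
    by (intro sum_idx_ins)
  also have "\<dots> = (\<Sum>xs\<in>idx k. \<Sum>i\<in>UNIV. f xs *\<^sub>C F (ins a i xs))"
    using True by (intro sum.cong refl) (auto simp: contract_adj_def idx_def del_ins)
  finally show ?thesis using True by (simp add: cvec.scale_sum_right)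
next
  case False
  then show ?thesis by (auto intro!: sum.neutral simp: contract_adj_def idx_def)
qed

lemma cinner_merge_adj:
  "cinner (idx (Suc k)) f (merge_adj a g) = cinner (idx k) (merge a f) (g :: 'n::finite list \<Rightarrow> complex)"
  using sum_merge_adj[of a g "\<lambda>xs. cnj (f xs)" k]
  by (auto simp: cinner_def scaleC_complex_def merge_def idx_def mult.commute intro!: sum.cong)

lemma cinner_contract_adj:
  "cinner (idx (Suc k)) f (contract_adj a g) = cinner (idx k) (contract a f) (g :: 'n::finite list \<Rightarrow> complex)"
  using sum_contract_adj[of a g "\<lambda>xs. cnj (f xs)" k]
  by (auto simp: cinner_def scaleC_complex_def contract_def idx_def mult.commute intro!: sum.cong)

lemma leg_ops_linear:
  fixes f g :: "'n::finite list \<Rightarrow> complex"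
  shows "merge a (\<lambda>xs. 0) = (\<lambda>xs. 0 :: complex)" "contract a (\<lambda>xs. 0) = (\<lambda>xs :: 'n list. 0)"
    "merge_adj a (\<lambda>xs. 0) = (\<lambda>xs. 0 :: complex)" "contract_adj a (\<lambda>xs. 0) = (\<lambda>xs. 0 :: complex)"
    "merge a (\<lambda>xs. f xs + g xs) = (\<lambda>xs. merge a f xs + merge a g xs)"
    "contract a (\<lambda>xs. f xs + g xs) = (\<lambda>xs. contract a f xs + contract a g xs)"
    "merge_adj a (\<lambda>xs. f xs + g xs) = (\<lambda>xs. merge_adj a f xs + merge_adj a g xs)"
    "contract_adj a (\<lambda>xs. f xs + g xs) = (\<lambda>xs. contract_adj a f xs + contract_adj a g xs)"
    "merge a (\<lambda>xs. c * f xs) = (\<lambda>xs. c * merge a f xs)"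
    "contract a (\<lambda>xs. c * f xs) = (\<lambda>xs. c * contract a f xs)"
    "merge_adj a (\<lambda>xs. c * f xs) = (\<lambda>xs. c * merge_adj a f xs)"
    "contract_adj a (\<lambda>xs. c * f xs) = (\<lambda>xs. c * contract_adj a f xs)"
  by (auto simp: leg_ops_def sum.distrib sum_distrib_left)

lemma supp_leg_ops:
  "supp k f \<Longrightarrow> supp (Suc k) (merge_adj a f)"
  "supp k f \<Longrightarrow> supp (Suc k) (contract_adj a f)"
  "supp (Suc k) f \<Longrightarrow> supp k (merge a f)"
  "supp (Suc k) g \<Longrightarrow> supp k (contract a (g :: 'n::finite list \<Rightarrow> complex))"
  "supp 0 f \<Longrightarrow> merge a f = (\<lambda>xs. 0)"
  "supp 0 g \<Longrightarrow> contract a g = (\<lambda>xs. 0)"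
  "supp 0 f \<Longrightarrow> merge_adj a f = (\<lambda>xs. 0)"
  by (auto simp: supp_def leg_ops_def fun_eq_iff split: if_splits)

text \<open>Distant positions commute up to a shift. Neighbouring positions are the Frobenius law of
  \<open>\<complex>^N\<close>, and at equal positions a leg is duplicated and merged again.\<close>

lemma merge_merge_adj:
  "b < a \<Longrightarrow> merge a (merge_adj b f) = merge_adj b (merge (a - 1) f)"
  "a < b \<Longrightarrow> merge a (merge_adj b f) = merge_adj (b - 1) (merge a f)"
  "merge a (merge_adj a f) = (\<lambda>xs. if a < length xs then f xs else 0)"
proof -
  show "merge a (merge_adj b f) = merge_adj b (merge (a - 1) f)" if "b < a"
    by (cases "a = Suc b")
       (use that in \<open>auto simp: merge_def merge_adj_def fun_eq_iff nth_ins nth_del del_ins_less less_Suc_eq\<close>)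
  show "merge a (merge_adj a f) = (\<lambda>xs. if a < length xs then f xs else 0)"
    by (auto simp: merge_def merge_adj_def fun_eq_iff nth_ins del_ins)
  assume ab: "a < b"
  then obtain c where b: "b = Suc c" "a \<le> c" by (cases b) auto
  show "merge a (merge_adj b f) = merge_adj (b - 1) (merge a f)"
  proof (cases "a = c")
    case True
    then show ?thesis
      by (auto simp: merge_def merge_adj_def fun_eq_iff nth_ins nth_del del_ins_greater b)
  next
    case False
    with b show ?thesis
      by (auto simp: merge_def merge_adj_def fun_eq_iff nth_ins nth_del del_ins_greater)
  qed
qed

lemma merge_contract_adj:
  "b < a \<Longrightarrow> merge a (contract_adj b f) = contract_adj b (merge (a - 1) f)"
  "Suc a < b \<Longrightarrow> merge a (contract_adj b f) = contract_adj (b - 1) (merge a f)"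
  "merge a (contract_adj a f) = (\<lambda>xs. if a < length xs then f xs else 0)"
  "merge a (contract_adj (Suc a) f) = (\<lambda>xs. if a < length xs then f xs else 0)"
  by (auto simp: merge_def contract_adj_def fun_eq_iff nth_ins nth_del del_ins del_ins_less del_ins_greater
      ins_del)

text \<open>The cases \<open>contract a\<close> and \<open>contract (Suc a)\<close> after
  \<open>merge_adj a\<close> are the two counit laws: summing out either copy of a duplicated leg
  returns the vector.\<close>

lemma contract_merge_adj:
  fixes f :: "'n::finite list \<Rightarrow> complex"
  shows "Suc b < a \<Longrightarrow> contract a (merge_adj b f) = merge_adj b (contract (a - 1) f)"
    "a < b \<Longrightarrow> contract a (merge_adj b f) = merge_adj (b - 1) (contract a f)"
    "contract a (merge_adj a f) = (\<lambda>xs. if a < length xs then f xs else 0)"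
    "contract (Suc a) (merge_adj a f) = (\<lambda>xs. if a < length xs then f xs else 0)"
proof -
  show "Suc b < a \<Longrightarrow> contract a (merge_adj b f) = merge_adj b (contract (a - 1) f)"
    by (auto simp: contract_def merge_adj_def fun_eq_iff nth_ins nth_del del_ins_less)
  show "a < b \<Longrightarrow> contract a (merge_adj b f) = merge_adj (b - 1) (contract a f)"
  proof
    fix xs :: "'n list" assume ab: "a < b"
    have "merge_adj b f (ins a i xs) =
        (if b < length xs \<and> xs ! (b - 1) = xs ! b then f (ins a i (del (b - 1) xs)) else 0)"
      if "a \<le> length xs" for i
      using ab that by (auto simp: merge_adj_def nth_ins del_ins_greater)
    then show "contract a (merge_adj b f) xs = merge_adj (b - 1) (contract a f) xs"
      using ab by (auto simp: contract_def merge_adj_def)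
  qed
  show "contract a (merge_adj a f) = (\<lambda>xs. if a < length xs then f xs else 0)"
    by (auto simp: contract_def merge_adj_def fun_eq_iff nth_ins del_ins cong: if_cong)
  show "contract (Suc a) (merge_adj a f) = (\<lambda>xs. if a < length xs then f xs else 0)"
  proof
    fix xs :: "'n list"
    have "(\<Sum>i\<in>UNIV. merge_adj a f (ins (Suc a) i xs)) = f xs" if "a < length xs"
    proof -
      have "(\<Sum>i\<in>UNIV. merge_adj a f (ins (Suc a) i xs)) = (\<Sum>i\<in>UNIV. if xs ! a = i then f xs else 0)"
        using that by (intro sum.cong refl) (auto simp: merge_adj_def nth_ins del_ins_Suc)
      then show ?thesis by simp
    qed
    then show "contract (Suc a) (merge_adj a f) xs = (if a < length xs then f xs else 0)"
      by (simp add: contract_def Suc_le_eq)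
  qed
qed

text \<open>A leg that is created and summed out again is a closed loop and contributes the factor
  N.\<close>

lemma contract_contract_adj:
  fixes f :: "'n::finite list \<Rightarrow> complex"
  shows "b < a \<Longrightarrow> contract a (contract_adj b f) = contract_adj b (contract (a - 1) f)"
    "a < b \<Longrightarrow> contract a (contract_adj b f) = contract_adj (b - 1) (contract a f)"
    "contract a (contract_adj a f) = (\<lambda>xs. of_nat CARD('n) * (if a \<le> length xs then f xs else 0))"
proof -
  show "b < a \<Longrightarrow> contract a (contract_adj b f) = contract_adj b (contract (a - 1) f)"
    "contract a (contract_adj a f) = (\<lambda>xs. of_nat CARD('n) * (if a \<le> length xs then f xs else 0))"
    by (auto simp: contract_def contract_adj_def fun_eq_iff del_ins del_ins_less)
  show "a < b \<Longrightarrow> contract a (contract_adj b f) = contract_adj (b - 1) (contract a f)"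
  proof
    fix xs :: "'n list" assume ab: "a < b"
    have "contract_adj b f (ins a i xs) = (if b \<le> length xs then f (ins a i (del (b - 1) xs)) else 0)"
      if "a \<le> length xs" for i
      using ab that by (auto simp: contract_adj_def del_ins_greater)
    moreover have "b - 1 < length xs \<longleftrightarrow> b \<le> length xs" using ab by auto
    ultimately show "contract a (contract_adj b f) xs = contract_adj (b - 1) (contract a f) xs"
      using ab by (auto simp: contract_def contract_adj_def[of "b - Suc 0"])
  qed
qed

section \<open>Noncrossing vectors and highest weight vectors\<close>

text \<open>The span of the vectors attached to noncrossing partitions. Only raising operations appear as rules,
  so that for \<open>k > 0\<close> such a vector is orthogonal to the highest weight space.\<close>

inductive nc :: "nat \<Rightarrow> ('n list \<Rightarrow> complex) \<Rightarrow> bool" where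
  unit: "nc 0 (\<lambda>xs. if xs = [] then 1 else 0)"
| zero: "nc k (\<lambda>xs. 0)"
| add: "nc k f \<Longrightarrow> nc k g \<Longrightarrow> nc k (\<lambda>xs. f xs + g xs)"
| scale: "nc k f \<Longrightarrow> nc k (\<lambda>xs. c * f xs)"
| merge_adj: "nc k f \<Longrightarrow> nc (Suc k) (merge_adj a f)"
| contract_adj: "nc k f \<Longrightarrow> nc (Suc k) (contract_adj a f)"

lemma nc_supp: "nc k f \<Longrightarrow> supp k f"
  by (induction rule: nc.induct) (auto simp: supp_leg_ops, auto simp: supp_def)

lemma nc_restrict: "nc k f \<Longrightarrow> nc k (\<lambda>xs. if P (length xs) then f xs else 0)"
proof -
  assume f: "nc k f"
  have "(\<lambda>xs. if P (length xs) then f xs else 0) = (if P k then f else (\<lambda>xs. 0))"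
    using nc_supp[OF f] by (auto simp: supp_def fun_eq_iff)
  then show ?thesis using f by (simp add: nc.zero)
qed

text \<open>A lowering operation either cancels against the last raising operation or passes it by
  the commutation rules and meets the shorter vector, where induction applies. In degree 0 the
  truncated \<open>k - 1\<close> is harmless, since lowering gives the zero vector.\<close>

lemma nc_lower:
  assumes "nc k (f :: 'n::finite list \<Rightarrow> complex)"
  shows "nc (k - 1) (merge a f) \<and> nc (k - 1) (contract a f)"
  using assms
proof (induction arbitrary: a rule: nc.induct)
  case unit
  have "supp 0 (\<lambda>xs :: 'n list. if xs = [] then 1 else 0)" by (simp add: supp_def)
  then show ?case by (simp add: supp_leg_ops nc.zero)
next
  case (zero k)
  then show ?case by (simp add: leg_ops_linear nc.zero)
next
  case (add k f g)
  then show ?case by (simp add: leg_ops_linear nc.add)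
next
  case (scale k f c)
  then show ?case by (simp add: leg_ops_linear nc.scale)
next
  case (merge_adj k f b)
  have up: "nc k (merge_adj b' (merge a' f)) \<and> nc k (merge_adj b' (contract a' f))" for a' b'
  proof (cases k)
    case 0
    then show ?thesis
      using nc_supp[OF merge_adj.hyps] by (simp add: supp_leg_ops leg_ops_linear nc.zero)
  next
    case (Suc m)
    then show ?thesis using merge_adj.IH[of a'] by (simp add: nc.merge_adj)
  qed
  have "nc k (merge a (merge_adj b f))"
    using up nc_restrict[OF merge_adj.hyps] by (cases a b rule: linorder_cases) (simp_all add: merge_merge_adj)
  moreover have "nc k (contract a (merge_adj b f))"
  proof -
    consider "a < b" | "a = b" | "a = Suc b" | "Suc b < a" by linarith
    then show ?thesis
      by cases (use up nc_restrict[OF merge_adj.hyps] in \<open>simp_all add: contract_merge_adj\<close>)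
  qed
  ultimately show ?case by simp
next
  case (contract_adj k f b)
  have up: "nc k (contract_adj b' (merge a' f)) \<and> nc k (contract_adj b' (contract a' f))" for a' b'
  proof (cases k)
    case 0
    then show ?thesis
      using nc_supp[OF contract_adj.hyps] by (simp add: supp_leg_ops leg_ops_linear nc.zero)
  next
    case (Suc m)
    then show ?thesis using contract_adj.IH[of a'] by (simp add: nc.contract_adj)
  qed
  have "nc k (merge a (contract_adj b f))"
  proof -
    consider "b < a" | "a = b" | "b = Suc a" | "Suc a < b" by linarith
    then show ?thesis
      by cases (use up nc_restrict[OF contract_adj.hyps] in \<open>simp_all add: merge_contract_adj\<close>)
  qed
  moreover have "nc k (contract a (contract_adj b f))"
    using up nc.scale[OF nc_restrict[OF contract_adj.hyps]]
    by (cases a b rule: linorder_cases) (simp_all add: contract_contract_adj)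
  ultimately show ?case by simp
qed

lemma fun_subspace_nc: "fun_subspace (idx k) {f. nc k f}"
  by (auto simp: fun_subspace_def idx_def nc.zero nc.add nc.scale dest!: nc_supp) (simp add: supp_def)

text \<open>Unlike \<open>nc\<close>, which is generated from the unit alone, this span contains the
  raisings of arbitrary vectors. It is the part of the tensor power whose coefficients already occur
  in lower degree.\<close>

inductive raised :: "nat \<Rightarrow> ('n list \<Rightarrow> complex) \<Rightarrow> bool" where
  zero: "raised k (\<lambda>xs. 0)"
| add: "raised k f \<Longrightarrow> raised k g \<Longrightarrow> raised k (\<lambda>xs. f xs + g xs)"
| scale: "raised k f \<Longrightarrow> raised k (\<lambda>xs. c * f xs)"
| merge_adj: "supp k f \<Longrightarrow> raised (Suc k) (merge_adj a f)"
| contract_adj: "supp k f \<Longrightarrow> raised (Suc k) (contract_adj a f)"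

text \<open>The orthogonal complement of \<^const>\<open>raised\<close>; it carries the irreducible summand of the \<open>k\<close>-th
  tensor power that does not occur in lower ones.\<close>

definition highest :: "nat \<Rightarrow> ('n::finite list \<Rightarrow> complex) set" where
  "highest k = {f. supp k f \<and> (\<forall>a. merge a f = (\<lambda>xs. 0) \<and> contract a f = (\<lambda>xs. 0))}"

lemma raised_supp: "raised k f \<Longrightarrow> supp k f"
  by (induction rule: raised.induct) (auto simp: supp_leg_ops, auto simp: supp_def)

lemma fun_subspace_raised: "fun_subspace (idx k) {f. raised k f}"
  by (auto simp: fun_subspace_def idx_def raised.zero raised.add raised.scale dest!: raised_supp)
     (simp add: supp_def)

lemma fun_subspace_highest: "fun_subspace (idx k) (highest k)"
  by (auto simp: fun_subspace_def idx_def highest_def leg_ops_linear) (auto simp: supp_def)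

lemma nc_raised: "nc k f \<Longrightarrow> k > 0 \<Longrightarrow> raised k f"
  by (induction rule: nc.induct) (auto intro: raised.intros nc_supp)

lemma raised_orthogonal_highest:
  assumes "raised k g" "f \<in> highest k"
  shows "cinner (idx k) f g = 0" "cinner (idx k) g f = 0"
proof -
  show "cinner (idx k) f g = 0" using assms
    by (induction rule: raised.induct) (simp_all add: cinner_simps cinner_merge_adj cinner_contract_adj highest_def)
  then show "cinner (idx k) g f = 0" using cnj_cinner[of "idx k" f g] by simp
qed

text \<open>Testing against the raisings of a delta at \<open>ys\<close> and moving the raising to
  the other side reads off the values of \<open>merge a f\<close> and \<open>contract a f\<close> at
  \<open>ys\<close>.\<close>

lemma highestI:
  fixes f :: "'n::finite list \<Rightarrow> complex"
  assumes supp: "supp k f" and orth: "\<And>g. raised k g \<Longrightarrow> cinner (idx k) g f = 0"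
  shows "f \<in> highest k"
proof (cases k)
  case 0
  then show ?thesis using supp by (simp add: highest_def supp_leg_ops)
next
  case (Suc m)
  have orth': "cinner (idx k) f g = 0" if "raised k g" for g
    using orth[OF that] cnj_cinner[of "idx k" g f] by simp
  have "merge a f ys = 0 \<and> contract a f ys = 0" for a ys
  proof (cases "length ys = m")
    case True
    let ?d = "\<lambda>xs. if xs = ys then 1 else 0"
    have "supp m ?d" and ys: "ys \<in> idx m" using True by (simp_all add: supp_def idx_def)
    then have "raised k (merge_adj a ?d)" "raised k (contract_adj a ?d)"
      using Suc by (simp_all add: raised.merge_adj raised.contract_adj)
    then have "cinner (idx k) f (merge_adj a ?d) = 0" "cinner (idx k) f (contract_adj a ?d) = 0"
      by (simp_all add: orth')
    then show ?thesis
      using Suc ys by (simp add: cinner_merge_adj cinner_contract_adj cinner_delta_right)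
  next
    case False
    then show ?thesis using supp Suc supp_leg_ops(3,4)[of m f a] by (simp add: supp_def)
  qed
  then show ?thesis using supp by (simp add: highest_def fun_eq_iff)
qed

lemma raised_highest_decomposition:
  fixes f :: "'n::finite list \<Rightarrow> complex"
  assumes "supp k f"
  obtains w l where "raised k w" "l \<in> highest k" "f = (\<lambda>xs. w xs + l xs)"
proof -
  obtain w l where w: "w \<in> {f. raised k f}" and l: "\<And>g. g \<in> {f. raised k f} \<Longrightarrow> cinner (idx k) g l = 0"
    and f: "\<And>x. f x = w x + l x"
    using orthogonal_decomposition[OF finite_idx fun_subspace_raised, of k f] by blast
  have "supp k l" using raised_supp[of k w] w assms by (simp add: supp_def f)
  then show thesis using that[of w l] w l f by (auto intro!: highestI)
qed

lemma highest_contract: "f \<in> highest k \<Longrightarrow> a \<le> length xs \<Longrightarrow> (\<Sum>i\<in>UNIV. f (ins a i xs)) = 0"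
  unfolding highest_def contract_def fun_eq_iff mem_Collect_eq by meson

lemma highest_contract_rev:
  "f \<in> highest k \<Longrightarrow> a \<le> length xs \<Longrightarrow> (\<Sum>i\<in>UNIV. f (rev (ins a i xs))) = 0"
  by (simp add: rev_ins highest_contract)

lemma highest_merge: "f \<in> highest k \<Longrightarrow> a < length xs \<Longrightarrow> f (ins a (xs ! a) xs) = 0"
  unfolding highest_def merge_def fun_eq_iff mem_Collect_eq by meson

lemma highest_adjacent:
  assumes "f \<in> highest k" "Suc a < length xs" "xs ! a = xs ! Suc a"
  shows "f xs = 0"
proof -
  have "ins a (del a xs ! a) (del a xs) = xs"
    using assms(2,3) ins_del[of a xs] by (simp add: nth_del)
  then show ?thesis using highest_merge[OF assms(1), of a "del a xs"] assms(2) by simp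
qed

lemma highest_adjacent_rev:
  assumes "f \<in> highest k" "Suc a < length xs" "xs ! a = xs ! Suc a"
  shows "f (rev xs) = 0"
  by (rule highest_adjacent[OF assms(1), of "length xs - Suc (Suc a)"])
     (use assms(2,3) in \<open>simp_all add: rev_nth Suc_diff_Suc\<close>)

lemma highest_supp: "f \<in> highest k \<Longrightarrow> supp k f"
  by (simp add: highest_def)

text \<open>Fixing the first leg leaves the conditions at all later positions intact. The induction
  behind Schur's lemma strips legs in this way.\<close>

lemma highest_slice:
  assumes "f \<in> highest (Suc k)"
  shows "(\<lambda>xs. f (i # xs)) \<in> highest k"
proof -
  have "merge a (\<lambda>xs. f (i # xs)) xs = 0" for a xs
    using highest_merge[OF assms, of "Suc a" "i # xs"] by (simp add: merge_def ins_def)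
  moreover have "contract a (\<lambda>xs. f (i # xs)) xs = 0" for a xs
    using highest_contract[OF assms, of "Suc a" "i # xs"] by (simp add: contract_def ins_def)
  moreover have "supp k (\<lambda>xs. f (i # xs))"
    using highest_supp[OF assms] by (simp add: supp_def)
  ultimately show ?thesis by (simp add: highest_def fun_eq_iff)
qed

text \<open>\<open>f\<^sup>* \<otimes> f'\<close> with the legs of \<open>f\<close> in reversed order; in \<open>rtens_merged\<close> the two innermost legs
  are identified.\<close>

definition rtens :: "nat \<Rightarrow> ('n list \<Rightarrow> complex) \<Rightarrow> ('n list \<Rightarrow> complex) \<Rightarrow> 'n list \<Rightarrow> complex" where
  "rtens k f f' = (\<lambda>xs. cnj (f (rev (take k xs))) * f' (drop k xs))"

definition rtens_merged :: "nat \<Rightarrow> ('n list \<Rightarrow> complex) \<Rightarrow> ('n list \<Rightarrow> complex) \<Rightarrow> 'n list \<Rightarrow> complex" where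
  "rtens_merged k f f' = (\<lambda>xs. cnj (f (rev (take (Suc k) xs))) * f' (drop k xs))"

lemma merge_rtens_middle:
  assumes "k < length xs"
  shows "merge k (rtens (Suc k) f f') xs = rtens_merged k f f' xs"
proof -
  have "take (Suc k) (ins k (xs ! k) xs) = take (Suc k) xs" "drop (Suc k) (ins k (xs ! k) xs) = drop k xs"
    using assms by (auto simp: take_ins drop_ins take_Suc_conv_app_nth ins_def)
  then show ?thesis using assms by (simp add: merge_def rtens_def rtens_merged_def)
qed

section \<open>Lowering operations on a product of two highest weight vectors\<close>

context
  fixes f f' :: "'n::finite list \<Rightarrow> complex" and k l m :: nat
  assumes f: "f \<in> highest k" and f': "f' \<in> highest l"
begin

text \<open>Away from the junction of the two factors, neighbouring legs belong to the same factor
  and its highest weight condition applies. In \<open>rtens_merged\<close> every pair of neighbours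
  is of this kind, since the shared leg belongs to both factors.\<close>

lemma rtens_adjacent:
  assumes "Suc a < length xs" "xs ! a = xs ! Suc a" "Suc a \<noteq> m"
  shows "rtens m f f' xs = 0"
proof (cases "Suc a < m")
  case True
  then have "f (rev (take m xs)) = 0"
    using assms by (intro highest_adjacent_rev[OF f, of a]) auto
  then show ?thesis by (simp add: rtens_def)
next
  case False
  then have "f' (drop m xs) = 0"
    using assms by (intro highest_adjacent[OF f', of "a - m"]) (auto simp: Suc_diff_le)
  then show ?thesis by (simp add: rtens_def)
qed

lemma rtens_merged_adjacent:
  assumes "Suc a < length xs" "xs ! a = xs ! Suc a"
  shows "rtens_merged m f f' xs = 0"
proof (cases "a < m")
  case True
  then have "f (rev (take (Suc m) xs)) = 0"
    using assms by (intro highest_adjacent_rev[OF f, of a]) auto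
  then show ?thesis by (simp add: rtens_merged_def)
next
  case False
  then have "f' (drop m xs) = 0"
    using assms by (intro highest_adjacent[OF f', of "a - m"]) (auto simp: Suc_diff_le)
  then show ?thesis by (simp add: rtens_merged_def)
qed

lemma merge_rtens: "Suc a \<noteq> m \<Longrightarrow> merge a (rtens m f f') xs = 0"
  by (auto simp: merge_def nth_ins intro!: rtens_adjacent[of a])

lemma merge_rtens_merged: "merge a (rtens_merged m f f') xs = 0"
  by (auto simp: merge_def nth_ins intro!: rtens_merged_adjacent[of a])

lemma contract_rtens: "contract a (rtens m f f') xs = 0" if "m \<le> length xs \<or> a < m"
proof (cases "a \<le> length xs")
  case a: True
  show ?thesis
  proof (cases "a < m")
    case True
    then have "(\<Sum>i\<in>UNIV. f (rev (take m (ins a i xs)))) = 0"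
      using a highest_contract_rev[OF f, of a "take (m - 1) xs"] by (simp add: take_ins)
    then have "(\<Sum>i\<in>UNIV. cnj (f (rev (take m (ins a i xs)))) * f' (drop (m - 1) xs)) = 0"
      by (metis cnj_sum complex_cnj_zero mult_zero_left sum_distrib_right)
    then show ?thesis using True a by (simp add: contract_def rtens_def drop_ins)
  next
    case False
    then have "(\<Sum>i\<in>UNIV. f' (drop m (ins a i xs))) = 0"
      using a that highest_contract[OF f', of "a - m" "drop m xs"] by (simp add: drop_ins)
    then show ?thesis
      using False a by (simp add: contract_def rtens_def take_ins sum_distrib_left[symmetric])
  qed
qed (simp add: contract_def)

text \<open>At any other position the summed leg belongs to only one factor and its sum vanishes. At
  \<open>m\<close> it is shared by both, which is the case of
  \<open>contract_rtens_merged_middle\<close>.\<close>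

lemma contract_rtens_merged: "contract a (rtens_merged m f f') xs = 0" if "a \<noteq> m"
proof (cases "a \<le> length xs")
  case a: True
  show ?thesis
  proof (cases "a < m")
    case True
    then have "(\<Sum>i\<in>UNIV. f (rev (take (Suc m) (ins a i xs)))) = 0"
      using a highest_contract_rev[OF f, of a "take m xs"] by (simp add: take_ins)
    then have "(\<Sum>i\<in>UNIV. cnj (f (rev (take (Suc m) (ins a i xs)))) * f' (drop (m - 1) xs)) = 0"
      by (metis cnj_sum complex_cnj_zero mult_zero_left sum_distrib_right)
    then show ?thesis using True a by (simp add: contract_def rtens_merged_def drop_ins)
  next
    case False
    then have "(\<Sum>i\<in>UNIV. f' (drop m (ins a i xs))) = 0"
      using a that highest_contract[OF f', of "a - m" "drop m xs"] by (simp add: drop_ins)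
    then show ?thesis
      using False a that by (simp add: contract_def rtens_merged_def take_ins sum_distrib_left[symmetric])
  qed
qed (simp add: contract_def)

end

lemma contract_rtens_merged_middle:
  assumes "m \<le> length xs"
  shows "contract m (rtens_merged m f f') xs = (\<Sum>i\<in>UNIV. rtens m (\<lambda>xs. f (i # xs)) (\<lambda>xs. f' (i # xs)) xs)"
proof -
  have "take (Suc m) (ins m i xs) = take m xs @ [i]" "drop m (ins m i xs) = i # drop m xs" for i
    using assms by (simp_all add: ins_def)
  then show ?thesis using assms by (simp add: contract_def rtens_merged_def rtens_def)
qed

lemma cinner_slices:
  "cinner (idx (Suc k)) f g = (\<Sum>i\<in>UNIV. cinner (idx k) (\<lambda>xs. f (i # xs)) (\<lambda>xs. g (i # xs)))"
  for f :: "'n::finite list \<Rightarrow> complex"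
  unfolding cinner_def by (subst sum_idx_ins[of 0]) (simp_all add: ins_def sum.swap[of _ UNIV])

text \<open>Schur's lemma for the highest weight spaces.\<close>

definition schur_scalar :: "nat \<Rightarrow> nat \<Rightarrow> (('n::finite list \<Rightarrow> complex) \<Rightarrow> ('n list \<Rightarrow> complex) \<Rightarrow> 'n list \<Rightarrow> complex) \<Rightarrow>
    nat \<Rightarrow> nat \<Rightarrow> ('n list \<Rightarrow> complex) \<Rightarrow> complex \<Rightarrow> bool" where
  "schur_scalar k l T m n v c \<longleftrightarrow>
     (\<forall>f\<in>highest k. \<forall>f'\<in>highest l. cinner (idx n) (T f f') v = c * cinner (idx m) f' f)"

text \<open>The two statements feed each other. Taking the last raising operation to the other side
  gives 0 unless it acts at the junction: there a merge turns \<open>rtens\<close> into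
  \<open>rtens_merged\<close>, and a contraction of the shared leg strips one leg from each factor
  and returns to \<open>rtens\<close>. What is left when all legs are used up is the inner product
  of \<open>f'\<close> and \<open>f\<close>.\<close>

lemma nc_schur_aux:
  assumes "nc n (v :: 'n::finite list \<Rightarrow> complex)"
  shows "(\<forall>k l. k + l = n \<longrightarrow> (\<exists>c. schur_scalar k l (rtens k) k n v c)) \<and>
    (\<forall>k l. k + l + 1 = n \<longrightarrow> (\<exists>c. schur_scalar (Suc k) (Suc l) (rtens_merged k) (Suc k) n v c))"
  using assms
proof (induction rule: nc.induct)
  case unit
  have "schur_scalar 0 0 (rtens 0) 0 0 (\<lambda>xs. if xs = [] then 1 else 0) (1::complex)"
    by (simp add: schur_scalar_def idx_0 cinner_def rtens_def)
  then show ?case by auto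
next
  case (zero n)
  then show ?case by (auto simp: schur_scalar_def cinner_simps)
next
  case (add n v w)
  have "schur_scalar k l T m n (\<lambda>xs. v xs + w xs) (c + d)"
    if "schur_scalar k l T m n v c" "schur_scalar k l T m n w d" for k l T m c d
    using that by (simp add: schur_scalar_def cinner_simps distrib_right)
  then have "\<exists>c. schur_scalar k l T m n (\<lambda>xs. v xs + w xs) c"
    if "\<exists>c. schur_scalar k l T m n v c" "\<exists>d. schur_scalar k l T m n w d" for k l T m
    using that by blast
  then show ?case using add.IH by simp
next
  case (scale n v c)
  have "schur_scalar k l T m n (\<lambda>xs. c * v xs) (c * d)" if "schur_scalar k l T m n v d" for k l T m d
    using that by (simp add: schur_scalar_def cinner_simps)
  then have "\<exists>d. schur_scalar k l T m n (\<lambda>xs. c * v xs) d" if "\<exists>d. schur_scalar k l T m n v d" for k l T m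
    using that by blast
  then show ?case using scale.IH by simp
next
  case (merge_adj n v a)
  have 1: "\<exists>c. schur_scalar k l (rtens k) k (Suc n) (merge_adj a v) c" if kl: "k + l = Suc n" for k l
  proof (cases "Suc a = k \<and> l > 0")
    case True
    then obtain l' where k: "k = Suc a" and l: "l = Suc l'" by (cases l) auto
    have n: "n = a + l' + 1" using kl k l by simp
    obtain c where c: "schur_scalar (Suc a) (Suc l') (rtens_merged a) (Suc a) n v c"
      using merge_adj.IH n by blast
    have "cinner (idx n) (merge a (rtens (Suc a) f f')) v = cinner (idx n) (rtens_merged a f f') v" for f f'
      unfolding cinner_def using n by (intro sum.cong refl) (simp add: merge_rtens_middle idx_def)
    then have "schur_scalar k l (rtens k) k (Suc n) (merge_adj a v) c"
      using c by (simp add: schur_scalar_def cinner_merge_adj k l)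
    then show ?thesis by blast
  next
    case False
    \<comment> \<open>Either \<open>a\<close> is not at the junction, or \<open>l = 0\<close> and
      there is no leg to its right, so that position \<open>a\<close> is out of range.\<close>
    have "merge a (rtens k f f') xs = 0" if "f \<in> highest k" "f' \<in> highest l" "xs \<in> idx n" for f f' and xs :: "'n list"
    proof (cases "Suc a = k")
      case True
      then have "n = a" using False kl by simp
      then show ?thesis using that by (simp add: merge_def idx_def)
    next
      case False
      then show ?thesis using merge_rtens[OF that(1,2)] by simp
    qed
    then have "schur_scalar k l (rtens k) k (Suc n) (merge_adj a v) 0"
      by (simp add: schur_scalar_def cinner_merge_adj) (simp add: cinner_def)
    then show ?thesis by blast
  qed
  have 2: "\<exists>c. schur_scalar (Suc k) (Suc l) (rtens_merged k) (Suc k) (Suc n) (merge_adj a v) c" for k l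
  proof -
    have "schur_scalar (Suc k) (Suc l) (rtens_merged k) (Suc k) (Suc n) (merge_adj a v) 0"
      by (simp add: schur_scalar_def cinner_merge_adj) (simp add: cinner_def merge_rtens_merged)
    then show ?thesis by blast
  qed
  show ?case using 1 2 by blast
next
  case (contract_adj n v a)
  have 1: "\<exists>c. schur_scalar k l (rtens k) k (Suc n) (contract_adj a v) c" if kl: "k + l = Suc n" for k l
  proof -
    have "contract a (rtens k f f') xs = 0" if "f \<in> highest k" "f' \<in> highest l" "xs \<in> idx n" for f f' and xs :: "'n list"
    proof (cases "a \<le> n")
      case True
      then have "k \<le> length xs \<or> a < k" using that kl by (auto simp: idx_def)
      then show ?thesis using contract_rtens[OF that(1,2)] by blast
    next
      case False
      then show ?thesis using that by (simp add: idx_def contract_def)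
    qed
    then have "schur_scalar k l (rtens k) k (Suc n) (contract_adj a v) 0"
      by (simp add: schur_scalar_def cinner_contract_adj) (simp add: cinner_def)
    then show ?thesis by blast
  qed
  have 2: "\<exists>c. schur_scalar (Suc k) (Suc l) (rtens_merged k) (Suc k) (Suc n) (contract_adj a v) c"
    if kl: "k + l + 1 = Suc n" for k l
  proof (cases "a = k")
    case True
    have "k + l = n" using kl by simp
    then obtain c where c: "schur_scalar k l (rtens k) k n v c" using contract_adj.IH by blast
    have "cinner (idx n) (contract k (rtens_merged k f f')) v = c * cinner (idx (Suc k)) f' f"
      if "f \<in> highest (Suc k)" "f' \<in> highest (Suc l)" for f f'
    proof -
      have "cinner (idx n) (contract k (rtens_merged k f f')) v =
          cinner (idx n) (\<lambda>xs. \<Sum>i\<in>UNIV. 1 * rtens k (\<lambda>xs. f (i # xs)) (\<lambda>xs. f' (i # xs)) xs) v"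
        unfolding cinner_def using kl
        by (intro sum.cong refl) (simp add: contract_rtens_merged_middle idx_def)
      also have "\<dots> = (\<Sum>i\<in>UNIV. cinner (idx n) (rtens k (\<lambda>xs. f (i # xs)) (\<lambda>xs. f' (i # xs))) v)"
        unfolding cinner_sum_left by simp
      also have "\<dots> = (\<Sum>i\<in>UNIV. c * cinner (idx k) (\<lambda>xs. f' (i # xs)) (\<lambda>xs. f (i # xs)))"
        by (intro sum.cong refl c[unfolded schur_scalar_def, rule_format] highest_slice that)
      finally show ?thesis by (simp add: cinner_slices sum_distrib_left)
    qed
    then have "schur_scalar (Suc k) (Suc l) (rtens_merged k) (Suc k) (Suc n) (contract_adj a v) c"
      by (simp add: schur_scalar_def cinner_contract_adj True)
    then show ?thesis by blast
  next
    case False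
    then have "schur_scalar (Suc k) (Suc l) (rtens_merged k) (Suc k) (Suc n) (contract_adj a v) 0"
      by (simp add: schur_scalar_def cinner_contract_adj) (simp add: cinner_def contract_rtens_merged)
    then show ?thesis by blast
  qed
  show ?case using 1 2 by blast
qed

lemma nc_schur:
  assumes "nc (k + l) (v :: 'n::finite list \<Rightarrow> complex)"
  shows "\<exists>c. \<forall>f\<in>highest k. \<forall>f'\<in>highest l. cinner (idx (k + l)) (rtens k f f') v = c * cinner (idx k) f' f"
  using nc_schur_aux[OF assms] by (auto simp: schur_scalar_def)

text \<open>The identity operator of the \<open>k\<close>-th tensor power, bent into a vector: the
  rainbow pairing. It is noncrossing and its Schur scalar is 1, which keeps the weights in
  \<open>haar_orthogonality\<close> from vanishing.\<close>

definition id_vec :: "nat \<Rightarrow> 'n list \<Rightarrow> complex" where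
  "id_vec k = (\<lambda>xs. if length xs = 2 * k \<and> rev (take k xs) = drop k xs then 1 else 0)"

lemma nc_id_vec: "nc (2 * k) (id_vec k)"
proof (induction k)
  case 0
  have "id_vec 0 = (\<lambda>xs :: 'a list. if xs = [] then 1 else 0)" by (auto simp: id_vec_def)
  then show ?case by (simp add: nc.unit)
next
  case (Suc k)
  \<comment> \<open>The rainbow grows from its centre: a free leg is created at position
    \<open>k\<close> and then duplicated into the new innermost pair.\<close>
  have "id_vec (Suc k) xs = merge_adj k (contract_adj k (id_vec k)) xs" for xs :: "'a list"
  proof (cases "length xs = 2 * Suc k")
    case True
    define A where "A = take k xs"
    define B where "B = drop (Suc (Suc k)) xs"
    have len: "length A = k" "length B = k" using True by (simp_all add: A_def B_def)
    have "xs = A @ xs ! k # xs ! Suc k # B"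
      using True by (simp add: A_def B_def Cons_nth_drop_Suc id_take_nth_drop[symmetric])
    then obtain x y where "xs = A @ x # y # B" by blast
    then show ?thesis using len
      by (auto simp: id_vec_def merge_adj_def contract_adj_def del_def nth_append)
  next
    case False
    then show ?thesis by (auto simp: id_vec_def merge_adj_def contract_adj_def)
  qed
  then have "id_vec (Suc k) = (merge_adj k (contract_adj k (id_vec k)) :: 'a list \<Rightarrow> complex)" by blast
  then show ?case using Suc by (simp add: nc.merge_adj nc.contract_adj)
qed

lemma sum_idx_add:
  fixes F :: "'n::finite list \<Rightarrow> 'n list \<Rightarrow> 'a::comm_monoid_add"
  shows "(\<Sum>xs\<in>idx (k + l). F (rev (take k xs)) (drop k xs)) = (\<Sum>xs\<in>idx k. \<Sum>ys\<in>idx l. F xs ys)"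
proof -
  have "(\<Sum>xs\<in>idx (k + l). F (rev (take k xs)) (drop k xs)) = (\<Sum>(xs, ys)\<in>idx k \<times> idx l. F xs ys)"
    by (rule sum.reindex_bij_witness[of _ "\<lambda>(xs, ys). rev xs @ ys" "\<lambda>xs. (rev (take k xs), drop k xs)"])
       (auto simp: idx_def)
  then show ?thesis by (simp add: sum.cartesian_product)
qed

lemma cinner_rtens_id_vec:
  "cinner (idx (k + k)) (rtens k f f') (id_vec k) = cinner (idx k) f' f" for f :: "'n::finite list \<Rightarrow> complex"
proof -
  have "cinner (idx (k + k)) (rtens k f f') (id_vec k) =
      (\<Sum>xs\<in>idx (k + k). f (rev (take k xs)) * cnj (f' (drop k xs)) * (if rev (take k xs) = drop k xs then 1 else 0))"
    unfolding cinner_def by (intro sum.cong refl) (simp add: rtens_def id_vec_def idx_def)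
  also have "\<dots> = (\<Sum>xs\<in>idx k. \<Sum>ys\<in>idx k. f xs * cnj (f' ys) * (if xs = ys then 1 else 0))"
    by (rule sum_idx_add)
  also have "\<dots> = cinner (idx k) f' f"
    by (simp add: cinner_def if_distrib[of "\<lambda>c. _ * c"] mult.commute cong: if_cong)
  finally show ?thesis .
qed

section \<open>Matrix coefficients of the tensor powers\<close>

lemma clinear_simps:
  assumes "clinear f"
  shows "f (x + y) = f x + f y" "f (c *\<^sub>C x) = c *\<^sub>C f x" "f 0 = 0" "f (- x) = - f x" "f (x - y) = f x - f y"
proof -
  show add: "f (x + y) = f x + f y" and scale: "f (c *\<^sub>C x) = c *\<^sub>C f x" for x y c
    using assms by (auto simp: clinear_iff)
  show zero: "f 0 = 0" using add[of 0 0] by simp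
  show minus: "f (- x) = - f x" for x using add[of x "- x"] zero by (simp add: minus_unique)
  show "f (x - y) = f x - f y" using add[of x "- y"] minus[of y] by simp
qed

lemma clinear_sum: "clinear f \<Longrightarrow> f (sum g A) = (\<Sum>a\<in>A. f (g a))"
  by (induction A rule: infinite_finite_induct) (simp_all add: clinear_simps)

text \<open>Matrix entries of the tensor powers of the fundamental representation. The value 0 for
  unequal lengths lets identities such as \<open>star_pm\<close> and \<open>eps_pm\<close> hold
  without a length condition.\<close>

fun pm :: "'n::finite list \<Rightarrow> 'n list \<Rightarrow> 'n qperm" where
  "pm [] [] = 1"
| "pm (i # xs) (j # ys) = qperm_gen i j * pm xs ys"
| "pm [] (j # ys) = 0"
| "pm (i # xs) [] = 0"

lemma pm_length: "length xs \<noteq> length ys \<Longrightarrow> pm xs ys = 0"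
  by (induction xs ys rule: pm.induct) auto

lemma pm_append: "length xs = length ys \<Longrightarrow> pm (xs @ xs') (ys @ ys') = pm xs ys * pm xs' ys'"
  by (induction xs ys rule: list_induct2) (simp_all add: mult.assoc)

lemma star_pm: "star (pm xs ys) = pm (rev xs) (rev ys)"
proof (cases "length xs = length ys")
  case True
  then show ?thesis
    by (induction xs ys rule: list_induct2) (simp_all add: star_one star_mult pm_append qperm_gen_relations)
next
  case False
  then show ?thesis by (simp add: pm_length star_zero)
qed

lemma pm_induct [case_names pm scale add]:
  assumes pm: "\<And>xs ys. length xs = length ys \<Longrightarrow> P (pm xs ys)"
    and scale: "\<And>c x. P x \<Longrightarrow> P (c *\<^sub>C x)" and add: "\<And>x y. P x \<Longrightarrow> P y \<Longrightarrow> P (x + y)"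
  shows "P (x :: 'n::finite qperm)"
proof -
  \<comment> \<open>The left factor is an accumulator: every generator that the induction strips off
    \<open>x\<close> is appended to the word.\<close>
  have "\<forall>xs ys. length xs = length ys \<longrightarrow> P (pm xs ys * x)"
  proof (induction x rule: qperm_induct)
    case one
    then show ?case using pm by simp
  next
    case (gen_mult i j x)
    show ?case
    proof (intro allI impI)
      fix xs ys :: "'n list" assume "length xs = length ys"
      then have "pm (xs @ [i]) (ys @ [j]) * x = pm xs ys * (qperm_gen i j * x)"
        by (simp add: pm_append mult.assoc)
      then show "P (pm xs ys * (qperm_gen i j * x))"
        using gen_mult \<open>length xs = length ys\<close> by (metis length_append_singleton)
    qed
  next
    case (scale c x)
    then show ?case using assms(2) by (simp add: scaleC_mult_right)
  next
    case (add x y)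
    then show ?case using assms(3) by (simp add: distrib_left)
  qed
  from this[rule_format, of "[]" "[]"] show ?thesis by simp
qed

lemma clinear_eqI_pm:
  fixes f g :: "'n::finite qperm \<Rightarrow> 'a::complex_vector"
  assumes "clinear f" "clinear g" "\<And>xs ys. length xs = length ys \<Longrightarrow> f (pm xs ys) = g (pm xs ys)"
  shows "f x = g x"
  by (induction x rule: pm_induct) (simp_all add: assms clinear_simps)

lemma pm_ins:
  assumes "length ys = Suc (length xs)" "a \<le> length xs"
  shows "pm (ins a i xs) ys = pm (take a xs) (take a ys) * (qperm_gen i (ys ! a) * pm (drop a xs) (drop (Suc a) ys))"
    and "pm ys (ins a i xs) = pm (take a ys) (take a xs) * (qperm_gen (ys ! a) i * pm (drop (Suc a) ys) (drop a xs))"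
proof -
  have "pm (ins a i xs) (take a ys @ ys ! a # drop (Suc a) ys) =
      pm (take a xs) (take a ys) * (qperm_gen i (ys ! a) * pm (drop a xs) (drop (Suc a) ys))"
    using assms by (simp add: ins_def pm_append)
  then show "pm (ins a i xs) ys = pm (take a xs) (take a ys) * (qperm_gen i (ys ! a) * pm (drop a xs) (drop (Suc a) ys))"
    using assms by (simp add: id_take_nth_drop[symmetric])
  have "pm (take a ys @ ys ! a # drop (Suc a) ys) (ins a i xs) =
      pm (take a ys) (take a xs) * (qperm_gen (ys ! a) i * pm (drop (Suc a) ys) (drop a xs))"
    using assms by (simp add: ins_def pm_append)
  then show "pm ys (ins a i xs) = pm (take a ys) (take a xs) * (qperm_gen (ys ! a) i * pm (drop (Suc a) ys) (drop a xs))"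
    using assms by (simp add: id_take_nth_drop[symmetric])
qed

lemma qperm_gen_mult:
  "qperm_gen i j * (qperm_gen i l * x) = (if j = l then qperm_gen i j * x else 0)"
  "qperm_gen i j * (qperm_gen l j * x) = (if i = l then qperm_gen i j * x else 0)"
  by (simp_all add: mult.assoc[symmetric] qperm_gen_relations)

text \<open>Merging neighbouring legs intertwines the tensor powers: two adjacent generators with a
  common row, or a common column, either absorb each other or have product 0.\<close>

lemma pm_merge:
  assumes "length ys = Suc (length xs)" "a < length xs"
  shows "pm (ins a (xs ! a) xs) ys = (if ys ! a = ys ! Suc a then pm xs (del a ys) else 0)"
    and "pm ys (ins a (xs ! a) xs) = (if ys ! a = ys ! Suc a then pm (del a ys) xs else 0)"
proof -
  have xs: "drop a xs = xs ! a # drop (Suc a) xs" and ys: "drop (Suc a) ys = ys ! Suc a # drop (Suc (Suc a)) ys"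
    using assms by (simp_all add: Cons_nth_drop_Suc)
  have xs': "xs = ins a (xs ! a) (del a xs)" using assms by (simp add: ins_del)
  have eq: "take a (del a xs) = take a xs" "drop a (del a xs) = drop (Suc a) xs"
    "take a (del a ys) = take a ys" "del a ys ! a = ys ! Suc a"
    "drop (Suc a) (del a ys) = drop (Suc (Suc a)) ys"
    using assms by (auto simp: del_def nth_append min_def)
  have 1: "pm xs (del a ys) = pm (take a xs) (take a ys) * (qperm_gen (xs ! a) (ys ! Suc a) *
      pm (drop (Suc a) xs) (drop (Suc (Suc a)) ys))"
    using pm_ins(1)[of "del a ys" "del a xs" a "xs ! a"] assms by (simp add: ins_del eq)
  have 2: "pm (del a ys) xs = pm (take a ys) (take a xs) * (qperm_gen (ys ! Suc a) (xs ! a) *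
      pm (drop (Suc (Suc a)) ys) (drop (Suc a) xs))"
    using pm_ins(2)[of "del a ys" "del a xs" a "xs ! a"] assms by (simp add: ins_del eq)
  show "pm (ins a (xs ! a) xs) ys = (if ys ! a = ys ! Suc a then pm xs (del a ys) else 0)"
    using assms by (simp add: pm_ins 1 xs ys qperm_gen_mult)
  show "pm ys (ins a (xs ! a) xs) = (if ys ! a = ys ! Suc a then pm (del a ys) xs else 0)"
    using assms by (simp add: pm_ins 2 xs ys qperm_gen_mult)
qed

text \<open>Summation over a leg is an intertwiner as well, since the rows and columns of generators
  sum to 1.\<close>

lemma pm_contract:
  assumes "length ys = Suc (length xs)" "a \<le> length xs"
  shows "(\<Sum>i\<in>UNIV. pm (ins a i xs) ys) = pm xs (del a ys)"
    and "(\<Sum>i\<in>UNIV. pm ys (ins a i xs)) = pm (del a ys) xs"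
proof -
  have 1: "pm xs (del a ys) = pm (take a xs) (take a ys) * pm (drop a xs) (drop (Suc a) ys)"
    and 2: "pm (del a ys) xs = pm (take a ys) (take a xs) * pm (drop (Suc a) ys) (drop a xs)"
    using pm_append[of "take a xs" "take a ys" "drop a xs" "drop (Suc a) ys"]
      pm_append[of "take a ys" "take a xs" "drop (Suc a) ys" "drop a xs"] assms by (simp_all add: del_def)
  show "(\<Sum>i\<in>UNIV. pm (ins a i xs) ys) = pm xs (del a ys)"
    unfolding pm_ins[OF assms] 1 by (simp add: sum_distrib_left[symmetric] sum_distrib_right[symmetric] qperm_gen_relations)
  show "(\<Sum>i\<in>UNIV. pm ys (ins a i xs)) = pm (del a ys) xs"
    unfolding pm_ins[OF assms] 2 by (simp add: sum_distrib_left[symmetric] sum_distrib_right[symmetric] qperm_gen_relations)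
qed

text \<open>With U the \<open>k\<close>-th tensor power, \<open>prow\<close> is the row vector f^t
  U, \<open>pcol\<close> the column vector U g and \<open>cf\<close> the coefficient of U between f
  and g. Only \<open>cf\<close> conjugates its first vector.\<close>

definition prow :: "nat \<Rightarrow> ('n::finite list \<Rightarrow> complex) \<Rightarrow> 'n list \<Rightarrow> 'n qperm" where
  "prow k f ys = (\<Sum>xs\<in>idx k. f xs *\<^sub>C pm xs ys)"

definition pcol :: "nat \<Rightarrow> ('n::finite list \<Rightarrow> complex) \<Rightarrow> 'n list \<Rightarrow> 'n qperm" where
  "pcol k g xs = (\<Sum>ys\<in>idx k. g ys *\<^sub>C pm xs ys)"

definition cf :: "nat \<Rightarrow> ('n::finite list \<Rightarrow> complex) \<Rightarrow> ('n list \<Rightarrow> complex) \<Rightarrow> 'n qperm" where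
  "cf k f g = (\<Sum>ys\<in>idx k. g ys *\<^sub>C prow k (\<lambda>xs. cnj (f xs)) ys)"

lemma cf_pcol: "cf k f g = (\<Sum>xs\<in>idx k. cnj (f xs) *\<^sub>C pcol k g xs)"
  unfolding cf_def prow_def pcol_def cvec.scale_sum_right
  by (subst sum.swap) (simp add: scaleC_scaleC mult.commute)

lemma prow_merge_adj:
  assumes "ys \<in> idx (Suc k)"
  shows "prow (Suc k) (merge_adj a f) ys = (if a < k \<and> ys ! a = ys ! Suc a then prow k f (del a ys) else 0)"
  using assms unfolding prow_def sum_merge_adj by (auto simp: idx_def pm_merge)

lemma prow_contract_adj:
  assumes "ys \<in> idx (Suc k)"
  shows "prow (Suc k) (contract_adj a f) ys = (if a \<le> k then prow k f (del a ys) else 0)"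
  using assms unfolding prow_def sum_contract_adj by (auto simp: idx_def pm_contract)

lemma pcol_merge_adj:
  assumes "ys \<in> idx (Suc k)"
  shows "pcol (Suc k) (merge_adj a f) ys = (if a < k \<and> ys ! a = ys ! Suc a then pcol k f (del a ys) else 0)"
  using assms unfolding pcol_def sum_merge_adj by (auto simp: idx_def pm_merge)

lemma pcol_contract_adj:
  assumes "ys \<in> idx (Suc k)"
  shows "pcol (Suc k) (contract_adj a f) ys = (if a \<le> k then pcol k f (del a ys) else 0)"
  using assms unfolding pcol_def sum_contract_adj by (auto simp: idx_def pm_contract)

lemma sum_merge:
  fixes F :: "'n::finite list \<Rightarrow> 'a::complex_vector"
  shows "(\<Sum>ys\<in>idx (Suc k). g ys *\<^sub>C (if a < k \<and> ys ! a = ys ! Suc a then F (del a ys) else 0)) =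
    (\<Sum>ys\<in>idx k. merge a g ys *\<^sub>C F ys)"
proof (cases "a < k")
  case True
  then have "(\<Sum>ys\<in>idx (Suc k). g ys *\<^sub>C (if a < k \<and> ys ! a = ys ! Suc a then F (del a ys) else 0)) =
      (\<Sum>ys\<in>idx k. \<Sum>i\<in>UNIV. if i = ys ! a then g (ins a i ys) *\<^sub>C F ys else 0)"
    by (subst sum_idx_ins[of a]) (simp, intro sum.cong refl, auto simp: idx_def nth_ins del_ins)
  then show ?thesis using True by (simp add: merge_def idx_def)
next
  case False
  then show ?thesis by (simp add: merge_def idx_def)
qed

lemma sum_contract:
  fixes F :: "'n::finite list \<Rightarrow> 'a::complex_vector"
  shows "(\<Sum>ys\<in>idx (Suc k). g ys *\<^sub>C (if a \<le> k then F (del a ys) else 0)) =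
    (\<Sum>ys\<in>idx k. contract a g ys *\<^sub>C F ys)"
proof (cases "a \<le> k")
  case True
  then show ?thesis
    by (subst sum_idx_ins[of a]) (auto intro!: sum.cong simp: idx_def del_ins contract_def cvec.scale_sum_left)
next
  case False
  then show ?thesis by (simp add: contract_def idx_def)
qed

lemma cnj_leg_ops:
  "(\<lambda>xs. cnj (merge_adj a f xs)) = merge_adj a (\<lambda>xs. cnj (f xs))"
  "(\<lambda>xs. cnj (contract_adj a f xs)) = contract_adj a (\<lambda>xs. cnj (f xs))"
  "cnj (merge a f xs) = merge a (\<lambda>xs. cnj (f xs)) xs"
  "cnj (contract a g xs) = contract a (\<lambda>xs. cnj (g xs)) xs"
  by (auto simp: leg_ops_def)

text \<open>Since the leg operations are intertwiners, raising one argument amounts to lowering the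
  other. The degree drops, which drives the reduction of all coefficients to highest weight
  vectors.\<close>

lemma cf_raise_left:
  "cf (Suc k) (merge_adj a f) g = cf k f (merge a g)"
  "cf (Suc k) (contract_adj a f) g = cf k f (contract a g)"
  unfolding cf_def cnj_leg_ops
  by (simp_all add: prow_merge_adj prow_contract_adj sum_merge sum_contract cong: sum.cong)

lemma cf_raise_right:
  "cf (Suc k) f (merge_adj a g) = cf k (merge a f) g"
  "cf (Suc k) f (contract_adj a g) = cf k (contract a f) g"
  unfolding cf_pcol cnj_leg_ops
  by (simp_all add: pcol_merge_adj pcol_contract_adj sum_merge[where g = "\<lambda>x. cnj (f x)"]
      sum_contract[where g = "\<lambda>x. cnj (f x)"] cong: sum.cong)

lemma cf_simps:
  "cf k (\<lambda>x. f x + f' x) g = cf k f g + cf k f' g"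
  "cf k (\<lambda>x. c * f x) g = cnj c *\<^sub>C cf k f g"
  "cf k (\<lambda>x. 0) g = 0"
  "cf k f (\<lambda>x. g x + g' x) = cf k f g + cf k f g'"
  "cf k f (\<lambda>x. c * g x) = c *\<^sub>C cf k f g"
  "cf k f (\<lambda>x. 0) = 0"
proof -
  show "cf k (\<lambda>x. f x + f' x) g = cf k f g + cf k f' g" "cf k (\<lambda>x. c * f x) g = cnj c *\<^sub>C cf k f g"
    "cf k (\<lambda>x. 0) g = 0"
    unfolding cf_pcol by (simp_all add: scaleC_add_left sum.distrib cvec.scale_sum_right scaleC_scaleC)
  show "cf k f (\<lambda>x. g x + g' x) = cf k f g + cf k f g'" "cf k f (\<lambda>x. c * g x) = c *\<^sub>C cf k f g"
    "cf k f (\<lambda>x. 0) = 0"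
    unfolding cf_def by (simp_all add: scaleC_add_left sum.distrib cvec.scale_sum_right scaleC_scaleC)
qed

lemma cf_sum_left: "cf k (\<lambda>x. \<Sum>b\<in>B. c b * F b x) g = (\<Sum>b\<in>B. cnj (c b) *\<^sub>C cf k (F b) g)"
  by (induction B rule: infinite_finite_induct) (simp_all add: cf_simps)

lemma cf_sum_right: "cf k f (\<lambda>x. \<Sum>b\<in>B. c b * F b x) = (\<Sum>b\<in>B. c b *\<^sub>C cf k f (F b))"
  by (induction B rule: infinite_finite_induct) (simp_all add: cf_simps)

lemma cf_delta_left: "xs \<in> idx k \<Longrightarrow> cf k (\<lambda>x. if x = xs then 1 else 0) g = pcol k g xs"
  by (simp add: cf_pcol if_distrib[of cnj] if_distrib[of "\<lambda>c. c *\<^sub>C _"] scaleC_one cong: if_cong)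

lemma pcol_delta: "ys \<in> idx k \<Longrightarrow> pcol k (\<lambda>y. if y = ys then 1 else 0) xs = pm xs ys"
  by (simp add: pcol_def if_distrib[of "\<lambda>c. c *\<^sub>C _"] scaleC_one cong: if_cong)

lemma cf_delta_right: "ys \<in> idx k \<Longrightarrow> cf k f (\<lambda>y. if y = ys then 1 else 0) = prow k (\<lambda>xs. cnj (f xs)) ys"
  by (simp add: cf_def if_distrib[of "\<lambda>c. c *\<^sub>C _"] scaleC_one cong: if_cong)

text \<open>Moved to the other argument, the raising operation becomes a lowering one and kills it.
  Each tensor power is thus block diagonal with respect to raised and highest weight
  vectors.\<close>

lemma cf_raised_highest:
  "raised k f \<Longrightarrow> g \<in> highest k \<Longrightarrow> cf k f g = 0"
  "raised k g \<Longrightarrow> f \<in> highest k \<Longrightarrow> cf k f g = 0"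
proof -
  show "cf k f g = 0" if "raised k f" "g \<in> highest k"
    using that by (induction rule: raised.induct) (simp_all add: cf_simps cf_raise_left highest_def)
  show "cf k f g = 0" if "raised k g" "f \<in> highest k"
    using that by (induction rule: raised.induct) (simp_all add: cf_simps cf_raise_right highest_def)
qed

text \<open>Each \<open>cf k f g\<close> with \<open>f\<close> or \<open>g\<close> raised is a coefficient of a lower tensor power.\<close>

lemma highest_induct [case_names cf scale add]:
  assumes cf: "\<And>k f g. f \<in> highest k \<Longrightarrow> g \<in> highest k \<Longrightarrow> P (cf k f g)"
    and scale: "\<And>c x. P x \<Longrightarrow> P (c *\<^sub>C x)" and add: "\<And>x y. P x \<Longrightarrow> P y \<Longrightarrow> P (x + y)"
  shows "P (x :: 'n::finite qperm)"
proof -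
  have zero: "P 0"
  proof -
    have "(\<lambda>xs :: 'n list. 0) \<in> highest 0" by (simp add: highest_def supp_def leg_ops_linear)
    from cf[OF this this] show ?thesis by (simp add: cf_simps)
  qed
  have all: "P (cf k f g)" if "supp k f" "supp k g" for k and f g :: "'n list \<Rightarrow> complex"
    using that
  proof (induction k arbitrary: f g rule: less_induct)
    case (less k)
    have left: "P (cf k w g)" if "raised k w" "supp k g" for w g
      using that(1) less.IH that(2)
      by (induction rule: raised.induct)
         (auto simp: cf_simps cf_raise_left zero intro!: add scale supp_leg_ops(3,4))
    have right: "P (cf k f w)" if "raised k w" "supp k f" for w f
      using that(1) less.IH that(2)
      by (induction rule: raised.induct)
         (auto simp: cf_simps cf_raise_right zero intro!: add scale supp_leg_ops(3,4))
    obtain w l where f: "raised k w" "l \<in> highest k" "f = (\<lambda>xs. w xs + l xs)"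
      using raised_highest_decomposition[OF less.prems(1)] by blast
    obtain w' l' where g: "raised k w'" "l' \<in> highest k" "g = (\<lambda>xs. w' xs + l' xs)"
      using raised_highest_decomposition[OF less.prems(2)] by blast
    have "cf k f g = cf k w g + (cf k l w' + cf k l l')"
      by (simp add: f(3) g(3) cf_simps)
    then show ?case
      using left[OF f(1) less.prems(2)] right[OF g(1) highest_supp[OF f(2)]] cf[OF f(2) g(2)] add by simp
  qed
  have "P (pm xs ys)" if "length xs = length ys" for xs ys
  proof -
    have "cf (length ys) (\<lambda>x. if x = xs then 1 else 0) (\<lambda>y. if y = ys then 1 else 0) = pm xs ys"
      using that by (simp add: cf_delta_left pcol_delta idx_def)
    moreover have "supp (length ys) (\<lambda>x. if x = xs then 1 else 0)" "supp (length ys) (\<lambda>x. if x = ys then 1 else 0)"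
      using that by (auto simp: supp_def)
    ultimately show ?thesis using all by metis
  qed
  then show ?thesis using scale add by (induction x rule: pm_induct) auto
qed

section \<open>The counit and the Haar state\<close>

lemma scaleC_complex: "c *\<^sub>C (x :: complex) = c * x"
  by (simp add: scaleC_complex_def)

text \<open>The functional wanted is not multiplicative, so the universal property does not provide
  it. Instead \<open>b\<close> is extended linearly over words and shown to vanish on every defining
  relation placed between two words; the hypotheses are these cases.\<close>

lemma qperm_functional:
  fixes b :: "'n::finite list \<Rightarrow> 'n list \<Rightarrow> complex"
  assumes merge_row: "\<And>xs ys xs' ys' i j l. length xs = length ys \<Longrightarrow> length xs' = length ys' \<Longrightarrow>
      b (xs @ i # i # xs') (ys @ j # l # ys') = (if j = l then b (xs @ i # xs') (ys @ j # ys') else 0)"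
    and merge_col: "\<And>xs ys xs' ys' i j l. length xs = length ys \<Longrightarrow> length xs' = length ys' \<Longrightarrow>
      b (xs @ i # l # xs') (ys @ j # j # ys') = (if i = l then b (xs @ i # xs') (ys @ j # ys') else 0)"
    and sum_row: "\<And>xs ys xs' ys' j. length xs = length ys \<Longrightarrow> length xs' = length ys' \<Longrightarrow>
      (\<Sum>i\<in>UNIV. b (xs @ i # xs') (ys @ j # ys')) = b (xs @ xs') (ys @ ys')"
    and sum_col: "\<And>xs ys xs' ys' i. length xs = length ys \<Longrightarrow> length xs' = length ys' \<Longrightarrow>
      (\<Sum>j\<in>UNIV. b (xs @ i # xs') (ys @ j # ys')) = b (xs @ xs') (ys @ ys')"
  shows "\<exists>f. clinear f \<and> (\<forall>xs ys. length xs = length ys \<longrightarrow> f (pm xs ys) = b xs ys)"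
proof -
  \<comment> \<open>A letter and its formal adjoint get the same indices, because the generators are
    self-adjoint.\<close>
  define rl where "rl = case_letter (\<lambda>i j :: 'n. i) (\<lambda>i j. i)"
  define cl where "cl = case_letter (\<lambda>i j :: 'n. j) (\<lambda>i j. j)"
  define \<beta> where "\<beta> w = b (map rl (letters w)) (map cl (letters w))" for w
  define E where "E = lin_ext \<beta>"
  have E_add: "E (f + g) = E f + E g" and E_diff: "E (f - g) = E f - E g" and E_zero: "E 0 = 0"
    and E_sum: "E (sum F A) = (\<Sum>a\<in>A. E (F a))" and E_single: "E (Poly_Mapping.single k c) = c * \<beta> k"
    for f g F k c and A :: "'n set"
    by (simp_all add: E_def lin_ext_add lin_ext_diff lin_ext_zero lin_ext_sum lin_ext_single scaleC_complex)
  have star_zero: "free_star 0 = (0 :: 'n free_star_algebra)"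
    using free_star_diff[of 0 "0 :: 'n free_star_algebra"] by simp
  have star_one: "free_star 1 = (1 :: 'n free_star_algebra)"
  proof -
    have "word_star 0 = (0 :: 'n letter word)" by (simp add: word_star_def zero_word_def)
    then show ?thesis using free_star_single[of "0 :: 'n letter word" 1] by simp
  qed
  have star_sum: "free_star (sum F A) = (\<Sum>a\<in>A. free_star (F a))"
    for F :: "'n \<Rightarrow> 'n free_star_algebra" and A
    by (induction A rule: infinite_finite_induct) (simp_all add: star_zero free_star_add)
  have van1: "E (Poly_Mapping.single k c * r * Poly_Mapping.single l d) = 0"
    if "r \<in> magic_unitary_relations \<union> free_star ` magic_unitary_relations" for r k l c d
  proof -
    define G where "G = (\<lambda>r. E (Poly_Mapping.single k c * r * Poly_Mapping.single l d))"
    define xs where "xs = map rl (letters k)"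
    define ys where "ys = map cl (letters k)"
    define xs' where "xs' = map rl (letters l)"
    define ys' where "ys' = map cl (letters l)"
    have len: "length xs = length ys" "length xs' = length ys'"
      by (simp_all add: xs_def ys_def xs'_def ys'_def)
    have G_diff: "G (f - g) = G f - G g" and G_zero: "G 0 = 0" for f g
      by (simp_all add: G_def left_diff_distrib right_diff_distrib E_diff E_zero)
    have G_sum: "G (sum F A) = (\<Sum>a\<in>A. G (F a))" for F and A :: "'n set"
      by (simp add: G_def sum_distrib_left sum_distrib_right E_sum)
    have G1: "G 1 = c * d * b (xs @ xs') (ys @ ys')"
      by (simp add: G_def mult_single E_single \<beta>_def plus_word_def xs_def ys_def xs'_def ys'_def)
    have G_gen: "G (free_gen i j) = c * d * b (xs @ i # xs') (ys @ j # ys')"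
      "G (free_star (free_gen i j)) = c * d * b (xs @ i # xs') (ys @ j # ys')" for i j
      by (simp_all add: G_def free_gen_def free_star_single word_star_def mult_single E_single \<beta>_def
          plus_word_def xs_def ys_def xs'_def ys'_def rl_def cl_def)
    have G_gen2: "G (free_gen i j * free_gen i' j') = c * d * b (xs @ i # i' # xs') (ys @ j # j' # ys')"
      "G (free_star (free_gen i j) * free_star (free_gen i' j')) = c * d * b (xs @ i # i' # xs') (ys @ j # j' # ys')"
      for i j i' j'
      by (simp_all add: G_def free_gen_def free_star_single word_star_def mult_single E_single \<beta>_def
          plus_word_def xs_def ys_def xs'_def ys'_def rl_def cl_def)
    have sums: "(\<Sum>i\<in>UNIV. c * d * b (xs @ i # xs') (ys @ j # ys')) = c * d * b (xs @ xs') (ys @ ys')"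
      "(\<Sum>j\<in>UNIV. c * d * b (xs @ i # xs') (ys @ j # ys')) = c * d * b (xs @ xs') (ys @ ys')" for i j
      by (simp_all only: sum_distrib_left[symmetric] sum_row[OF len] sum_col[OF len])
    have "G r = 0"
      using that unfolding magic_unitary_relations_def
      by (auto simp: G_diff G_zero G_sum G1 G_gen G_gen2 merge_row[OF len] merge_col[OF len] sums
          free_star_diff free_star_mult free_star_free_star star_sum star_zero star_one)
    then show ?thesis by (simp add: G_def)
  qed
  have van2: "E (x * r * Poly_Mapping.single l d) = 0"
    if "r \<in> magic_unitary_relations \<union> free_star ` magic_unitary_relations" for r x l d
    by (induction x rule: monom_induct) (use van1[OF that] in \<open>simp_all add: distrib_right E_add\<close>)
  have van3: "E (x * r * y) = 0"
    if "r \<in> magic_unitary_relations \<union> free_star ` magic_unitary_relations" for r x y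
    by (induction y rule: monom_induct) (use van2[OF that] in \<open>simp_all add: distrib_left E_add\<close>)
  have van: "E x = 0" if "x \<in> magic_unitary_ideal" for x
    using that by induction (use van3 in \<open>simp_all add: E_add E_zero\<close>)
  define g where "g x = E (rep_qperm x)" for x
  have g_abs: "g (abs_qperm f) = E f" for f
  proof -
    have "rep_qperm (abs_qperm f) - f \<in> magic_unitary_ideal"
      using Quotient_rep_abs[OF Quotient_qperm] by (simp add: two_sided_ideal.zero)
    from van[OF this] show ?thesis by (simp add: g_def E_diff)
  qed
  have rep: "\<exists>f. x = abs_qperm f" for x :: "'n qperm"
    by (rule exI[of _ "rep_qperm x"]) (simp add: Quotient_abs_rep[OF Quotient_qperm])
  have "clinear g"
    unfolding clinear_iff
  proof (intro conjI allI)
    fix x y c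
    show "g (x + y) = g x + g y"
      using rep[of x] rep[of y] by (auto simp: plus_qperm.abs_eq g_abs E_add)
    show "g (c *\<^sub>C x) = c *\<^sub>C g x"
      using rep[of x] by (auto simp: scaleC_qperm.abs_eq g_abs E_def lin_ext_scale)
  qed
  moreover have "g (pm xs ys) = b xs ys" if "length xs = length ys" for xs ys
  proof -
    have "pm xs ys = abs_qperm (Poly_Mapping.single (Word (map2 Gen xs ys)) 1)"
      using that
    proof (induction xs ys rule: list_induct2)
      case Nil
      then show ?case by (simp add: one_qperm_def zero_word_def[symmetric])
    next
      case (Cons x xs y ys)
      then show ?case
        by (simp add: qperm_gen.abs_eq free_gen_def times_qperm.abs_eq mult_single plus_word_def)
    qed
    moreover have "map rl (map2 Gen xs ys) = xs" "map cl (map2 Gen xs ys) = ys"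
      using that by (induction xs ys rule: list_induct2) (simp_all add: rl_def cl_def)
    ultimately show ?thesis by (simp add: g_abs E_single \<beta>_def del: map_map)
  qed
  ultimately show ?thesis by blast
qed

text \<open>Integrating a representation against the Haar state gives the projection onto its fixed
  vectors. The fixed vectors of the tensor powers are expected to be the noncrossing ones, so the
  projection onto \<open>nc\<close> is taken as the value of the functional, and invariance is
  proved afterwards.\<close>

definition nc_kernel :: "'n::finite list \<Rightarrow> 'n list \<Rightarrow> complex" where
  "nc_kernel xs ys =
     (if length xs = length ys then repro_kernel (idx (length ys)) {f. nc (length ys) f} xs ys else 0)"

lemma cnj_nc_kernel: "cnj (nc_kernel xs ys) = nc_kernel ys xs"
  by (simp add: nc_kernel_def cnj_repro_kernel)

lemma nc_nc_kernel: "nc (length ys) (\<lambda>xs. nc_kernel xs ys)"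
proof -
  have "nc (length ys) (\<lambda>xs. repro_kernel (idx (length ys)) {f. nc (length ys) f} xs ys)"
    using repro_kernel_mem[OF finite_idx fun_subspace_nc, of "length ys" ys] by simp
  from nc_restrict[OF this, of "\<lambda>n. n = length ys"] show ?thesis
    unfolding nc_kernel_def .
qed

lemma cinner_nc_kernel: "nc (length ys) f \<Longrightarrow> cinner (idx (length ys)) (\<lambda>xs. nc_kernel xs ys) f = f ys"
  using cinner_repro_kernel[OF finite_idx fun_subspace_nc, of f "length ys" ys]
  by (simp add: nc_kernel_def cinner_def idx_def)

lemma nc_kernel_unique:
  assumes "nc (length ys) p" "\<And>f. nc (length ys) f \<Longrightarrow> cinner (idx (length ys)) p f = cnj c * f ys"
    and "length xs = length ys"
  shows "p xs = c * nc_kernel xs ys"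
  using repro_kernel_unique[OF finite_idx fun_subspace_nc, of p "length ys" c ys xs] assms
  by (simp add: nc_kernel_def)

text \<open>Pairing the merged kernel with \<open>f\<close> evaluates \<open>merge_adj a f\<close>
  at \<open>ys\<close>, which is \<open>f (del a ys)\<close> or 0. The merged kernel is noncrossing
  by \<open>nc_lower\<close>, so it is determined by this functional.\<close>

lemma nc_kernel_merge:
  assumes "length ys = Suc (length xs)" "a < length xs"
  shows "nc_kernel (ins a (xs ! a) xs) ys = (if ys ! a = ys ! Suc a then nc_kernel xs (del a ys) else 0)"
proof -
  have len: "length (del a ys) = length xs" using assms by simp
  have "merge a (\<lambda>xs. nc_kernel xs ys) xs = (if ys ! a = ys ! Suc a then 1 else 0) * nc_kernel xs (del a ys)"
  proof (rule nc_kernel_unique)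
    show "nc (length (del a ys)) (merge a (\<lambda>xs. nc_kernel xs ys))"
      using nc_lower[OF nc_nc_kernel[of ys], of a] len assms by simp
    fix f :: "'a list \<Rightarrow> complex" assume "nc (length (del a ys)) f"
    then have "nc (length ys) (merge_adj a f)" using nc.merge_adj[of "length xs" f a] len assms by simp
    from cinner_nc_kernel[OF this]
    have "cinner (idx (length (del a ys))) (merge a (\<lambda>xs. nc_kernel xs ys)) f = merge_adj a f ys"
      using assms len by (simp add: cinner_merge_adj)
    also have "\<dots> = cnj (if ys ! a = ys ! Suc a then 1 else 0) * f (del a ys)"
      using assms by (simp add: merge_adj_def)
    finally show "cinner (idx (length (del a ys))) (merge a (\<lambda>xs. nc_kernel xs ys)) f =
        cnj (if ys ! a = ys ! Suc a then 1 else 0) * f (del a ys)" .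
  qed (use len in simp)
  then show ?thesis using assms by (simp add: merge_def split: if_splits)
qed

lemma nc_kernel_contract:
  assumes "length ys = Suc (length xs)" "a \<le> length xs"
  shows "(\<Sum>i\<in>UNIV. nc_kernel (ins a i xs) ys) = nc_kernel xs (del a ys)"
proof -
  have len: "length (del a ys) = length xs" using assms by simp
  have "contract a (\<lambda>xs. nc_kernel xs ys) xs = 1 * nc_kernel xs (del a ys)"
  proof (rule nc_kernel_unique)
    show "nc (length (del a ys)) (contract a (\<lambda>xs. nc_kernel xs ys))"
      using nc_lower[OF nc_nc_kernel[of ys], of a] len assms by simp
    fix f :: "'a list \<Rightarrow> complex" assume "nc (length (del a ys)) f"
    then have "nc (length ys) (contract_adj a f)" using nc.contract_adj[of "length xs" f a] len assms by simp
    from cinner_nc_kernel[OF this]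
    have "cinner (idx (length (del a ys))) (contract a (\<lambda>xs. nc_kernel xs ys)) f = contract_adj a f ys"
      using assms len by (simp add: cinner_contract_adj)
    also have "\<dots> = cnj 1 * f (del a ys)"
      using assms by (simp add: contract_adj_def)
    finally show "cinner (idx (length (del a ys))) (contract a (\<lambda>xs. nc_kernel xs ys)) f = cnj 1 * f (del a ys)" .
  qed (use len in simp)
  then show ?thesis using assms by (simp add: contract_def)
qed

lemma ex_haar_functional:
  "\<exists>f. clinear f \<and> (\<forall>xs ys :: 'n::finite list. f (pm xs ys) = nc_kernel xs ys)"
proof -
  have merge: "nc_kernel (xs @ i # i # xs') (ys @ j # l # ys') =
      (if j = l then nc_kernel (xs @ i # xs') (ys @ j # ys') else 0)"
    and contract: "(\<Sum>i\<in>UNIV. nc_kernel (xs @ i # xs') (ys @ j # ys')) = nc_kernel (xs @ xs') (ys @ ys')"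
    if "length xs = length ys" "length xs' = length ys'" for xs ys xs' ys' :: "'n list" and i j l
    using that nc_kernel_merge[of "ys @ j # l # ys'" "xs @ i # xs'" "length xs"]
      nc_kernel_contract[of "ys @ j # ys'" "xs @ xs'" "length xs"]
    by (simp_all add: ins_def del_def nth_append)
  have "\<exists>f. clinear f \<and> (\<forall>xs ys :: 'n list. length xs = length ys \<longrightarrow> f (pm xs ys) = nc_kernel xs ys)"
  proof (rule qperm_functional)
    fix xs ys xs' ys' :: "'n list" and i j l
    assume len: "length xs = length ys" "length xs' = length ys'"
    \<comment> \<open>The kernel is Hermitian, so the conditions on columns are the conjugates of
      those on rows.\<close>
    have "cnj (nc_kernel (ys @ j # j # ys') (xs @ i # l # xs')) =
        cnj (if i = l then nc_kernel (ys @ j # ys') (xs @ i # xs') else 0)"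
      using merge[of ys xs ys' xs'] len by simp
    then show "nc_kernel (xs @ i # l # xs') (ys @ j # j # ys') =
        (if i = l then nc_kernel (xs @ i # xs') (ys @ j # ys') else 0)"
      by (simp add: cnj_nc_kernel split: if_splits)
    have "cnj (\<Sum>j\<in>UNIV. nc_kernel (ys @ j # ys') (xs @ i # xs')) = cnj (nc_kernel (ys @ ys') (xs @ xs'))"
      using contract[of ys xs ys' xs'] len by simp
    then show "(\<Sum>j\<in>UNIV. nc_kernel (xs @ i # xs') (ys @ j # ys')) = nc_kernel (xs @ xs') (ys @ ys')"
      by (simp add: cnj_nc_kernel)
  qed (use merge contract in auto)
  then obtain f where f: "clinear f" "\<And>xs ys :: 'n list. length xs = length ys \<Longrightarrow> f (pm xs ys) = nc_kernel xs ys"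
    by blast
  have "f (pm xs ys) = nc_kernel xs ys" for xs ys
    using f by (cases "length xs = length ys") (simp_all add: pm_length nc_kernel_def clinear_simps)
  with f show ?thesis by blast
qed

definition haar :: "'n::finite qperm \<Rightarrow> complex" where
  "haar = (SOME f. clinear f \<and> (\<forall>xs ys. f (pm xs ys) = nc_kernel xs ys))"

lemma clinear_haar: "clinear (haar :: 'n::finite qperm \<Rightarrow> complex)"
  and haar_pm: "haar (pm xs ys) = nc_kernel xs (ys :: 'n list)"
proof -
  have "clinear (haar :: 'n qperm \<Rightarrow> complex) \<and> (\<forall>xs ys :: 'n list. haar (pm xs ys) = nc_kernel xs ys)"
    unfolding haar_def by (rule someI_ex[OF ex_haar_functional])
  then show "clinear (haar :: 'n qperm \<Rightarrow> complex)" "haar (pm xs ys) = nc_kernel xs ys" by blast+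
qed

lemma haar_one: "haar 1 = 1"
proof -
  have "nc 0 (\<lambda>xs :: 'a list. if xs = [] then 1 else 0)" by (rule nc.unit)
  then have "cnj (nc_kernel [] ([] :: 'a list)) = 1"
    using cinner_nc_kernel[of "[] :: 'a list" "\<lambda>xs. if xs = [] then 1 else 0"]
    by (simp add: cinner_def idx_0)
  then show ?thesis using haar_pm[of "[] :: 'a list" "[]"] by (simp add: cnj_nc_kernel)
qed

definition eps :: "'n::finite qperm \<Rightarrow> complex" where
  "eps = (THE f. unital_algebra_hom f \<and> (\<forall>i j. f (qperm_gen i j) = (if i = j then 1 else 0)))"

lemma unital_algebra_hom_eps: "unital_algebra_hom (eps :: 'n::finite qperm \<Rightarrow> complex)"
  and eps_gen: "eps (qperm_gen i j) = (if i = (j :: 'n) then 1 else 0)"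
proof -
  have "\<exists>!f :: 'n qperm \<Rightarrow> complex. unital_algebra_hom f \<and> (\<forall>i j. f (qperm_gen i j) = (if i = j then 1 else 0))"
    by (rule qperm_universal) auto
  from theI'[OF this] show "unital_algebra_hom (eps :: 'n qperm \<Rightarrow> complex)"
    "eps (qperm_gen i j) = (if i = j then 1 else 0)"
    by (simp_all add: eps_def)
qed

lemma clinear_eps: "clinear eps"
  and eps_one: "eps 1 = 1"
  and eps_mult: "eps (x * y) = eps x * eps y"
  using unital_algebra_hom_eps[unfolded unital_algebra_hom_def] by blast+

lemma eps_pm: "eps (pm xs ys) = (if xs = ys then 1 else 0)"
  by (induction xs ys rule: pm.induct)
     (simp_all add: eps_one eps_mult eps_gen clinear_simps[OF clinear_eps])

lemma clinear_comult: "clinear qperm_comult"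
  and comult_one: "qperm_comult 1 = 1"
  and comult_mult: "qperm_comult (x * y) = qperm_comult x * qperm_comult y"
  using qperm_comult(1)[unfolded unital_algebra_hom_def] by blast+

lemma comult_pm:
  "length xs = length ys \<Longrightarrow>
   qperm_comult (pm xs ys) = (\<Sum>ms\<in>idx (length xs). pm xs ms \<otimes>\<^sub>C pm ms (ys :: 'n::finite list))"
proof (induction xs ys rule: list_induct2)
  case Nil
  then show ?case by (simp add: comult_one idx_0 tensor_one)
next
  case (Cons x xs y ys)
  have "qperm_comult (pm (x # xs) (y # ys)) = (\<Sum>k\<in>UNIV. qperm_gen x k \<otimes>\<^sub>C qperm_gen k y) *
      (\<Sum>ms\<in>idx (length xs). pm xs ms \<otimes>\<^sub>C pm ms ys)"
    using Cons by (simp add: comult_mult qperm_comult(2))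
  also have "\<dots> = (\<Sum>ms\<in>idx (length xs). \<Sum>k\<in>UNIV. pm (x # xs) (k # ms) \<otimes>\<^sub>C pm (k # ms) (y # ys))"
    by (simp add: sum_product tensor_mult sum.swap[of _ UNIV])
  finally show ?case by (simp add: sum_idx_ins[of 0] ins_def)
qed

section \<open>Slices of the coproduct: counit, uniqueness and invariance\<close>

lemma clinear_comp: "clinear f \<Longrightarrow> clinear g \<Longrightarrow> clinear (\<lambda>x. g (f x))"
  by (simp add: clinear_iff)

lemma tensor_lift_left:
  fixes f :: "'a::complex_algebra_1 \<Rightarrow> complex"
  assumes "clinear f"
  shows "clinear (tensor_lift (\<lambda>x (y :: 'b::complex_algebra_1). f x *\<^sub>C y))"
    and "tensor_lift (\<lambda>x (y :: 'b). f x *\<^sub>C y) (a \<otimes>\<^sub>C b) = f a *\<^sub>C b"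
proof -
  have "clinear (\<lambda>x. f x *\<^sub>C y)" "clinear (\<lambda>y. f x *\<^sub>C y)" for x and y :: 'b
    unfolding clinear_iff
    by (simp_all add: clinear_simps[OF assms] scaleC_add_left scaleC_add_right scaleC_scaleC
        scaleC_complex mult.commute)
  from tensor_lift[of "\<lambda>x y. f x *\<^sub>C y", OF this]
  show "clinear (tensor_lift (\<lambda>x (y :: 'b). f x *\<^sub>C y))"
    "tensor_lift (\<lambda>x (y :: 'b). f x *\<^sub>C y) (a \<otimes>\<^sub>C b) = f a *\<^sub>C b" by auto
qed

lemma tensor_lift_right:
  fixes f :: "'b::complex_algebra_1 \<Rightarrow> complex"
  assumes "clinear f"
  shows "clinear (tensor_lift (\<lambda>(x :: 'a::complex_algebra_1) y. f y *\<^sub>C x))"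
    and "tensor_lift (\<lambda>(x :: 'a) y. f y *\<^sub>C x) (a \<otimes>\<^sub>C b) = f b *\<^sub>C a"
proof -
  have "clinear (\<lambda>x. f y *\<^sub>C x)" "clinear (\<lambda>y. f y *\<^sub>C x)" for y and x :: 'a
    unfolding clinear_iff
    by (simp_all add: clinear_simps[OF assms] scaleC_add_left scaleC_add_right scaleC_scaleC
        scaleC_complex mult.commute)
  from tensor_lift[of "\<lambda>x y. f y *\<^sub>C x", OF this]
  show "clinear (tensor_lift (\<lambda>(x :: 'a) y. f y *\<^sub>C x))"
    "tensor_lift (\<lambda>(x :: 'a) y. f y *\<^sub>C x) (a \<otimes>\<^sub>C b) = f b *\<^sub>C a" by auto
qed

text \<open>Both sides apply f to the left and g to the right tensor factor. Evaluating a coproduct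
  in these two ways gives the uniqueness of the counit and of the Haar state.\<close>

lemma slice_swap:
  fixes f :: "'a::complex_algebra_1 \<Rightarrow> complex" and g :: "'b::complex_algebra_1 \<Rightarrow> complex"
  assumes "clinear f" "clinear g"
  shows "g (tensor_lift (\<lambda>x y. f x *\<^sub>C y) t) = f (tensor_lift (\<lambda>x y. g y *\<^sub>C x) t)"
proof (induction t rule: tensor_induct)
  case (pure a b)
  then show ?case
    by (simp add: tensor_lift_left(2)[OF assms(1)] tensor_lift_right(2)[OF assms(2)]
        clinear_simps[OF assms(1)] clinear_simps[OF assms(2)] scaleC_complex mult.commute)
next
  case (add s t)
  then show ?case
    by (simp add: clinear_simps(1)[OF tensor_lift_left(1)[OF assms(1)]]
        clinear_simps(1)[OF tensor_lift_right(1)[OF assms(2)]]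
        clinear_simps(1)[OF assms(1)] clinear_simps(1)[OF assms(2)])
qed

lemma counit_unique:
  assumes "is_counit \<Delta> e" "is_counit \<Delta> e'"
  shows "e = e'"
proof
  fix a
  have "e (tensor_lift (\<lambda>x y. e' x *\<^sub>C y) (\<Delta> a)) = e' (tensor_lift (\<lambda>x y. e y *\<^sub>C x) (\<Delta> a))"
    using assms by (intro slice_swap) (simp_all add: is_counit_def)
  moreover have "tensor_lift (\<lambda>x y. e' x *\<^sub>C y) (\<Delta> a) = a" "tensor_lift (\<lambda>x y. e y *\<^sub>C x) (\<Delta> a) = a"
    using assms unfolding is_counit_def by blast+
  ultimately show "e a = e' a" by simp
qed

lemma haar_state_unique:
  assumes "is_haar_state \<Delta> h" "is_haar_state \<Delta> h'"
  shows "h = h'"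
proof
  fix a
  have "h' (tensor_lift (\<lambda>x y. h x *\<^sub>C y) (\<Delta> a)) = h (tensor_lift (\<lambda>x y. h' y *\<^sub>C x) (\<Delta> a))"
    using assms by (intro slice_swap) (simp_all add: is_haar_state_def)
  moreover have "tensor_lift (\<lambda>x y. h x *\<^sub>C y) (\<Delta> a) = h a *\<^sub>C 1"
    "tensor_lift (\<lambda>x y. h' y *\<^sub>C x) (\<Delta> a) = h' a *\<^sub>C 1"
    and lin: "clinear h" "clinear h'" and one: "h 1 = 1" "h' 1 = 1"
    using assms unfolding is_haar_state_def by blast+
  ultimately show "h a = h' a"
    by (simp add: clinear_simps(2)[OF lin(1)] clinear_simps(2)[OF lin(2)] one scaleC_complex)
qed

lemma counit_qperm: "counit qperm_comult = (eps :: 'n::finite qperm \<Rightarrow> complex)"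
proof -
  have left: "tensor_lift (\<lambda>x y. eps x *\<^sub>C y) (qperm_comult a) = a" for a :: "'n qperm"
  proof (rule clinear_eqI_pm[where x = a])
    show "clinear (\<lambda>a. tensor_lift (\<lambda>x y. eps x *\<^sub>C y) (qperm_comult a) :: 'n qperm)"
      by (rule clinear_comp[OF clinear_comult tensor_lift_left(1)[OF clinear_eps]])
    fix xs ys :: "'n list" assume "length xs = length ys"
    then show "tensor_lift (\<lambda>x y. eps x *\<^sub>C y) (qperm_comult (pm xs ys)) = pm xs ys"
      by (simp add: comult_pm clinear_sum[OF tensor_lift_left(1)] clinear_eps tensor_lift_left eps_pm
          if_distrib[of "\<lambda>c. c *\<^sub>C _"] scaleC_one idx_def cong: if_cong)
         (simp add: idx_def[symmetric], simp add: idx_def)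
  qed (simp add: clinear_iff)
  have right: "tensor_lift (\<lambda>x y. eps y *\<^sub>C x) (qperm_comult a) = a" for a :: "'n qperm"
  proof (rule clinear_eqI_pm[where x = a])
    show "clinear (\<lambda>a. tensor_lift (\<lambda>x y. eps y *\<^sub>C x) (qperm_comult a) :: 'n qperm)"
      by (rule clinear_comp[OF clinear_comult tensor_lift_right(1)[OF clinear_eps]])
    fix xs ys :: "'n list" assume "length xs = length ys"
    then show "tensor_lift (\<lambda>x y. eps y *\<^sub>C x) (qperm_comult (pm xs ys)) = pm xs ys"
      by (simp add: comult_pm clinear_sum[OF tensor_lift_right(1)] clinear_eps tensor_lift_right eps_pm
          if_distrib[of "\<lambda>c. c *\<^sub>C _"] scaleC_one idx_def cong: if_cong)
         (simp add: idx_def[symmetric], simp add: idx_def)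
  qed (simp add: clinear_iff)
  have "is_counit qperm_comult (eps :: 'n qperm \<Rightarrow> complex)"
    using left right clinear_eps by (simp add: is_counit_def)
  then show ?thesis unfolding counit_def using counit_unique by blast
qed

lemma nc_cnj: "nc k f \<Longrightarrow> nc k (\<lambda>xs. cnj (f (xs :: 'n::finite list)))"
proof (induction rule: nc.induct)
  case (merge_adj k f a)
  show ?case unfolding cnj_leg_ops by (rule nc.merge_adj) fact
next
  case (contract_adj k f a)
  show ?case unfolding cnj_leg_ops by (rule nc.contract_adj) fact
qed (simp_all add: nc.unit nc.zero nc.add nc.scale if_distrib[of cnj] cong: if_cong)

text \<open>The unit is fixed and the raising operations are intertwiners. Fixed vectors are what
  makes the projection onto \<open>nc\<close> an invariant functional.\<close>

lemma nc_fixed: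
  assumes "nc k (f :: 'n::finite list \<Rightarrow> complex)" "ys \<in> idx k"
  shows "pcol k f ys = f ys *\<^sub>C 1" "prow k f ys = f ys *\<^sub>C 1"
proof -
  show "pcol k f ys = f ys *\<^sub>C 1"
    using assms
  proof (induction arbitrary: ys rule: nc.induct)
    case unit
    then show ?case by (simp add: pcol_def idx_0)
  next
    case (merge_adj k f a)
    then have "Suc a < length ys \<Longrightarrow> del a ys \<in> idx k" by (simp add: idx_def)
    then show ?case using merge_adj by (subst pcol_merge_adj) (auto simp: merge_adj_def idx_def)
  next
    case (contract_adj k f a)
    then have "a < length ys \<Longrightarrow> del a ys \<in> idx k" by (simp add: idx_def)
    then show ?case using contract_adj by (subst pcol_contract_adj) (auto simp: contract_adj_def idx_def)
  next
    case (scale k f c)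
    have "pcol k (\<lambda>xs. c * f xs) ys = c *\<^sub>C pcol k f ys"
      by (simp add: pcol_def cvec.scale_sum_right scaleC_scaleC)
    then show ?case using scale by (simp add: scaleC_scaleC)
  qed (simp_all add: pcol_def scaleC_add_left sum.distrib)
  show "prow k f ys = f ys *\<^sub>C 1"
    using assms
  proof (induction arbitrary: ys rule: nc.induct)
    case unit
    then show ?case by (simp add: prow_def idx_0)
  next
    case (merge_adj k f a)
    then have "Suc a < length ys \<Longrightarrow> del a ys \<in> idx k" by (simp add: idx_def)
    then show ?case using merge_adj by (subst prow_merge_adj) (auto simp: merge_adj_def idx_def)
  next
    case (contract_adj k f a)
    then have "a < length ys \<Longrightarrow> del a ys \<in> idx k" by (simp add: idx_def)
    then show ?case using contract_adj by (subst prow_contract_adj) (auto simp: contract_adj_def idx_def)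
  next
    case (scale k f c)
    have "prow k (\<lambda>xs. c * f xs) ys = c *\<^sub>C prow k f ys"
      by (simp add: prow_def cvec.scale_sum_right scaleC_scaleC)
    then show ?case using scale by (simp add: scaleC_scaleC)
  qed (simp_all add: prow_def scaleC_add_left sum.distrib)
qed

lemma haar_invariant:
  fixes a :: "'n::finite qperm"
  shows "tensor_lift (\<lambda>x y. haar x *\<^sub>C y) (qperm_comult a) = haar a *\<^sub>C 1"
    and "tensor_lift (\<lambda>x y. haar y *\<^sub>C x) (qperm_comult a) = haar a *\<^sub>C 1"
proof -
  have lin: "clinear (\<lambda>a :: 'n qperm. haar a *\<^sub>C (1 :: 'n qperm))"
    by (simp add: clinear_iff clinear_simps[OF clinear_haar] scaleC_add_left scaleC_scaleC scaleC_complex)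
  show "tensor_lift (\<lambda>x y. haar x *\<^sub>C y) (qperm_comult a) = haar a *\<^sub>C 1"
  proof (rule clinear_eqI_pm[where x = a, OF _ lin])
    show "clinear (\<lambda>a. tensor_lift (\<lambda>x y. haar x *\<^sub>C y) (qperm_comult a) :: 'n qperm)"
      by (rule clinear_comp[OF clinear_comult tensor_lift_left(1)[OF clinear_haar]])
    fix xs ys :: "'n list" assume len: "length xs = length ys"
    \<comment> \<open>This slice runs over the second index of the kernel, where the kernel is the
      conjugate of a noncrossing vector and hence noncrossing.\<close>
    have "nc (length ys) (\<lambda>ms. nc_kernel xs ms)"
      using nc_cnj[OF nc_nc_kernel[of xs]] len by (simp add: cnj_nc_kernel)
    from nc_fixed(2)[OF this, of ys]
    show "tensor_lift (\<lambda>x y. haar x *\<^sub>C y) (qperm_comult (pm xs ys)) = haar (pm xs ys) *\<^sub>C 1"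
      using len by (simp add: comult_pm clinear_sum[OF tensor_lift_left(1)] clinear_haar tensor_lift_left
          haar_pm prow_def) (simp add: idx_def)
  qed
  show "tensor_lift (\<lambda>x y. haar y *\<^sub>C x) (qperm_comult a) = haar a *\<^sub>C 1"
  proof (rule clinear_eqI_pm[where x = a, OF _ lin])
    show "clinear (\<lambda>a. tensor_lift (\<lambda>x y. haar y *\<^sub>C x) (qperm_comult a) :: 'n qperm)"
      by (rule clinear_comp[OF clinear_comult tensor_lift_right(1)[OF clinear_haar]])
    fix xs ys :: "'n list" assume len: "length xs = length ys"
    from nc_fixed(1)[OF nc_nc_kernel[of ys], of xs]
    show "tensor_lift (\<lambda>x y. haar y *\<^sub>C x) (qperm_comult (pm xs ys)) = haar (pm xs ys) *\<^sub>C 1"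
      using len by (simp add: comult_pm clinear_sum[OF tensor_lift_right(1)] clinear_haar tensor_lift_right
          haar_pm pcol_def) (simp add: idx_def)
  qed
qed

section \<open>Schur orthogonality and positivity of the Haar state\<close>

lemma cf_double: "cf k f g = (\<Sum>xs\<in>idx k. \<Sum>ys\<in>idx k. (cnj (f xs) * g ys) *\<^sub>C pm xs ys)"
  by (simp add: cf_pcol pcol_def cvec.scale_sum_right scaleC_scaleC)

lemma star_sum: "star (sum f A) = (\<Sum>a\<in>A. star (f a :: 'a::star_algebra))"
  by (induction A rule: infinite_finite_induct) (simp_all add: star_zero star_add)

lemma sum_scaleC_product:
  fixes F :: "'c \<Rightarrow> 'a::complex_algebra_1"
  shows "(\<Sum>x\<in>A. a x *\<^sub>C F x) * (\<Sum>y\<in>B. b y *\<^sub>C G y) = (\<Sum>x\<in>A. \<Sum>y\<in>B. (a x * b y) *\<^sub>C (F x * G y))"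
  by (simp add: sum_product scaleC_mult_left scaleC_mult_right scaleC_scaleC mult.commute)

text \<open>The adjoint reverses words, whence the reversed legs in \<open>rtens\<close>. A product
  of two coefficients becomes a single coefficient, on which the Haar state can be evaluated by
  projecting onto \<open>nc\<close>.\<close>

lemma star_cf_mult:
  "star (cf k f g) * cf l f' g' = cf (k + l) (rtens k f f') (rtens k g g')"
  for f :: "'n::finite list \<Rightarrow> complex"
proof -
  have "cf (k + l) (rtens k f f') (rtens k g g') =
      (\<Sum>X\<in>idx (k + l). \<Sum>Y\<in>idx (k + l). (f (rev (take k X)) * cnj (f' (drop k X)) *
         (cnj (g (rev (take k Y))) * g' (drop k Y))) *\<^sub>C
         (star (pm (rev (take k X)) (rev (take k Y))) * pm (drop k X) (drop k Y)))"
    unfolding cf_double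
  proof (intro sum.cong refl)
    fix X Y :: "'n list" assume "X \<in> idx (k + l)" "Y \<in> idx (k + l)"
    then have "pm X Y = pm (take k X) (take k Y) * pm (drop k X) (drop k Y)"
      using pm_append[of "take k X" "take k Y" "drop k X" "drop k Y"] by (simp add: idx_def)
    then show "(cnj (rtens k f f' X) * rtens k g g' Y) *\<^sub>C pm X Y =
        (f (rev (take k X)) * cnj (f' (drop k X)) * (cnj (g (rev (take k Y))) * g' (drop k Y))) *\<^sub>C
         (star (pm (rev (take k X)) (rev (take k Y))) * pm (drop k X) (drop k Y))"
      by (simp add: rtens_def star_pm)
  qed
  also have "\<dots> = (\<Sum>X\<in>idx (k + l). \<Sum>j\<in>idx k. \<Sum>n\<in>idx l. (f (rev (take k X)) * cnj (f' (drop k X)) *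
         (cnj (g j) * g' n)) *\<^sub>C (star (pm (rev (take k X)) j) * pm (drop k X) n))"
    by (intro sum.cong refl sum_idx_add)
  also have "\<dots> = (\<Sum>i\<in>idx k. \<Sum>m\<in>idx l. \<Sum>j\<in>idx k. \<Sum>n\<in>idx l. (f i * cnj (f' m) *
         (cnj (g j) * g' n)) *\<^sub>C (star (pm i j) * pm m n))"
    by (rule sum_idx_add)
  also have "\<dots> = (\<Sum>i\<in>idx k. \<Sum>j\<in>idx k. \<Sum>m\<in>idx l. \<Sum>n\<in>idx l. (f i * cnj (g j) *
         (cnj (f' m) * g' n)) *\<^sub>C (star (pm i j) * pm m n))"
    by (subst sum.swap[of _ "idx l" "idx k"]) (simp add: mult_ac)
  also have "\<dots> = star (cf k f g) * cf l f' g'"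
    unfolding cf_double star_sum star_scaleC sum_distrib_right
    unfolding sum_distrib_left scaleC_mult_left scaleC_mult_right scaleC_scaleC
    by (simp add: mult_ac)
  finally show ?thesis by simp
qed

text \<open>The kernel is characterised by its reproducing property, so an arbitrary orthonormal
  basis of \<open>nc\<close> may replace the one chosen in its definition.\<close>

lemma haar_cf:
  assumes "onb (idx k) {f. nc k f} B"
  shows "haar (cf k f g) = (\<Sum>b\<in>B. cinner (idx k) f b * cinner (idx k) b (g :: 'n::finite list \<Rightarrow> complex))"
proof -
  have "nc_kernel xs ys = (\<Sum>b\<in>B. b xs * cnj (b ys))" if "xs \<in> idx k" "ys \<in> idx k" for xs ys :: "'n list"
  proof -
    have B: "B \<subseteq> {f. nc k f}" "\<And>f. nc k f \<Longrightarrow> f = (\<lambda>x. \<Sum>b\<in>B. cinner (idx k) b f * b x)"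
      using assms by (auto simp: onb_def)
    have "(\<lambda>x. \<Sum>b\<in>B. cnj (b ys) * b x) xs = 1 * nc_kernel xs ys"
    proof (rule nc_kernel_unique)
      show "nc (length ys) (\<lambda>x. \<Sum>b\<in>B. cnj (b ys) * b x)"
        using that fun_subspace_sum[OF fun_subspace_nc, of B "\<lambda>b. b" k "\<lambda>b. cnj (b ys)"] B(1)
        by (auto simp: idx_def)
      fix f :: "'n list \<Rightarrow> complex" assume "nc (length ys) f"
      then have "f ys = (\<Sum>b\<in>B. cinner (idx k) b f * b ys)"
        using fun_cong[OF B(2)[of f], of ys] that by (simp add: idx_def)
      then show "cinner (idx (length ys)) (\<lambda>x. \<Sum>b\<in>B. cnj (b ys) * b x) f = cnj 1 * f ys"
        using that unfolding cinner_sum_left by (simp add: idx_def mult.commute)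
    qed (use that in \<open>simp add: idx_def\<close>)
    then show ?thesis by (simp add: mult.commute)
  qed
  then have "haar (cf k f g) = (\<Sum>xs\<in>idx k. \<Sum>ys\<in>idx k. \<Sum>b\<in>B. (cnj (f xs) * b xs) * (cnj (b ys) * g ys))"
    by (simp add: cf_double clinear_sum[OF clinear_haar] clinear_simps[OF clinear_haar] haar_pm
        scaleC_complex sum_distrib_left mult_ac)
  also have "\<dots> = (\<Sum>b\<in>B. \<Sum>xs\<in>idx k. \<Sum>ys\<in>idx k. (cnj (f xs) * b xs) * (cnj (b ys) * g ys))"
    by (subst sum.swap[of _ B], subst sum.swap[of _ B]) (rule refl)
  finally show ?thesis by (simp add: cinner_def sum_product)
qed

text \<open>For \<open>k > 0\<close> every noncrossing vector is raised, hence orthogonal to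
  \<open>f\<close>.\<close>

lemma haar_cf_raised_left:
  "f \<in> highest k \<Longrightarrow> k > 0 \<Longrightarrow> haar (cf k f g) = 0"
proof -
  assume f: "f \<in> highest k" "k > 0"
  obtain B where B: "onb (idx k) {f :: 'a list \<Rightarrow> complex. nc k f} B"
    using ex_onb[OF finite_idx fun_subspace_nc] by blast
  then have "cinner (idx k) f b = 0" if "b \<in> B" for b
    using that f nc_raised[of k b] raised_orthogonal_highest(1) by (auto simp: onb_def)
  then show ?thesis by (simp add: haar_cf[OF B])
qed

text \<open>Schur's lemma gives every vector \<open>b\<close> of an orthonormal basis of
  \<open>nc\<close> a scalar \<open>c b\<close>, and \<open>s\<close> is the sum of their squared
  moduli. If \<open>s\<close> were 0, the noncrossing vector \<open>id_vec k\<close> would be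
  orthogonal to \<open>rtens k f f\<close>, whereas their pairing is the squared norm of
  \<open>f\<close>.\<close>

lemma haar_orthogonality:
  obtains s :: real where "s \<ge> 0"
    "\<And>f g f' g' :: 'n::finite list \<Rightarrow> complex. f \<in> highest k \<Longrightarrow> g \<in> highest k \<Longrightarrow> f' \<in> highest l \<Longrightarrow> g' \<in> highest l \<Longrightarrow>
      haar (star (cf k f g) * cf l f' g') = complex_of_real s * cinner (idx k) f' f * cinner (idx k) g g'"
    "\<And>f :: 'n list \<Rightarrow> complex. k = l \<Longrightarrow> f \<in> highest k \<Longrightarrow> cinner (idx k) f f \<noteq> 0 \<Longrightarrow> s \<noteq> 0"
proof -
  obtain B where B: "onb (idx (k + l)) {f :: 'n list \<Rightarrow> complex. nc (k + l) f} B"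
    using ex_onb[OF finite_idx fun_subspace_nc] by blast
  have "\<forall>b\<in>B. \<exists>c. \<forall>f\<in>highest k. \<forall>f'\<in>highest l.
      cinner (idx (k + l)) (rtens k f f') b = c * cinner (idx k) f' f"
    using B nc_schur unfolding onb_def by blast
  then obtain c where c: "\<And>b f f'. b \<in> B \<Longrightarrow> f \<in> highest k \<Longrightarrow> f' \<in> highest l \<Longrightarrow>
      cinner (idx (k + l)) (rtens k f f') b = c b * cinner (idx k) f' f"
    by metis
  define s where "s = (\<Sum>b\<in>B. (cmod (c b))\<^sup>2)"
  have fin: "finite B" using B by (simp add: onb_def orthonormal_def)
  show thesis
  proof (rule that)
    show "s \<ge> 0" by (simp add: s_def sum_nonneg)
    fix f g f' g' :: "'n list \<Rightarrow> complex"
    assume h: "f \<in> highest k" "g \<in> highest k" "f' \<in> highest l" "g' \<in> highest l"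
    have "haar (star (cf k f g) * cf l f' g') =
        (\<Sum>b\<in>B. cinner (idx (k + l)) (rtens k f f') b * cnj (cinner (idx (k + l)) (rtens k g g') b))"
      by (simp add: star_cf_mult haar_cf[OF B] cnj_cinner)
    also have "\<dots> = (\<Sum>b\<in>B. (c b * cnj (c b)) * (cinner (idx k) f' f * cinner (idx k) g g'))"
      using h by (intro sum.cong refl) (simp add: c cnj_cinner mult_ac)
    also have "\<dots> = complex_of_real s * (cinner (idx k) f' f * cinner (idx k) g g')"
      by (simp add: s_def sum_distrib_right complex_norm_square del: of_real_power)
    finally show "haar (star (cf k f g) * cf l f' g') =
        complex_of_real s * cinner (idx k) f' f * cinner (idx k) g g'" by (simp add: mult.assoc)
  next
    fix f :: "'n list \<Rightarrow> complex"
    assume kl: "k = l" and f: "f \<in> highest k" "cinner (idx k) f f \<noteq> 0"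
    show "s \<noteq> 0"
    proof
      assume "s = 0"
      then have c0: "c b = 0" if "b \<in> B" for b
        using that fin unfolding s_def by (subst (asm) sum_nonneg_eq_0_iff) auto
      have "nc (k + l) (id_vec k :: 'n list \<Rightarrow> complex)"
        using nc_id_vec[of k] kl by (simp add: mult_2)
      then have "id_vec k = (\<lambda>x. \<Sum>b\<in>B. cinner (idx (k + l)) b (id_vec k) * b x)"
        using B unfolding onb_def by blast
      then have "cinner (idx (k + l)) (rtens k f f) (id_vec k) =
          cinner (idx (k + l)) (rtens k f f) (\<lambda>x. \<Sum>b\<in>B. cinner (idx (k + l)) b (id_vec k) * b x)"
        by (rule arg_cong)
      also have "\<dots> = 0"
        unfolding cinner_sum_right using c f c0 kl by (intro sum.neutral) auto
      finally show False using f(2) cinner_rtens_id_vec[of k f f] kl by simp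
    qed
  qed
qed

text \<open>The coefficients between orthonormal bases of the highest weight spaces span the
  algebra, are orthogonal for the form \<open>haar (star x * y)\<close>, and have nonnegative
  squares. In such a system positivity is read off the expansion of \<open>x\<close>.\<close>

lemma haar_nonneg: "haar (star x * x) \<in> \<real>\<^sub>\<ge>\<^sub>0"
proof -
  obtain B :: "nat \<Rightarrow> ('a list \<Rightarrow> complex) set" where B: "\<And>k. onb (idx k) (highest k) (B k)"
    using ex_onb[OF finite_idx fun_subspace_highest] by metis
  define E where "E = {cf k b b' | k b b'. b \<in> B k \<and> b' \<in> B k}"
  have Bh: "b \<in> B k \<Longrightarrow> b \<in> highest k" for b k
    using B[of k] by (auto simp: onb_def)
  have Bo: "cinner (idx k) b b' = (if b = b' then 1 else 0)" if "b \<in> B k" "b' \<in> B k" for b b' k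
    using B[of k] that by (simp add: onb_def orthonormal_def)
  have orth: "haar (star e * e') = 0" if E: "e \<in> E" "e' \<in> E" "e \<noteq> e'" for e e'
  proof -
    obtain k b c where e: "e = cf k b c" "b \<in> B k" "c \<in> B k" using E(1) unfolding E_def by blast
    obtain l b' c' where e': "e' = cf l b' c'" "b' \<in> B l" "c' \<in> B l" using E(2) unfolding E_def by blast
    have "cinner (idx k) b' b * cinner (idx k) c c' = 0"
    proof (cases "k = l")
      case True
      then show ?thesis using E(3) e e' Bo by auto
    next
      case False
      then have "supp l b'" "k \<noteq> l" using highest_supp[OF Bh[OF e'(2)]] by auto
      then have "cinner (idx k) b' b = 0" by (simp add: cinner_def supp_def idx_def)
      then show ?thesis by simp
    qed
    then show ?thesis
      using haar_orthogonality[of k l] Bh e e' by (metis mult.assoc mult_zero_right)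
  qed
  have "\<exists>s\<ge>0. haar (star e * e) = complex_of_real s" if E: "e \<in> E" for e
  proof -
    obtain k b c where e: "e = cf k b c" "b \<in> B k" "c \<in> B k" using E unfolding E_def by blast
    then show ?thesis
      using haar_orthogonality[of k k] Bh Bo[of b k b] Bo[of c k c] by (metis mult.right_neutral)
  qed
  then obtain s where s: "\<And>e. e \<in> E \<Longrightarrow> s e \<ge> 0" "\<And>e. e \<in> E \<Longrightarrow> haar (star e * e) = complex_of_real (s e)"
    by metis
  have "x \<in> cvec.span E"
  proof (induction x rule: highest_induct)
    case (cf k f g)
    have f: "f = (\<lambda>x. \<Sum>b\<in>B k. cinner (idx k) b f * b x)" and g: "g = (\<lambda>x. \<Sum>b\<in>B k. cinner (idx k) b g * b x)"
      using cf B[of k] unfolding onb_def by blast+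
    have "cf k (\<lambda>x. \<Sum>b\<in>B k. cinner (idx k) b f * b x) (\<lambda>x. \<Sum>b\<in>B k. cinner (idx k) b g * b x) \<in> cvec.span E"
      unfolding cf_sum_left cf_sum_right
      by (intro cvec.span_sum cvec.span_scale cvec.span_base) (auto simp: E_def)
    then show ?case using f g by simp
  next
    case (scale c x)
    then show ?case by (rule cvec.span_scale)
  next
    case (add x y)
    then show ?case by (rule cvec.span_add)
  qed
  then obtain T r where T: "finite T" "T \<subseteq> E" and x: "x = (\<Sum>e\<in>T. r e *\<^sub>C e)"
    unfolding cvec.span_explicit by blast
  have "haar (star x * x) = (\<Sum>e\<in>T. \<Sum>e'\<in>T. cnj (r e) * r e' * haar (star e * e'))"
    unfolding x star_sum star_scaleC sum_scaleC_product
    by (simp add: clinear_sum[OF clinear_haar] clinear_simps[OF clinear_haar] scaleC_complex)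
  also have "\<dots> = (\<Sum>e\<in>T. \<Sum>e'\<in>T. if e = e' then cnj (r e) * r e * haar (star e * e) else 0)"
    using T orth by (intro sum.cong refl) auto
  also have "\<dots> = (\<Sum>e\<in>T. cnj (r e) * r e * haar (star e * e))"
    using T by simp
  also have "\<dots> = (\<Sum>e\<in>T. complex_of_real ((cmod (r e))\<^sup>2 * s e))"
    using T s by (intro sum.cong refl) (auto simp: complex_norm_square mult.commute simp del: of_real_power)
  finally have "haar (star x * x) = complex_of_real (\<Sum>e\<in>T. (cmod (r e))\<^sup>2 * s e)" by simp
  moreover have "(\<Sum>e\<in>T. (cmod (r e))\<^sup>2 * s e) \<ge> 0"
    using T s by (intro sum_nonneg mult_nonneg_nonneg) auto
  ultimately show ?thesis by (simp only: nonneg_Reals_of_real_iff)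
qed

lemma haar_state_qperm: "haar_state qperm_comult = (haar :: 'n::finite qperm \<Rightarrow> complex)"
proof -
  have "is_haar_state qperm_comult (haar :: 'n qperm \<Rightarrow> complex)"
    unfolding is_haar_state_def using clinear_haar haar_one haar_nonneg haar_invariant by blast
  then show ?thesis unfolding haar_state_def using haar_state_unique by blast
qed

section \<open>The irreducible representations\<close>

text \<open>In the first sum the generators of the first letters enclose the remaining word, whose
  sum is a scalar by induction. In the second they meet in the middle, so they are summed
  first.\<close>

lemma pm_unitary:
  assumes "xs \<in> idx k" "ms \<in> idx k"
  shows "(\<Sum>ys\<in>idx k. pm xs ys * star (pm ms ys)) = (if xs = ms then 1 else 0)"
    and "(\<Sum>ys\<in>idx k. star (pm ys xs) * pm ys ms) = (if xs = (ms :: 'n::finite list) then 1 else 0)"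
  using assms
proof (induction k arbitrary: xs ms)
  case 0
  case 1 then show ?case by (simp add: idx_0 star_one)
  case 2 then show ?case by (simp add: idx_0 star_one)
next
  case (Suc k)
  case 1
  then obtain x m and xs' ms' where xs: "xs = x # xs'" "ms = m # ms'" "xs' \<in> idx k" "ms' \<in> idx k"
    by (auto simp: idx_def length_Suc_conv)
  have "(\<Sum>ys\<in>idx (Suc k). pm xs ys * star (pm ms ys)) =
      (\<Sum>j\<in>UNIV. \<Sum>ys\<in>idx k. qperm_gen x j * (pm xs' ys * star (pm ms' ys)) * qperm_gen m j)"
    by (subst sum_idx_ins[of 0], simp, subst sum.swap)
       (simp add: ins_def xs star_mult qperm_gen_relations mult.assoc)
  also have "\<dots> = (\<Sum>j\<in>UNIV. qperm_gen x j * (if xs' = ms' then 1 else 0) * qperm_gen m j)"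
    by (simp only: sum_distrib_left[symmetric] sum_distrib_right[symmetric] Suc.IH(1)[OF xs(3,4)])
  also have "\<dots> = (if xs = ms then 1 else 0)"
    by (simp add: xs qperm_gen_relations)
  finally show ?case .
next
  case (Suc k)
  case 2
  then obtain x m and xs' ms' where xs: "xs = x # xs'" "ms = m # ms'" "xs' \<in> idx k" "ms' \<in> idx k"
    by (auto simp: idx_def length_Suc_conv)
  have "(\<Sum>ys\<in>idx (Suc k). star (pm ys xs) * pm ys ms) =
      (\<Sum>ys\<in>idx k. \<Sum>j\<in>UNIV. star (pm ys xs') * ((if x = m then qperm_gen j x else 0) * pm ys ms'))"
    by (subst sum_idx_ins[of 0], simp, intro sum.cong refl)
       (simp add: ins_def xs star_mult qperm_gen_relations mult.assoc qperm_gen_mult)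
  also have "\<dots> = (\<Sum>ys\<in>idx k. star (pm ys xs') * ((if x = m then 1 else 0) * pm ys ms'))"
    by (simp add: sum_distrib_left[symmetric] sum_distrib_right[symmetric] qperm_gen_relations)
  also have "\<dots> = (if xs = ms then 1 else 0)"
    using Suc.IH(2)[OF xs(3,4)] by (auto simp: xs)
  finally show ?case .
qed

section \<open>Unitarity and coproduct on a highest weight space\<close>

context
  fixes k :: nat and B :: "('n::finite list \<Rightarrow> complex) set"
  assumes B: "onb (idx k) (highest k) B"
begin

lemma basis_highest: "b \<in> B \<Longrightarrow> b \<in> highest k"
  using B by (auto simp: onb_def)

lemma basis_orthonormal: "b \<in> B \<Longrightarrow> b' \<in> B \<Longrightarrow> cinner (idx k) b b' = (if b = b' then 1 else 0)"
  using B by (simp add: onb_def orthonormal_def)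

lemma basis_expansion: "f \<in> highest k \<Longrightarrow> f = (\<lambda>x. \<Sum>b\<in>B. cinner (idx k) b f * b x)"
  using B unfolding onb_def by blast

text \<open>The sum is the projection of a standard basis vector onto \<open>highest k\<close>. The
  raised rest is invisible to coefficients against highest weight vectors, so sums over all
  multi-indices can be traded for sums over \<open>B\<close>.\<close>

lemma delta_decomposition:
  assumes "x \<in> idx k"
  obtains w where "raised k w" "(\<lambda>y. if y = x then 1 else 0) = (\<lambda>y. w y + (\<Sum>b\<in>B. cnj (b x) * b y))"
proof -
  let ?d = "\<lambda>y. if y = x then 1 else (0 :: complex)"
  have "supp k ?d" using assms by (auto simp: supp_def idx_def)
  then obtain w l where w: "raised k w" and l: "l \<in> highest k" and d: "?d = (\<lambda>y. w y + l y)"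
    using raised_highest_decomposition by blast
  have "cinner (idx k) b l = cnj (b x)" if "b \<in> B" for b
  proof -
    have "cinner (idx k) b ?d = cnj (b x)" using assms by (simp add: cinner_delta_right)
    then have "cinner (idx k) b w + cinner (idx k) b l = cnj (b x)" by (simp only: d cinner_simps)
    then show ?thesis using raised_orthogonal_highest(1)[OF w basis_highest[OF that]] by simp
  qed
  then have "l = (\<lambda>y. \<Sum>b\<in>B. cnj (b x) * b y)"
    using basis_expansion[OF l] by (metis (no_types, lifting) sum.cong)
  with w d show thesis by (auto intro: that)
qed

lemma prow_expansion:
  assumes "f \<in> highest k" "y \<in> idx k"
  shows "prow k (\<lambda>x. cnj (f x)) y = (\<Sum>b\<in>B. cnj (b y) *\<^sub>C cf k f b)"
proof -
  obtain w where w: "raised k w" "(\<lambda>x. if x = y then 1 else 0) = (\<lambda>x. w x + (\<Sum>b\<in>B. cnj (b y) * b x))"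
    using delta_decomposition[OF assms(2)] .
  have "prow k (\<lambda>x. cnj (f x)) y = cf k f (\<lambda>x. w x + (\<Sum>b\<in>B. cnj (b y) * b x))"
    using cf_delta_right[OF assms(2), of f] unfolding w(2) by simp
  then show ?thesis using cf_raised_highest(2)[OF w(1) assms(1)] by (simp add: cf_simps cf_sum_right)
qed

lemma pcol_expansion:
  assumes "g \<in> highest k" "x \<in> idx k"
  shows "pcol k g x = (\<Sum>b\<in>B. b x *\<^sub>C cf k b g)"
proof -
  obtain w where w: "raised k w" "(\<lambda>y. if y = x then 1 else 0) = (\<lambda>y. w y + (\<Sum>b\<in>B. cnj (b x) * b y))"
    using delta_decomposition[OF assms(2)] .
  have "pcol k g x = cf k (\<lambda>y. w y + (\<Sum>b\<in>B. cnj (b x) * b y)) g"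
    using cf_delta_left[OF assms(2), of g] unfolding w(2) by simp
  then show ?thesis using cf_raised_highest(1)[OF w(1) assms(1)] by (simp add: cf_simps cf_sum_left)
qed

text \<open>Unitarity is inherited from the full tensor power: \<open>prow_expansion\<close> turns
  the sum over \<open>B\<close> into one over all multi-indices.\<close>

lemma cf_unitary_left:
  assumes "f \<in> highest k" "f' \<in> highest k"
  shows "(\<Sum>b\<in>B. cf k f b * star (cf k f' b)) = cinner (idx k) f f' *\<^sub>C 1"
proof -
  let ?r = "\<lambda>f. prow k (\<lambda>x. cnj (f x))"
  have "(\<Sum>b\<in>B. cf k f b * star (cf k f' b)) = (\<Sum>b\<in>B. \<Sum>y\<in>idx k. (cnj (b y) *\<^sub>C cf k f b) * star (?r f' y))"
    by (simp add: cf_def[of k f'] star_sum star_scaleC sum_distrib_left scaleC_mult_right scaleC_mult_left)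
  also have "\<dots> = (\<Sum>y\<in>idx k. ?r f y * star (?r f' y))"
    by (subst sum.swap) (simp add: prow_expansion[OF assms(1)] sum_distrib_right)
  also have "\<dots> = (\<Sum>y\<in>idx k. \<Sum>x\<in>idx k. \<Sum>m\<in>idx k. (cnj (f x) * f' m) *\<^sub>C (pm x y * star (pm m y)))"
    by (simp add: prow_def star_sum star_scaleC sum_scaleC_product)
  also have "\<dots> = (\<Sum>x\<in>idx k. \<Sum>m\<in>idx k. \<Sum>y\<in>idx k. (cnj (f x) * f' m) *\<^sub>C (pm x y * star (pm m y)))"
    by (subst sum.swap, subst (2) sum.swap) (rule refl)
  also have "\<dots> = (\<Sum>x\<in>idx k. \<Sum>m\<in>idx k. if x = m then (cnj (f x) * f' x) *\<^sub>C 1 else 0)"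
    by (intro sum.cong refl) (simp add: cvec.scale_sum_right[symmetric] pm_unitary)
  also have "\<dots> = cinner (idx k) f f' *\<^sub>C 1"
    by (simp add: cinner_def cvec.scale_sum_left)
  finally show ?thesis .
qed

lemma cf_unitary_right:
  assumes "g \<in> highest k" "g' \<in> highest k"
  shows "(\<Sum>b\<in>B. star (cf k b g) * cf k b g') = cinner (idx k) g g' *\<^sub>C 1"
proof -
  have "(\<Sum>b\<in>B. star (cf k b g) * cf k b g') = (\<Sum>b\<in>B. \<Sum>x\<in>idx k. star (pcol k g x) * (b x *\<^sub>C cf k b g'))"
    by (simp add: cf_pcol[of k _ g] star_sum star_scaleC sum_distrib_right scaleC_mult_right scaleC_mult_left)
  also have "\<dots> = (\<Sum>x\<in>idx k. star (pcol k g x) * pcol k g' x)"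
    by (subst sum.swap) (simp add: pcol_expansion[OF assms(2)] sum_distrib_left)
  also have "\<dots> = (\<Sum>x\<in>idx k. \<Sum>y\<in>idx k. \<Sum>m\<in>idx k. (cnj (g y) * g' m) *\<^sub>C (star (pm x y) * pm x m))"
    by (simp add: pcol_def star_sum star_scaleC sum_scaleC_product)
  also have "\<dots> = (\<Sum>y\<in>idx k. \<Sum>m\<in>idx k. \<Sum>x\<in>idx k. (cnj (g y) * g' m) *\<^sub>C (star (pm x y) * pm x m))"
    by (subst sum.swap, subst (2) sum.swap) (rule refl)
  also have "\<dots> = (\<Sum>y\<in>idx k. \<Sum>m\<in>idx k. if y = m then (cnj (g y) * g' y) *\<^sub>C 1 else 0)"
    by (intro sum.cong refl) (simp add: cvec.scale_sum_right[symmetric] pm_unitary)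
  also have "\<dots> = cinner (idx k) g g' *\<^sub>C 1"
    by (simp add: cinner_def cvec.scale_sum_left)
  finally show ?thesis .
qed

lemma comult_cf:
  assumes "f \<in> highest k"
  shows "qperm_comult (cf k f g) = (\<Sum>b\<in>B. cf k f b \<otimes>\<^sub>C cf k b g)"
proof -
  have "qperm_comult (cf k f g) =
      (\<Sum>x\<in>idx k. \<Sum>y\<in>idx k. \<Sum>m\<in>idx k. (cnj (f x) *\<^sub>C pm x m) \<otimes>\<^sub>C (g y *\<^sub>C pm m y))"
    unfolding cf_double clinear_sum[OF clinear_comult] clinear_simps[OF clinear_comult]
  proof (intro sum.cong refl)
    fix x y :: "'n list" assume "x \<in> idx k" "y \<in> idx k"
    then have "qperm_comult (pm x y) = (\<Sum>m\<in>idx k. pm x m \<otimes>\<^sub>C pm m y)"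
      using comult_pm[of x y] by (simp add: idx_def)
    then show "(cnj (f x) * g y) *\<^sub>C qperm_comult (pm x y) =
        (\<Sum>m\<in>idx k. (cnj (f x) *\<^sub>C pm x m) \<otimes>\<^sub>C (g y *\<^sub>C pm m y))"
      by (simp add: cvec.scale_sum_right tensor_bilinear scaleC_scaleC mult.commute)
  qed
  also have "\<dots> = (\<Sum>m\<in>idx k. prow k (\<lambda>x. cnj (f x)) m \<otimes>\<^sub>C pcol k g m)"
    unfolding prow_def pcol_def tensor_sum
    by (subst (2) sum.swap, subst sum.swap) (rule sum.swap)
  also have "\<dots> = (\<Sum>m\<in>idx k. \<Sum>b\<in>B. cf k f b \<otimes>\<^sub>C (cnj (b m) *\<^sub>C pcol k g m))"
    by (simp add: prow_expansion[OF assms] tensor_sum tensor_bilinear)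
  also have "\<dots> = (\<Sum>b\<in>B. cf k f b \<otimes>\<^sub>C cf k b g)"
    by (subst sum.swap) (simp add: cf_pcol tensor_sum)
  finally show ?thesis .
qed

end

text \<open>By orthogonality the Haar state takes the value s times the two squared norms on the
  square of the coefficient, and s is nonzero as soon as \<open>f\<close> has nonzero norm.\<close>

lemma cf_nonzero:
  fixes f g :: "'n::finite list \<Rightarrow> complex"
  assumes "f \<in> highest k" "g \<in> highest k" "cf k f g = 0"
  shows "cinner (idx k) f f = 0 \<or> cinner (idx k) g g = 0"
proof (rule haar_orthogonality[of k k])
  fix s :: real
  assume eq: "\<And>f g f' g' :: 'n list \<Rightarrow> complex. f \<in> highest k \<Longrightarrow> g \<in> highest k \<Longrightarrow> f' \<in> highest k \<Longrightarrow> g' \<in> highest k \<Longrightarrow>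
      haar (star (cf k f g) * cf k f' g') = complex_of_real s * cinner (idx k) f' f * cinner (idx k) g g'"
    and s: "\<And>f :: 'n list \<Rightarrow> complex. k = k \<Longrightarrow> f \<in> highest k \<Longrightarrow> cinner (idx k) f f \<noteq> 0 \<Longrightarrow> s \<noteq> 0"
  have "complex_of_real s * cinner (idx k) f f * cinner (idx k) g g = 0"
    using eq[OF assms(1,2,1,2)] assms(3) by (simp add: clinear_simps[OF clinear_haar])
  then show ?thesis using s[OF refl assms(1)] by auto
qed

definition highest_rep :: "nat \<Rightarrow> ('n::finite list \<Rightarrow> complex) list \<Rightarrow> 'n qperm mat" where
  "highest_rep k bs = mat (length bs) (length bs) (\<lambda>(i, j). cf k (bs ! i) (bs ! j))"

text \<open>For an invariant projection P all coefficients between the ranges of 1 - P and P vanish.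
  By \<open>cf_nonzero\<close> one of the two ranges is zero.\<close>

lemma irreducible_highest_rep:
  fixes bs :: "('n::finite list \<Rightarrow> complex) list"
  assumes B: "onb (idx k) (highest k) (set bs)" and bs: "distinct bs" "bs \<noteq> []"
  shows "irreducible_unitary qperm_comult (highest_rep k bs)"
proof -
  let ?U = "highest_rep k bs" and ?r = "length bs"
  have sum_bs: "(\<Sum>i = 0..<?r. F (bs ! i)) = (\<Sum>b\<in>set bs. F b)" for F :: "_ \<Rightarrow> 'b::comm_monoid_add"
    using sum.reindex_bij_betw[OF bij_betw_nth[OF bs(1) refl refl], of F] by (simp add: lessThan_atLeast0)
  have h: "bs ! i \<in> highest k" if "i < ?r" for i
    using basis_highest[OF B] that by simp
  have on: "cinner (idx k) (bs ! i) (bs ! j) = (if i = j then 1 else 0)" if "i < ?r" "j < ?r" for i j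
    using basis_orthonormal[OF B, of "bs ! i" "bs ! j"] that bs(1) by (simp add: nth_eq_iff_index_eq)
  have on_sum: "cinner (idx k) (bs ! i) (\<lambda>x. \<Sum>j = 0..<?r. c j * (bs ! j) x) = c i" if "i < ?r" for i c
  proof -
    have "cinner (idx k) (bs ! i) (\<lambda>x. \<Sum>j = 0..<?r. c j * (bs ! j) x) =
        (\<Sum>j = 0..<?r. if i = j then c i else 0)"
      unfolding cinner_sum_right using on that by (intro sum.cong refl) auto
    then show ?thesis using that by simp
  qed
  have null: "cinner (idx k) (bs ! i) f = 0" if "cinner (idx k) f f = 0" for i f
    using that cinner_self_eq_0[OF finite_idx, of k f] by (simp add: cinner_def[of _ "bs ! i"])
  have dim: "dim_row ?U = ?r" "dim_col ?U = ?r" "dim_row (adjoint_mat ?U) = ?r" "dim_col (adjoint_mat ?U) = ?r"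
    by (simp_all add: highest_rep_def adjoint_mat_def)
  have adj: "adjoint_mat ?U $$ (i, j) = star (cf k (bs ! j) (bs ! i))" if "i < ?r" "j < ?r" for i j
    using that by (simp add: adjoint_mat_def highest_rep_def)
  have U: "?U $$ (i, j) = cf k (bs ! i) (bs ! j)" if "i < ?r" "j < ?r" for i j
    using that by (simp add: highest_rep_def)
  have "unitary_representation qperm_comult ?U"
    unfolding unitary_representation_def dim
  proof (intro conjI allI impI)
    show "square_mat ?U" by (simp add: dim)
    show "1 \<le> ?r" using bs by (cases bs) auto
    show "?U * adjoint_mat ?U = 1\<^sub>m ?r"
    proof (rule eq_matI)
      fix i j assume "i < dim_row (1\<^sub>m ?r)" "j < dim_col (1\<^sub>m ?r)"
      then have ij: "i < ?r" "j < ?r" by simp_all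
      then have "(?U * adjoint_mat ?U) $$ (i, j) =
          (\<Sum>l = 0..<?r. cf k (bs ! i) (bs ! l) * star (cf k (bs ! j) (bs ! l)))"
        by (simp add: scalar_prod_def dim adj U)
      also have "\<dots> = 1\<^sub>m ?r $$ (i, j)"
        using ij by (simp add: sum_bs[of "\<lambda>b. cf k (bs ! i) b * star (cf k (bs ! j) b)"]
            cf_unitary_left[OF B h h] on scaleC_one)
      finally show "(?U * adjoint_mat ?U) $$ (i, j) = 1\<^sub>m ?r $$ (i, j)" .
    qed (simp_all add: dim)
    show "adjoint_mat ?U * ?U = 1\<^sub>m ?r"
    proof (rule eq_matI)
      fix i j assume "i < dim_row (1\<^sub>m ?r)" "j < dim_col (1\<^sub>m ?r)"
      then have ij: "i < ?r" "j < ?r" by simp_all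
      then have "(adjoint_mat ?U * ?U) $$ (i, j) =
          (\<Sum>l = 0..<?r. star (cf k (bs ! l) (bs ! i)) * cf k (bs ! l) (bs ! j))"
        by (simp add: scalar_prod_def dim adj U)
      also have "\<dots> = 1\<^sub>m ?r $$ (i, j)"
        using ij by (simp add: sum_bs[of "\<lambda>b. star (cf k b (bs ! i)) * cf k b (bs ! j)"]
            cf_unitary_right[OF B h h] on scaleC_one)
      finally show "(adjoint_mat ?U * ?U) $$ (i, j) = 1\<^sub>m ?r $$ (i, j)" .
    qed (simp_all add: dim)
    fix i j assume ij: "i < ?r" "j < ?r"
    then show "qperm_comult (?U $$ (i, j)) = (\<Sum>l<?r. ?U $$ (i, l) \<otimes>\<^sub>C ?U $$ (l, j))"
      using sum_bs[of "\<lambda>b. cf k (bs ! i) b \<otimes>\<^sub>C cf k b (bs ! j)"]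
      by (simp add: U comult_cf[OF B h] lessThan_atLeast0)
  qed
  moreover have "P = 0\<^sub>m ?r ?r \<or> P = 1\<^sub>m ?r"
    if P: "P \<in> carrier_mat ?r ?r" and inv: "?U * scalar_mat P = scalar_mat P * ?U * scalar_mat P" for P
  proof -
    \<comment> \<open>These are P applied to the \<open>d\<close>-th and 1 minus the adjoint of P
      applied to the \<open>a\<close>-th basis vector; invariance says that the coefficient between
      them is 0.\<close>
    define g where "g d = (\<lambda>x. \<Sum>c = 0..<?r. P $$ (c, d) * (bs ! c) x)" for d
    define f where "f a = (\<lambda>x. (bs ! a) x - (\<Sum>b = 0..<?r. cnj (P $$ (a, b)) * (bs ! b) x))" for a
    have gh: "g d \<in> highest k" for d
      unfolding g_def using h by (intro fun_subspace_sum[OF fun_subspace_highest]) auto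
    have fh: "f a \<in> highest k" if "a < ?r" for a
      unfolding f_def using h that
      by (intro fun_subspace_diff[OF fun_subspace_highest] fun_subspace_sum[OF fun_subspace_highest]) auto
    have dP: "dim_row P = ?r" "dim_col P = ?r" using P by auto
    have van: "cf k (f a) (g d) = 0" if ad: "a < ?r" "d < ?r" for a d
    proof -
      have e1: "(?U * scalar_mat P) $$ (a', d) = cf k (bs ! a') (g d)" if "a' < ?r" for a'
        using that ad dP by (simp add: scalar_prod_def dim scalar_mat_def U g_def cf_sum_right
            scaleC_mult_right)
      have e2: "(scalar_mat P * (?U * scalar_mat P)) $$ (a, d) =
          (\<Sum>b = 0..<?r. P $$ (a, b) *\<^sub>C (?U * scalar_mat P) $$ (b, d))"
        using ad dP by (simp add: scalar_prod_def dim scalar_mat_def scaleC_mult_left)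
      have e3: "scalar_mat P * ?U * scalar_mat P = scalar_mat P * (?U * scalar_mat P)"
        using dP by (intro assoc_mult_mat[of _ ?r ?r _ ?r _ ?r]) (auto simp: dim scalar_mat_def)
      have "cf k (bs ! a) (g d) = (scalar_mat P * (?U * scalar_mat P)) $$ (a, d)"
        unfolding e1[OF ad(1), symmetric] by (rule arg_cong[OF trans[OF inv e3]])
      also have "\<dots> = (\<Sum>b = 0..<?r. P $$ (a, b) *\<^sub>C cf k (bs ! b) (g d))"
        unfolding e2 by (intro sum.cong refl) (simp add: e1)
      finally have eq: "cf k (bs ! a) (g d) = (\<Sum>b = 0..<?r. P $$ (a, b) *\<^sub>C cf k (bs ! b) (g d))" .
      have "cf k (\<lambda>x. f a x + (\<Sum>b = 0..<?r. cnj (P $$ (a, b)) * (bs ! b) x)) (g d) =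
          cf k (f a) (g d) + (\<Sum>b = 0..<?r. P $$ (a, b) *\<^sub>C cf k (bs ! b) (g d))"
        unfolding cf_simps cf_sum_left by simp
      then show ?thesis using eq by (simp add: f_def)
    qed
    show ?thesis
    proof (cases "\<exists>d<?r. cinner (idx k) (g d) (g d) \<noteq> 0")
      case True
      then obtain d where d: "d < ?r" "cinner (idx k) (g d) (g d) \<noteq> 0" by blast
      have "P $$ (a, b) = (if a = b then 1 else 0)" if ab: "a < ?r" "b < ?r" for a b
      proof -
        have "cinner (idx k) (f a) (f a) = 0"
          using cf_nonzero[OF fh gh van] ab d by blast
        from null[OF this, of b] have "cnj (P $$ (a, b)) = cinner (idx k) (bs ! b) (bs ! a)"
          unfolding f_def cinner_simps on_sum[OF ab(2)] by simp
        then have "cnj (P $$ (a, b)) = (if b = a then 1 else 0)" using ab by (simp add: on)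
        then have "cnj (cnj (P $$ (a, b))) = cnj (if b = a then 1 else 0)" by (rule arg_cong)
        then show ?thesis by (auto split: if_splits)
      qed
      then have "P = 1\<^sub>m ?r" using dP by (intro eq_matI) auto
      then show ?thesis ..
    next
      case False
      have "P $$ (c, d) = 0" if "c < ?r" "d < ?r" for c d
        using null[of "g d" c] False that on_sum[OF that(1), of "\<lambda>c. P $$ (c, d)"] by (simp add: g_def)
      then have "P = 0\<^sub>m ?r ?r" using dP by (intro eq_matI) auto
      then show ?thesis ..
    qed
  qed
  ultimately show ?thesis
    unfolding irreducible_unitary_def dim by blast
qed

text \<open>Centrality speaks of the chosen representatives only. \<open>highest_rep\<close> is
  conjugate to one of them by a scalar matrix T, with which \<open>\<phi>\<close> commutes, and
  conjugation fixes multiples of the identity. Expansion in a basis extends the formula to all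
  highest weight vectors.\<close>

lemma central_highest:
  fixes \<phi> :: "'n::finite qperm \<Rightarrow> complex"
  assumes Irr: "irr_representatives qperm_comult Irr" and lin: "clinear \<phi>" and cent: "central Irr \<phi>"
  shows "\<exists>c. \<forall>f\<in>highest k. \<forall>g\<in>highest k. \<phi> (cf k f g) = c * cinner (idx k) f g"
proof -
  obtain B where B: "onb (idx k) (highest k :: ('n list \<Rightarrow> complex) set) B"
    using ex_onb[OF finite_idx fun_subspace_highest] by blast
  then have "finite B" by (simp add: onb_def orthonormal_def)
  then obtain bs where bs: "set bs = B" "distinct bs" using finite_distinct_list by blast
  have "\<exists>c. \<forall>b\<in>B. \<forall>b'\<in>B. \<phi> (cf k b b') = (if b = b' then c else 0)"
  proof (cases "bs = []")
    case True
    then show ?thesis using bs by simp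
  next
    case False
    let ?U = "highest_rep k bs" and ?r = "length bs"
    have "irreducible_unitary qperm_comult ?U"
      using irreducible_highest_rep B bs False by blast
    then obtain V where V: "V \<in> Irr" "equivalent_reps V ?U"
      using Irr unfolding irr_representatives_def by blast
    have dU: "dim_row ?U = ?r" "dim_col ?U = ?r" by (simp_all add: highest_rep_def)
    obtain T where dV: "dim_row V = ?r" and T: "T \<in> carrier_mat ?r ?r" "invertible_mat T"
      and eq: "scalar_mat T * V = ?U * scalar_mat T"
      using V(2) by (auto simp: equivalent_reps_def dU)
    have "irreducible_unitary qperm_comult V" using Irr V(1) by (simp add: irr_representatives_def)
    then have dV': "dim_col V = ?r"
      using dV by (simp add: irreducible_unitary_def unitary_representation_def)
    obtain c where c: "\<And>i j. i < ?r \<Longrightarrow> j < ?r \<Longrightarrow> \<phi> (V $$ (i, j)) = (if i = j then c else 0)"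
      using bspec[OF cent[unfolded central_def] V(1)] dV by auto
    obtain S where S: "T * S = 1\<^sub>m ?r" "S * T = 1\<^sub>m (dim_row S)"
      using T by (auto simp: invertible_mat_def inverts_mat_def)
    have dS: "S \<in> carrier_mat ?r ?r"
    proof (rule carrier_matI)
      show "dim_row S = ?r" using arg_cong[OF S(2), of dim_col] T by simp
      show "dim_col S = ?r" using arg_cong[OF S(1), of dim_col] by simp
    qed
    define M where "M = mat ?r ?r (\<lambda>(i, j). \<phi> (?U $$ (i, j)))"
    have M: "M \<in> carrier_mat ?r ?r" by (simp add: M_def)
    have "M * T = c \<cdot>\<^sub>m T"
    proof (rule eq_matI)
      fix i j assume "i < dim_row (c \<cdot>\<^sub>m T)" "j < dim_col (c \<cdot>\<^sub>m T)"
      then have ij: "i < ?r" "j < ?r" using T by auto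
      have "\<phi> ((scalar_mat T * V) $$ (i, j)) = (\<Sum>l = 0..<?r. T $$ (i, l) * \<phi> (V $$ (l, j)))"
        using ij T dV dV' by (simp add: scalar_prod_def scalar_mat_def scaleC_mult_left
            clinear_sum[OF lin] clinear_simps[OF lin] scaleC_complex)
      also have "\<dots> = (\<Sum>l = 0..<?r. if l = j then T $$ (i, l) * c else 0)"
        using ij c by (intro sum.cong refl) auto
      also have "\<dots> = (c \<cdot>\<^sub>m T) $$ (i, j)" using ij T by simp
      finally have "\<phi> ((scalar_mat T * V) $$ (i, j)) = (c \<cdot>\<^sub>m T) $$ (i, j)" .
      moreover have "\<phi> ((?U * scalar_mat T) $$ (i, j)) = (M * T) $$ (i, j)"
        using ij T dU by (simp add: scalar_prod_def scalar_mat_def scaleC_mult_right M_def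
            clinear_sum[OF lin] clinear_simps[OF lin] scaleC_complex mult.commute)
      ultimately show "(M * T) $$ (i, j) = (c \<cdot>\<^sub>m T) $$ (i, j)" using eq by simp
    qed (use T M in auto)
    then have "M * T * S = c \<cdot>\<^sub>m (T * S)"
      using T dS by (simp add: mult_smult_assoc_mat[of T ?r ?r S ?r])
    then have "M = c \<cdot>\<^sub>m 1\<^sub>m ?r"
      using S(1) M T(1) dS by (simp add: assoc_mult_mat[of M ?r ?r T ?r S ?r])
    then have "\<phi> (cf k (bs ! i) (bs ! j)) = (if i = j then c else 0)" if "i < ?r" "j < ?r" for i j
    proof -
      have "M $$ (i, j) = (if i = j then c else 0)"
        using that unfolding \<open>M = c \<cdot>\<^sub>m 1\<^sub>m ?r\<close> by simp
      then show ?thesis using that by (simp add: M_def highest_rep_def)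
    qed
    then have "\<phi> (cf k b b') = (if b = b' then c else 0)" if "b \<in> B" "b' \<in> B" for b b'
      using that bs by (metis in_set_conv_nth nth_eq_iff_index_eq)
    then show ?thesis by blast
  qed
  then obtain c where c: "\<And>b b'. b \<in> B \<Longrightarrow> b' \<in> B \<Longrightarrow> \<phi> (cf k b b') = (if b = b' then c else 0)" by blast
  have "\<phi> (cf k f g) = c * cinner (idx k) f g" if fg: "f \<in> highest k" "g \<in> highest k" for f g
  proof -
    let ?e = "\<lambda>f x. \<Sum>b\<in>B. cinner (idx k) b f * b x"
    have "\<phi> (cf k f g) = \<phi> (cf k (?e f) (?e g))"
      using basis_expansion[OF B fg(1)] basis_expansion[OF B fg(2)] by simp
    also have "\<dots> = (\<Sum>b\<in>B. \<Sum>b'\<in>B. cinner (idx k) b' g * (cinner (idx k) f b * \<phi> (cf k b b')))"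
      unfolding cf_sum_left cf_sum_right
      by (simp add: clinear_sum[OF lin] clinear_simps[OF lin] scaleC_complex cnj_cinner sum_distrib_left mult_ac)
    also have "\<dots> = (\<Sum>b\<in>B. \<Sum>b'\<in>B. if b = b' then c * (cinner (idx k) f b * cinner (idx k) b g) else 0)"
      using c by (intro sum.cong refl) auto
    also have "\<dots> = c * (\<Sum>b\<in>B. cinner (idx k) f b * cinner (idx k) b g)"
      using \<open>finite B\<close> by (simp add: sum_distrib_left)
    also have "\<dots> = c * cinner (idx k) f g"
      by (simp add: onb_cinner[OF B fg])
    finally show ?thesis .
  qed
  then show ?thesis by blast
qed

section \<open>Tracial central functionals\<close>

fun tens :: "('n \<Rightarrow> complex) list \<Rightarrow> 'n list \<Rightarrow> complex" where
  "tens [] [] = 1"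
| "tens (v # vs) (x # xs) = v x * tens vs xs"
| "tens [] (x # xs) = 0"
| "tens (v # vs) [] = 0"

lemma tens_length: "length vs \<noteq> length xs \<Longrightarrow> tens vs xs = 0"
  by (induction vs xs rule: tens.induct) auto

lemma tens_append: "length vs = length xs \<Longrightarrow> tens (vs @ ws) (xs @ ys) = tens vs xs * tens ws ys"
  by (induction vs xs rule: list_induct2) auto

lemma tens_nonzero: "\<forall>v\<in>set vs. \<exists>x. v x \<noteq> 0 \<Longrightarrow> \<exists>xs. length xs = length vs \<and> tens vs xs \<noteq> 0"
proof (induction vs)
  case (Cons v vs)
  then obtain xs x where "length xs = length vs" "tens vs xs \<noteq> 0" "v x \<noteq> 0" by auto
  then show ?case by (intro exI[of _ "x # xs"]) simp
qed simp

text \<open>Merging multiplies two neighbouring factors pointwise and contracting sums a single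
  factor, so both operations give 0.\<close>

lemma tens_highest:
  fixes vs :: "('n::finite \<Rightarrow> complex) list"
  assumes sum0: "\<forall>v\<in>set vs. (\<Sum>i\<in>UNIV. v i) = 0" and adj: "successively (\<lambda>v w. \<forall>i. v i * w i = 0) vs"
  shows "tens vs \<in> highest (length vs)"
proof -
  have supp: "supp (length vs) (tens vs)" by (simp add: supp_def tens_length)
  have "merge a (tens vs) xs = 0" for a xs
  proof (cases "a < length xs \<and> Suc (length xs) = length vs")
    case True
    define A v w C where "A = take a vs" and "v = vs ! a" and "w = vs ! Suc a" and "C = drop (Suc (Suc a)) vs"
    have vs: "vs = A @ v # w # C"
      using True by (simp add: A_def v_def w_def C_def Cons_nth_drop_Suc id_take_nth_drop[symmetric])
    have "v i * w i = 0" for i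
      using adj unfolding vs by (simp add: successively_append_iff)
    moreover have "tens vs (ins a (xs ! a) xs) =
        tens A (take a xs) * (v (xs ! a) * w (xs ! a) * tens C (drop (Suc a) xs))"
      unfolding vs using True
      by (simp add: ins_def A_def tens_append Cons_nth_drop_Suc[symmetric])
    ultimately show ?thesis by (simp add: merge_def)
  next
    case False
    then show ?thesis by (auto simp: merge_def tens_length)
  qed
  moreover have "contract a (tens vs) xs = 0" for a xs
  proof (cases "a \<le> length xs \<and> Suc (length xs) = length vs")
    case True
    define A v C where "A = take a vs" and "v = vs ! a" and "C = drop (Suc a) vs"
    have vs: "vs = A @ v # C"
      using True by (simp add: A_def v_def C_def id_take_nth_drop[symmetric])
    have "(\<Sum>i\<in>UNIV. v i) = 0" using sum0 unfolding vs by simp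
    moreover have "tens vs (ins a i xs) = v i * (tens A (take a xs) * tens C (drop a xs))" for i
      unfolding vs using True by (simp add: ins_def A_def tens_append)
    ultimately show ?thesis by (simp add: contract_def sum_distrib_right[symmetric])
  next
    case False
    then show ?thesis by (auto simp: contract_def tens_length)
  qed
  ultimately show ?thesis using supp by (simp add: highest_def fun_eq_iff)
qed

text \<open>Traciality carries the last generator to the front. There it shares its row with the
  first one, so the product vanishes unless the columns agree, and then it is absorbed.\<close>

lemma tracial_rotate:
  fixes \<phi> :: "'n::finite qperm \<Rightarrow> complex"
  assumes lin: "clinear \<phi>" and tr: "tracial \<phi>" and X: "X \<in> idx (Suc n)"
  shows "\<phi> (pcol (Suc (Suc n)) \<xi> (X @ [hd X])) = \<phi> (pcol (Suc n) (\<lambda>Y. \<xi> (Y @ [hd Y])) X)"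
proof -
  have rot: "\<phi> (pm (X @ [hd X]) (Y @ [z])) = (if z = hd Y then \<phi> (pm X Y) else 0)" if Y: "Y \<in> idx (Suc n)" for Y z
  proof -
    obtain x xs y ys where XY: "X = x # xs" "Y = y # ys" "length xs = length ys"
      using X Y by (auto simp: idx_def length_Suc_conv)
    have "\<phi> (pm (X @ [hd X]) (Y @ [z])) = \<phi> ((qperm_gen x y * pm xs ys) * qperm_gen x z)"
      using XY by (simp add: pm_append mult.assoc)
    also have "\<dots> = \<phi> (qperm_gen x z * (qperm_gen x y * pm xs ys))"
      using tr unfolding tracial_def by blast
    finally show ?thesis using XY by (simp add: qperm_gen_mult clinear_simps[OF lin])
  qed
  have ins_end: "ins (Suc n) z Y = Y @ [z]" if "Y \<in> idx (Suc n)" for Y and z :: 'n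
    using that by (simp add: ins_def idx_def)
  have "\<phi> (pcol (Suc (Suc n)) \<xi> (X @ [hd X])) =
      (\<Sum>Y\<in>idx (Suc n). \<Sum>z\<in>UNIV. \<xi> (Y @ [z]) * \<phi> (pm (X @ [hd X]) (Y @ [z])))"
    unfolding pcol_def clinear_sum[OF lin] clinear_simps[OF lin] scaleC_complex
    by (subst sum_idx_ins[of "Suc n"]) (simp_all add: ins_end)
  also have "\<dots> = (\<Sum>Y\<in>idx (Suc n). \<Sum>z\<in>UNIV. if z = hd Y then \<xi> (Y @ [z]) * \<phi> (pm X Y) else 0)"
    by (intro sum.cong refl) (simp add: rot)
  finally show ?thesis
    by (simp add: pcol_def clinear_sum[OF lin] clinear_simps[OF lin] scaleC_complex)
qed

text \<open>The scalar action persists on the full tensor power: of the delta at \<open>x\<close>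
  only the highest weight part contributes, since coefficients between raised and highest weight
  vectors vanish.\<close>

lemma phi_pcol_highest:
  fixes \<phi> :: "'n::finite qperm \<Rightarrow> complex"
  assumes lin: "clinear \<phi>" and c: "\<And>f g. f \<in> highest k \<Longrightarrow> g \<in> highest k \<Longrightarrow> \<phi> (cf k f g) = c * cinner (idx k) f g"
    and g: "g \<in> highest k" and x: "x \<in> idx k"
  shows "\<phi> (pcol k g x) = c * g x"
proof -
  let ?d = "\<lambda>y. if y = x then 1 else (0 :: complex)"
  have "supp k ?d" using x by (auto simp: supp_def idx_def)
  then obtain w l where w: "raised k w" and l: "l \<in> highest k" and d: "?d = (\<lambda>y. w y + l y)"
    using raised_highest_decomposition by blast
  have "pcol k g x = cf k ?d g" using x by (simp add: cf_delta_left)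
  also have "\<dots> = cf k l g" unfolding d cf_simps using cf_raised_highest(1)[OF w g] by simp
  finally have "\<phi> (pcol k g x) = c * cinner (idx k) l g" using c[OF l g] by simp
  moreover have "cinner (idx k) ?d g = cinner (idx k) l g"
    unfolding d cinner_simps using raised_orthogonal_highest(2)[OF w g] by simp
  ultimately show ?thesis using x by (simp add: cinner_delta_left)
qed

text \<open>The generators in a column sum to 1, so summing over the first row index passes to the
  first leg of \<open>g\<close>.\<close>

lemma sum_pcol_contract:
  assumes "X \<in> idx k"
  shows "(\<Sum>i\<in>UNIV. pcol (Suc k) g (i # X)) = pcol k (contract 0 g) X"
proof -
  have "(\<Sum>i\<in>UNIV. pcol (Suc k) g (i # X)) = (\<Sum>Y\<in>idx (Suc k). g Y *\<^sub>C (\<Sum>i\<in>UNIV. pm (i # X) Y))"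
    unfolding pcol_def by (subst sum.swap) (simp add: cvec.scale_sum_right)
  also have "\<dots> = (\<Sum>Y\<in>idx (Suc k). g Y *\<^sub>C (if 0 \<le> k then pm X (del 0 Y) else 0))"
    using assms pm_contract(1)[of _ X 0] by (intro sum.cong refl) (auto simp: idx_def ins_def)
  also have "\<dots> = pcol k (contract 0 g) X"
    unfolding pcol_def by (rule sum_contract)
  finally show ?thesis .
qed

section \<open>Relations between the eigenvalues\<close>

context
  fixes \<phi> :: "'n::finite qperm \<Rightarrow> complex" and c :: "nat \<Rightarrow> complex"
  assumes lin: "clinear \<phi>" and tr: "tracial \<phi>"
    and c: "\<And>k f g. f \<in> highest k \<Longrightarrow> g \<in> highest k \<Longrightarrow> \<phi> (cf k f g) = c k * cinner (idx k) f g"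
begin

text \<open>With \<open>\<xi> = a \<otimes> \<nu> \<otimes> a\<close> in the \<open>(k + 2)\<close>-nd highest weight space, rotating and merging the two
  outer legs produces an eigenvector \<open>a\<^sup>2 \<otimes> \<nu>\<close> of lower degree with the same eigenvalue.\<close>

lemma square_tens_eigen:
  assumes "tens (a # \<nu> @ [a]) \<in> highest (Suc (Suc k))" "length \<nu> = k" "X \<in> idx (Suc k)"
  shows "\<phi> (pcol (Suc k) (tens ((\<lambda>i. a i * a i) # \<nu>)) X) = c (Suc (Suc k)) * tens ((\<lambda>i. a i * a i) # \<nu>) X"
proof -
  have eq: "tens (a # \<nu> @ [a]) (Y @ [hd Y]) = tens ((\<lambda>i. a i * a i) # \<nu>) Y" if "Y \<in> idx (Suc k)" for Y
    using that assms(2) by (auto simp: idx_def length_Suc_conv tens_append)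
  have "pcol (Suc k) (tens ((\<lambda>i. a i * a i) # \<nu>)) X = pcol (Suc k) (\<lambda>Y. tens (a # \<nu> @ [a]) (Y @ [hd Y])) X"
    unfolding pcol_def by (intro sum.cong refl) (simp add: eq)
  then have "\<phi> (pcol (Suc k) (tens ((\<lambda>i. a i * a i) # \<nu>)) X) = \<phi> (pcol (Suc (Suc k)) (tens (a # \<nu> @ [a])) (X @ [hd X]))"
    using tracial_rotate[OF lin tr assms(3), of "tens (a # \<nu> @ [a])"] by simp
  also have "\<dots> = c (Suc (Suc k)) * tens (a # \<nu> @ [a]) (X @ [hd X])"
    using assms(3) by (intro phi_pcol_highest[OF lin c assms(1)]) (auto simp: idx_def)
  finally show ?thesis using eq[OF assms(3)] by simp
qed

lemma eigenvalue_skip: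
  fixes a :: "'n \<Rightarrow> complex"
  assumes a: "tens (a # \<nu> @ [a]) \<in> highest (Suc (Suc k))" and \<nu>: "length \<nu> = k" "tens \<nu> \<in> highest k"
    and nz: "\<forall>v\<in>set \<nu>. \<exists>x. v x \<noteq> 0" and sq: "(\<Sum>i\<in>UNIV. a i * a i) \<noteq> 0"
  shows "c k = c (Suc (Suc k))"
proof -
  let ?a2 = "\<lambda>i. a i * a i"
  obtain X where X: "length X = k" "tens \<nu> X \<noteq> 0" using tens_nonzero[OF nz] \<nu>(1) by auto
  then have Xk: "X \<in> idx k" "\<And>i. i # X \<in> idx (Suc k)" by (auto simp: idx_def)
  have "contract 0 (tens (?a2 # \<nu>)) Y = (\<Sum>i\<in>UNIV. ?a2 i) * tens \<nu> Y" for Y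
    by (simp add: contract_def ins_def sum_distrib_right)
  then have "pcol k (contract 0 (tens (?a2 # \<nu>))) X = (\<Sum>i\<in>UNIV. ?a2 i) *\<^sub>C pcol k (tens \<nu>) X"
    by (simp add: pcol_def cvec.scale_sum_right scaleC_scaleC)
  then have "(\<Sum>i\<in>UNIV. \<phi> (pcol (Suc k) (tens (?a2 # \<nu>)) (i # X))) = (\<Sum>i\<in>UNIV. ?a2 i) * \<phi> (pcol k (tens \<nu>) X)"
    using sum_pcol_contract[OF Xk(1), of "tens (?a2 # \<nu>)"]
    by (simp add: clinear_sum[OF lin, symmetric] clinear_simps[OF lin] scaleC_complex)
  moreover have "(\<Sum>i\<in>UNIV. \<phi> (pcol (Suc k) (tens (?a2 # \<nu>)) (i # X))) =
      (\<Sum>i\<in>UNIV. ?a2 i) * (c (Suc (Suc k)) * tens \<nu> X)"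
    unfolding square_tens_eigen[OF a \<nu>(1) Xk(2)] by (simp add: sum_distrib_left sum_distrib_right mult_ac)
  moreover have "\<phi> (pcol k (tens \<nu>) X) = c k * tens \<nu> X"
    by (rule phi_pcol_highest[OF lin c \<nu>(2) Xk(1)])
  ultimately show ?thesis using X sq by simp
qed

lemma eigenvalue_step:
  fixes a b :: "'n \<Rightarrow> complex"
  assumes a: "tens (a # \<nu> @ [a]) \<in> highest (Suc (Suc k))" and b: "tens (b # \<nu> @ [b]) \<in> highest (Suc (Suc k))"
    and diff: "tens ((\<lambda>i. a i * a i - b i * b i) # \<nu>) \<in> highest (Suc k)"
    and \<nu>: "length \<nu> = k" and nz: "\<forall>v\<in>set \<nu>. \<exists>x. v x \<noteq> 0" and ab: "\<exists>x. a x * a x \<noteq> b x * b x"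
  shows "c (Suc k) = c (Suc (Suc k))"
proof -
  let ?a2 = "\<lambda>i. a i * a i" and ?b2 = "\<lambda>i. b i * b i" and ?d = "\<lambda>i. a i * a i - b i * b i"
  have "\<exists>X. length X = length (?d # \<nu>) \<and> tens (?d # \<nu>) X \<noteq> 0"
    using nz ab by (intro tens_nonzero) auto
  then obtain X where X: "X \<in> idx (Suc k)" "tens (?d # \<nu>) X \<noteq> 0" using \<nu> by (auto simp: idx_def)
  have split: "tens (?d # \<nu>) Y = tens (?a2 # \<nu>) Y - tens (?b2 # \<nu>) Y" for Y
    by (cases Y) (simp_all add: left_diff_distrib)
  have "pcol (Suc k) (tens (?d # \<nu>)) X = pcol (Suc k) (tens (?a2 # \<nu>)) X - pcol (Suc k) (tens (?b2 # \<nu>)) X"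
    unfolding pcol_def split by (simp add: cvec.scale_left_diff_distrib sum_subtractf)
  then have "\<phi> (pcol (Suc k) (tens (?d # \<nu>)) X) = c (Suc (Suc k)) * tens (?d # \<nu>) X"
    unfolding split
    by (simp only: clinear_simps[OF lin] square_tens_eigen[OF a \<nu> X(1)] square_tens_eigen[OF b \<nu> X(1)] right_diff_distrib)
  moreover have "\<phi> (pcol (Suc k) (tens (?d # \<nu>)) X) = c (Suc k) * tens (?d # \<nu>) X"
    by (rule phi_pcol_highest[OF lin c diff X(1)])
  ultimately show ?thesis using X(2) by simp
qed

lemma eigenvalues_constant:
  assumes card: "CARD('n) \<ge> 6"
  shows "k > 0 \<Longrightarrow> c k = c 1"
proof -
  obtain S :: "'n set" where "finite S" "card S = 6"
    by (rule obtain_subset_with_card_n[OF card])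
  then obtain ps where "set ps = S" and ps: "distinct ps" "length ps = 6"
    using finite_distinct_list[of S] distinct_card by force
  \<comment> \<open>A difference of two deltas has zero sum; the six points give three such
    functions with disjoint supports.\<close>
  define d where "d i j = (\<lambda>x. (if x = ps ! i then 1 else 0) - (if x = ps ! j then 1 else (0 :: complex)))" for i j
  have ne: "ps ! i = ps ! j \<longleftrightarrow> i = j" if "i < 6" "j < 6" for i j
    using ps that by (simp add: nth_eq_iff_index_eq)
  define a e b where "a = d 0 1" and "e = d 2 3" and "b = d 4 5"
  have sum0: "(\<Sum>i\<in>UNIV. a i) = 0" "(\<Sum>i\<in>UNIV. e i) = 0" "(\<Sum>i\<in>UNIV. b i) = 0"
    by (simp_all add: a_def e_def b_def d_def sum_subtractf)
  have disj: "a i * e i = 0" "e i * a i = 0" "b i * e i = 0" "e i * b i = 0" "a i * b i = 0" for i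
    using ne[of 0 2] ne[of 0 3] ne[of 1 2] ne[of 1 3] ne[of 4 2] ne[of 4 3] ne[of 5 2] ne[of 5 3]
      ne[of 0 4] ne[of 0 5] ne[of 1 4] ne[of 1 5]
    by (auto simp: a_def e_def b_def d_def)
  note disj' = disj[unfolded mult_eq_0_iff]
  have val: "a (ps ! 0) = 1" "e (ps ! 2) = 1" "b (ps ! 0) = 0"
    using ne[of 0 1] ne[of 2 3] ne[of 0 4] ne[of 0 5] by (auto simp: a_def e_def b_def d_def)
  have sq: "(\<Sum>i\<in>UNIV. a i * a i) = 2" "(\<Sum>i\<in>UNIV. b i * b i) = 2"
  proof -
    have "(\<Sum>x\<in>UNIV. d i j x * d i j x) = 2" if "i < 6" "j < 6" "i \<noteq> j" for i j
    proof -
      have "d i j x * d i j x = (if x = ps ! i then 1 else 0) + (if x = ps ! j then 1 else 0)" for x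
        using that ne[of i j] by (auto simp: d_def)
      then show ?thesis by (simp add: sum.distrib)
    qed
    then show "(\<Sum>i\<in>UNIV. a i * a i) = 2" "(\<Sum>i\<in>UNIV. b i * b i) = 2"
      by (simp_all add: a_def b_def)
  qed
  \<comment> \<open>The word e a e ... a e with \<open>m\<close> letters \<open>a\<close>. Both ends
    are \<open>e\<close>, so that \<open>a\<close>, \<open>b\<close> and the difference of their
    squares may stand next to them.\<close>
  define \<nu> where "\<nu> = rec_nat [e] (\<lambda>_ vs. e # a # vs)"
  have \<nu>_simps: "\<nu> 0 = [e]" "\<nu> (Suc m) = e # a # \<nu> m" for m by (simp_all add: \<nu>_def)
  have hd: "hd (\<nu> m) = e" and nonempty: "\<nu> m \<noteq> []" for m by (cases m; simp add: \<nu>_simps)+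
  have last: "last (\<nu> m) = e" for m by (induction m) (simp_all add: \<nu>_simps nonempty)
  have len: "length (\<nu> m) = 2 * m + 1" for m by (induction m) (simp_all add: \<nu>_simps)
  have set: "set (\<nu> m) \<subseteq> {a, e}" for m by (induction m) (auto simp: \<nu>_simps)
  let ?R = "\<lambda>v w. \<forall>i. v i * w i = (0 :: complex)"
  have succ: "successively ?R (\<nu> m)" for m
    by (induction m) (simp_all add: \<nu>_simps successively_Cons disj' hd)
  have nz: "\<forall>v\<in>set (\<nu> m). \<exists>x. v x \<noteq> 0" for m
  proof
    fix v assume "v \<in> set (\<nu> m)"
    then have "v = a \<or> v = e" using set[of m] by auto
    then show "\<exists>x. v x \<noteq> 0" using val by (metis zero_neq_one)
  qed
  have \<nu>_high: "tens (\<nu> m) \<in> highest (2 * m + 1)" for m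
    using tens_highest[of "\<nu> m"] set[of m] sum0 succ by (auto simp: len)
  have outer: "tens (v # \<nu> m @ [v]) \<in> highest (Suc (Suc (2 * m + 1)))" if "v \<in> {a, b}" for v m
  proof -
    have "successively ?R (v # \<nu> m @ [v])"
      using that succ[of m] disj' by (auto simp: successively_Cons successively_append_iff nonempty hd last)
    moreover have "\<forall>w\<in>set (v # \<nu> m @ [v]). (\<Sum>i\<in>UNIV. w i) = 0"
      using that set[of m] sum0 by auto
    ultimately show ?thesis using tens_highest[of "v # \<nu> m @ [v]"] by (simp add: len)
  qed
  have diff: "tens ((\<lambda>i. a i * a i - b i * b i) # \<nu> m) \<in> highest (Suc (2 * m + 1))" for m
  proof -
    have "(a i * a i - b i * b i) * e i = 0" for i
      using disj'(1)[of i] disj'(3)[of i] by auto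
    then have "successively ?R ((\<lambda>i. a i * a i - b i * b i) # \<nu> m)"
      using succ[of m] by (simp add: successively_Cons hd)
    moreover have "\<forall>w\<in>set ((\<lambda>i. a i * a i - b i * b i) # \<nu> m). (\<Sum>i\<in>UNIV. w i) = 0"
      using set[of m] sum0 sq by (auto simp: sum_subtractf)
    ultimately show ?thesis using tens_highest[of "(\<lambda>i. a i * a i - b i * b i) # \<nu> m"] by (simp add: len)
  qed
  have skip: "c (2 * m + 1) = c (Suc (Suc (2 * m + 1)))" for m
    using eigenvalue_skip[OF outer[of a m] len \<nu>_high nz] sq by simp
  have step: "c (Suc (2 * m + 1)) = c (Suc (Suc (2 * m + 1)))" for m
    using eigenvalue_step[OF outer[of a m] outer[of b m] diff len nz] val
    by (metis insertI1 insertI2 mult_cancel_left1 mult_eq_0_iff zero_neq_one)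
  have odd: "c (2 * m + 1) = c 1" for m
    by (induction m) (use skip in \<open>simp_all\<close>)
  show "c k = c 1" if "k > 0"
  \<comment> \<open>Odd degrees are linked by \<open>skip\<close>. An even degree is linked by
    \<open>step\<close> to the odd degree just above it.\<close>
  proof (cases "even k")
    case True
    then obtain l where l: "k = 2 * l" by (elim evenE)
    with that obtain m where "l = Suc m" by (cases l) auto
    with l have "k = Suc (2 * m + 1)" by simp
    then show ?thesis using step[of m] skip[of m] odd[of m] by simp
  next
    case False
    then obtain m where "k = 2 * m + 1" by (auto elim!: oddE)
    then show ?thesis using odd by simp
  qed
qed

end

lemma haar_eps_cf:
  assumes "f \<in> highest k" "k > 0"
  shows "eps (cf k f g) = cinner (idx k) f g" "haar (cf k f g) = 0"
proof -
  show "eps (cf k f g) = cinner (idx k) f g"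
    by (simp add: cf_double clinear_sum[OF clinear_eps] clinear_simps[OF clinear_eps] scaleC_complex eps_pm
        cinner_def if_distrib[of "\<lambda>c. _ * c"] cong: if_cong)
  show "haar (cf k f g) = 0" by (rule haar_cf_raised_left[OF assms])
qed

lemma tracial_central_decomposition:
  fixes \<phi> :: "'n::finite qperm \<Rightarrow> complex"
  assumes card: "CARD('n) \<ge> 6" and Irr: "irr_representatives qperm_comult Irr"
    and lin: "clinear \<phi>" and tr: "tracial \<phi>" and cent: "central Irr \<phi>"
  shows "\<exists>a b. \<forall>x. \<phi> x = a * eps x + b * haar x"
proof -
  obtain c where c: "\<And>k f g. f \<in> highest k \<Longrightarrow> g \<in> highest k \<Longrightarrow> \<phi> (cf k f g) = c k * cinner (idx k) f g"
    using central_highest[OF Irr lin cent] by metis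
  \<comment> \<open>In positive degree only \<open>eps\<close> contributes, which forces the
    coefficient \<open>c 1\<close>; since both functionals are 1 at the unit, the rest of
    \<open>\<phi> 1\<close> goes to \<open>haar\<close>.\<close>
  have "\<phi> x = c 1 * eps x + (\<phi> 1 - c 1) * haar x" for x
  proof (induction x rule: highest_induct)
    case (cf k f g)
    show ?case
    proof (cases "k = 0")
      case True
      then have "cf k f g = (cnj (f []) * g []) *\<^sub>C 1" by (simp add: cf_double idx_0)
      then show ?thesis
        by (simp add: clinear_simps[OF lin] clinear_simps[OF clinear_eps] clinear_simps[OF clinear_haar]
            scaleC_complex eps_one haar_one algebra_simps)
    next
      case False
      then have k: "k > 0" by simp
      have "c k = c 1" by (rule eigenvalues_constant[OF lin tr c card k])
      then have "\<phi> (cf k f g) = c 1 * cinner (idx k) f g" using c[OF cf] by (simp only:)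
      then show ?thesis by (simp add: haar_eps_cf[OF cf(1) k])
    qed
  next
    case (scale s x)
    show ?case
      unfolding clinear_simps[OF lin] clinear_simps[OF clinear_eps] clinear_simps[OF clinear_haar]
        scaleC_complex scale by (simp only: distrib_left mult.left_commute)
  next
    case (add x y)
    show ?case
      unfolding clinear_simps[OF lin] clinear_simps[OF clinear_eps] clinear_simps[OF clinear_haar] add
      by (simp only: distrib_left add_ac)
  qed
  then show ?thesis by blast
qed

section \<open>Boundedness\<close>

text \<open>The GNS construction reduced to its seminorm: the semi-inner product
  \<open>h (star y * z)\<close> lives on the algebra itself, and the operator norm of left
  multiplication will be a C*-seminorm dominating \<open>h\<close>.\<close>

locale state =
  fixes h :: "'a::star_algebra \<Rightarrow> complex"
  assumes lin: "clinear h" and pos: "h (star x * x) \<in> \<real>\<^sub>\<ge>\<^sub>0" and one: "h 1 = 1"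
begin

definition nrm :: "'a \<Rightarrow> real" where "nrm x = sqrt (Re (h (star x * x)))"

lemma pos_Re: "h (star x * x) = complex_of_real (Re (h (star x * x)))" "Re (h (star x * x)) \<ge> 0"
proof -
  obtain r where "h (star x * x) = complex_of_real r" "r \<ge> 0"
    using pos[of x] by (auto elim!: nonneg_Reals_cases)
  then show "h (star x * x) = complex_of_real (Re (h (star x * x)))" "Re (h (star x * x)) \<ge> 0" by simp_all
qed

lemma nrm_nonneg: "nrm x \<ge> 0"
  by (simp add: nrm_def pos_Re(2))

lemma nrm_square: "complex_of_real ((nrm x)\<^sup>2) = h (star x * x)"
proof -
  have "(nrm x)\<^sup>2 = Re (h (star x * x))" by (simp add: nrm_def pos_Re(2))
  then show ?thesis by (simp only: pos_Re(1)[of x, symmetric])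
qed

lemma pos_Im: "Im (h (star x * x)) = 0"
  using arg_cong[OF nrm_square[of x], of Im] by simp

lemma expand:
  "h (star (y + t *\<^sub>C z) * (y + t *\<^sub>C z)) =
    h (star y * y) + t * h (star y * z) + cnj t * h (star z * y) + complex_of_real ((cmod t)\<^sup>2) * h (star z * z)"
  by (simp add: star_add star_scaleC distrib_left distrib_right clinear_simps[OF lin] scaleC_mult_left
      scaleC_mult_right scaleC_complex complex_norm_square del: of_real_power)

text \<open>Polarisation: by positivity \<open>t * ?A + cnj t * ?B\<close> is real for every t. The
  values 1 and \<open>\<i>\<close> of t settle the imaginary and the real parts.\<close>

lemma hermitian: "h (star z * y) = cnj (h (star y * z))"
proof -
  let ?A = "h (star y * z)" and ?B = "h (star z * y)"
  have "t * ?A + cnj t * ?B = h (star (y + t *\<^sub>C z) * (y + t *\<^sub>C z)) - h (star y * y) -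
      complex_of_real ((cmod t)\<^sup>2) * h (star z * z)" for t
    unfolding expand by simp
  then have "Im (t * ?A + cnj t * ?B) = 0" for t
    by (simp only: minus_complex.sel pos_Im times_complex.sel Im_complex_of_real)
  from this[of 1] this[of \<i>] show ?thesis by (simp add: complex_eq_iff)
qed

lemma Cauchy_Schwarz: "cmod (h (star y * z)) \<le> nrm y * nrm z"
proof -
  define A where "A = h (star y * z)"
  have ineq: "0 \<le> (nrm y)\<^sup>2 - 2 * s * (cmod A)\<^sup>2 + s\<^sup>2 * (cmod A)\<^sup>2 * (nrm z)\<^sup>2" for s :: real
  proof -
    \<comment> \<open>The factor \<open>cnj A\<close> makes both cross terms real and negative for
      positive s.\<close>
    let ?t = "- complex_of_real s * cnj A"
    have "h (star (y + ?t *\<^sub>C z) * (y + ?t *\<^sub>C z)) =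
        complex_of_real ((nrm y)\<^sup>2) + ?t * A + cnj ?t * cnj A + complex_of_real ((cmod ?t)\<^sup>2) * complex_of_real ((nrm z)\<^sup>2)"
      unfolding expand nrm_square hermitian[of z y] A_def ..
    also have "?t * A = complex_of_real (- s * (cmod A)\<^sup>2)"
      using complex_norm_square[of A] by (simp add: mult.commute)
    also have "cnj ?t * cnj A = complex_of_real (- s * (cmod A)\<^sup>2)"
      using complex_norm_square[of A] by (simp add: mult.commute)
    finally have "h (star (y + ?t *\<^sub>C z) * (y + ?t *\<^sub>C z)) =
        complex_of_real ((nrm y)\<^sup>2 - s * (cmod A)\<^sup>2 - s * (cmod A)\<^sup>2 + (cmod ?t)\<^sup>2 * (nrm z)\<^sup>2)"
      by simp
    then have "0 \<le> (nrm y)\<^sup>2 - s * (cmod A)\<^sup>2 - s * (cmod A)\<^sup>2 + (cmod ?t)\<^sup>2 * (nrm z)\<^sup>2"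
      using pos_Re(2)[of "y + ?t *\<^sub>C z"] by (metis Re_complex_of_real)
    then show ?thesis by (simp add: norm_mult power_mult_distrib algebra_simps)
  qed
  have "(cmod A)\<^sup>2 \<le> (nrm y)\<^sup>2 * (nrm z)\<^sup>2"
  proof (cases "nrm z = 0")
    case True
    have "(cmod A)\<^sup>2 = 0"
    proof (rule ccontr)
      assume nz: "(cmod A)\<^sup>2 \<noteq> 0"
      \<comment> \<open>With \<open>nrm z = 0\<close> the bound is affine in s, and this s is large
        enough to make it negative.\<close>
      have "0 \<le> (nrm y)\<^sup>2 - 2 * (((nrm y)\<^sup>2 + 1) / (cmod A)\<^sup>2) * (cmod A)\<^sup>2"
        using ineq[of "((nrm y)\<^sup>2 + 1) / (cmod A)\<^sup>2"] True by simp
      also have "\<dots> = - (nrm y)\<^sup>2 - 2" using nz by simp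
      finally show False using zero_le_power2[of "nrm y"] by linarith
    qed
    then show ?thesis by simp
  next
    case False
    then have z: "(nrm z)\<^sup>2 > 0" by simp
    \<comment> \<open>This value of s minimises the quadratic bound.\<close>
    have "0 \<le> (nrm y)\<^sup>2 - 2 * (1 / (nrm z)\<^sup>2) * (cmod A)\<^sup>2 + (1 / (nrm z)\<^sup>2)\<^sup>2 * (cmod A)\<^sup>2 * (nrm z)\<^sup>2"
      by (rule ineq)
    also have "\<dots> = (nrm y)\<^sup>2 - (cmod A)\<^sup>2 / (nrm z)\<^sup>2"
      using z by (simp add: field_simps power2_eq_square)
    finally show ?thesis using z by (simp add: field_simps)
  qed
  then have "(cmod A)\<^sup>2 \<le> (nrm y * nrm z)\<^sup>2" by (simp add: power_mult_distrib)
  then show ?thesis unfolding A_def using nrm_nonneg by (simp add: power2_le_iff_abs_le)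
qed

lemma nrm_triangle: "nrm (x + y) \<le> nrm x + nrm y"
proof -
  have "complex_of_real ((nrm (x + y))\<^sup>2) = h (star x * x) + h (star x * y) + h (star y * x) + h (star y * y)"
    unfolding nrm_square using expand[of x 1 y] by (simp add: scaleC_one)
  also have "\<dots> = complex_of_real ((nrm x)\<^sup>2 + 2 * Re (h (star x * y)) + (nrm y)\<^sup>2)"
    unfolding hermitian[of y x] by (simp add: nrm_square[symmetric] complex_add_cnj del: of_real_power)
  finally have "(nrm (x + y))\<^sup>2 = (nrm x)\<^sup>2 + 2 * Re (h (star x * y)) + (nrm y)\<^sup>2"
    by (simp only: of_real_eq_iff)
  also have "\<dots> \<le> (nrm x + nrm y)\<^sup>2"
    using Cauchy_Schwarz[of x y] complex_Re_le_cmod[of "h (star x * y)"] by (simp add: power2_sum)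
  finally show ?thesis by (rule power2_le_imp_le) (simp add: nrm_nonneg)
qed

lemma nrm_scale: "nrm (c *\<^sub>C x) = cmod c * nrm x"
proof -
  have "complex_of_real ((nrm (c *\<^sub>C x))\<^sup>2) = complex_of_real ((cmod c * nrm x)\<^sup>2)"
    by (simp add: nrm_square star_scaleC clinear_simps[OF lin] scaleC_mult_left scaleC_mult_right
        scaleC_complex power_mult_distrib complex_norm_square del: of_real_power)
  then have "(nrm (c *\<^sub>C x))\<^sup>2 = (cmod c * nrm x)\<^sup>2" by (simp only: of_real_eq_iff)
  then show ?thesis using nrm_nonneg by (simp add: power2_eq_iff_nonneg)
qed

text \<open>The operator norm of the GNS representation.\<close>

definition gns_norm :: "'a \<Rightarrow> real" where
  "gns_norm x = Inf {B. B \<ge> 0 \<and> (\<forall>y. nrm (x * y) \<le> B * nrm y)}"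

lemma gns_norm_least: "B \<ge> 0 \<Longrightarrow> (\<And>y. nrm (x * y) \<le> B * nrm y) \<Longrightarrow> gns_norm x \<le> B"
  unfolding gns_norm_def by (rule cInf_lower) (auto intro!: bdd_belowI[of _ 0])

context
  assumes bounded: "\<And>x. \<exists>B\<ge>0. \<forall>y. nrm (x * y) \<le> B * nrm y"
begin

lemma gns_norm_nonneg: "gns_norm x \<ge> 0"
  unfolding gns_norm_def using bounded[of x] by (intro cInf_greatest) auto

lemma nrm_mult_le: "nrm (x * y) \<le> gns_norm x * nrm y"
proof (cases "nrm y = 0")
  case True
  obtain B where "nrm (x * y) \<le> B * nrm y" using bounded by blast
  then show ?thesis using True by simp
next
  case False
  then have y: "nrm y > 0" using nrm_nonneg[of y] by simp
  have "nrm (x * y) / nrm y \<le> gns_norm x"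
    unfolding gns_norm_def using bounded[of x] y
    by (intro cInf_greatest) (auto simp: divide_le_eq)
  then show ?thesis using y by (simp add: divide_le_eq)
qed

text \<open>The C*-identity is the substantial axiom. Cauchy-Schwarz bounds the square of
  \<open>nrm (x * z)\<close> by \<open>nrm z\<close> times \<open>nrm (star x * x * z)\<close>,
  which gives \<open>sq\<close>. With submultiplicativity, \<open>x\<close> has at most the norm of
  \<open>star x\<close>; exchanging the two gives equality.\<close>

lemma cstar_seminorm_gns: "cstar_seminorm gns_norm"
  unfolding cstar_seminorm_def
proof (intro conjI allI)
  fix x y :: 'a and c :: complex
  show "0 \<le> gns_norm x" by (rule gns_norm_nonneg)
  show "gns_norm (x + y) \<le> gns_norm x + gns_norm y"
  proof (rule gns_norm_least)
    fix z
    have "nrm ((x + y) * z) \<le> nrm (x * z) + nrm (y * z)" by (simp add: distrib_right nrm_triangle)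
    also have "\<dots> \<le> (gns_norm x + gns_norm y) * nrm z"
      using nrm_mult_le[of x z] nrm_mult_le[of y z] by (simp add: distrib_right)
    finally show "nrm ((x + y) * z) \<le> (gns_norm x + gns_norm y) * nrm z" .
  qed (simp add: gns_norm_nonneg)
  have scale: "gns_norm (c *\<^sub>C x) \<le> cmod c * gns_norm x" for c x
  proof (rule gns_norm_least)
    show "nrm ((c *\<^sub>C x) * z) \<le> cmod c * gns_norm x * nrm z" for z
      using nrm_mult_le[of x z] by (simp add: scaleC_mult_left nrm_scale mult.assoc mult_left_mono)
  qed (simp add: gns_norm_nonneg)
  show "gns_norm (c *\<^sub>C x) = cmod c * gns_norm x"
  proof (cases "c = 0")
    case True
    then show ?thesis using scale[of c x] gns_norm_nonneg[of "c *\<^sub>C x"] by simp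
  next
    case False
    have "gns_norm (inverse c *\<^sub>C (c *\<^sub>C x)) \<le> cmod (inverse c) * gns_norm (c *\<^sub>C x)" by (rule scale)
    then have "cmod c * gns_norm x \<le> gns_norm (c *\<^sub>C x)"
      using False by (simp add: scaleC_scaleC scaleC_one norm_inverse norm_divide field_simps)
    then show ?thesis using scale[of c x] by simp
  qed
  have mult: "gns_norm (x * y) \<le> gns_norm x * gns_norm y" for x y
  proof (rule gns_norm_least)
    fix z
    have "nrm (x * y * z) \<le> gns_norm x * nrm (y * z)" using nrm_mult_le[of x "y * z"] by (simp add: mult.assoc)
    also have "\<dots> \<le> gns_norm x * (gns_norm y * nrm z)"
      by (intro mult_left_mono nrm_mult_le gns_norm_nonneg)
    finally show "nrm (x * y * z) \<le> gns_norm x * gns_norm y * nrm z" by (simp add: mult.assoc)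
  qed (simp add: gns_norm_nonneg)
  then show "gns_norm (x * y) \<le> gns_norm x * gns_norm y" .
  have sq: "(gns_norm x)\<^sup>2 \<le> gns_norm (star x * x)" for x
  proof -
    have "gns_norm x \<le> sqrt (gns_norm (star x * x))"
    proof (rule gns_norm_least)
      fix z
      have "(nrm (x * z))\<^sup>2 = cmod (h (star z * (star x * x * z)))"
        using arg_cong[OF nrm_square[of "x * z"], of cmod] by (simp add: star_mult mult.assoc norm_power)
      also have "\<dots> \<le> nrm z * (gns_norm (star x * x) * nrm z)"
        by (rule order.trans[OF Cauchy_Schwarz]) (intro mult_left_mono nrm_mult_le nrm_nonneg)
      also have "\<dots> = (sqrt (gns_norm (star x * x)) * nrm z)\<^sup>2"
        by (simp add: power_mult_distrib gns_norm_nonneg power2_eq_square[of "nrm z"])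
      finally show "nrm (x * z) \<le> sqrt (gns_norm (star x * x)) * nrm z"
        by (rule power2_le_imp_le) (simp add: gns_norm_nonneg nrm_nonneg)
    qed (simp add: gns_norm_nonneg)
    then have "(gns_norm x)\<^sup>2 \<le> (sqrt (gns_norm (star x * x)))\<^sup>2"
      by (intro power_mono gns_norm_nonneg)
    then show ?thesis by (simp add: gns_norm_nonneg)
  qed
  have le: "gns_norm x \<le> gns_norm (star x)" for x
  proof (cases "gns_norm x = 0")
    case False
    have "gns_norm x * gns_norm x \<le> gns_norm (star x) * gns_norm x"
      using order.trans[OF sq mult, of x] by (simp add: power2_eq_square)
    then show ?thesis using False gns_norm_nonneg[of x] by simp
  qed (simp add: gns_norm_nonneg)
  have "gns_norm (star x) = gns_norm x" using le[of x] le[of "star x"] by (simp add: star_star)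
  then show "gns_norm (star x * x) = (gns_norm x)\<^sup>2"
    using sq[of x] mult[of "star x" x] by (simp add: power2_eq_square)
qed

lemma cmod_le_gns_norm: "cmod (h x) \<le> gns_norm x"
proof -
  have "nrm 1 = 1" by (simp add: nrm_def star_one one)
  then show ?thesis using Cauchy_Schwarz[of 1 x] nrm_mult_le[of x 1] by (simp add: star_one)
qed

end

end

text \<open>A generator p is a projection, so the squared norms of p z and (1 - p) z add up to that
  of z, and left multiplication by p is contractive. Hence every left multiplication is bounded, and
  the GNS seminorm lies below the universal norm.\<close>

lemma haar_bounded: "cmod (haar x) \<le> univ_norm (x :: 'n::finite qperm)"
proof -
  interpret state "haar :: 'n qperm \<Rightarrow> complex"
    by (rule state.intro) (simp_all add: clinear_haar haar_nonneg haar_one)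
  have gen: "nrm (qperm_gen i j * z) \<le> nrm z" for i j and z :: "'n qperm"
  proof -
    let ?p = "qperm_gen i j" and ?q = "1 - qperm_gen i j"
    have 1: "haar (star (?p * z) * (?p * z)) = haar (star z * (?p * z))"
      by (simp add: star_mult qperm_gen_relations qperm_gen_mult mult.assoc)
    have "star (?q * z) * (?q * z) = star z * z - star z * (?p * z)"
      by (simp add: star_mult star_diff star_one qperm_gen_relations qperm_gen_mult algebra_simps)
    then have "haar (star (?q * z) * (?q * z)) = haar (star z * z) - haar (star z * (?p * z))"
      by (simp add: clinear_simps[OF lin])
    then have "Re (haar (star (?p * z) * (?p * z))) \<le> Re (haar (star z * z))"
      using pos_Re(2)[of "?q * z"] 1 by simp
    then show ?thesis by (simp add: nrm_def)
  qed
  have bounded: "\<exists>B\<ge>0. \<forall>z. nrm (y * z) \<le> B * nrm z" for y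
  proof (induction y rule: qperm_induct)
    case one
    show ?case by (intro exI[of _ 1]) simp
  next
    case (gen_mult i j y)
    then show ?case using gen order.trans by (metis mult.assoc)
  next
    case (scale c y)
    then obtain B where "B \<ge> 0" "\<And>z. nrm (y * z) \<le> B * nrm z" by blast
    then show ?case
      by (intro exI[of _ "cmod c * B"]) (simp add: scaleC_mult_left nrm_scale mult.assoc mult_left_mono)
  next
    case (add x y)
    then obtain B C where BC: "B \<ge> 0" "C \<ge> 0" "\<And>z. nrm (x * z) \<le> B * nrm z" "\<And>z. nrm (y * z) \<le> C * nrm z" by blast
    have "nrm ((x + y) * z) \<le> (B + C) * nrm z" for z
      using nrm_triangle[of "x * z" "y * z"] BC(3,4)[of z] by (simp add: distrib_right)
    then show ?case using BC(1,2) by (intro exI[of _ "B + C"]) simp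
  qed
  show ?thesis
    using cmod_le_gns_norm[OF bounded, of x] cstar_seminorm_le_univ_norm[OF cstar_seminorm_gns[OF bounded], of x]
    by simp
qed

lemma eps_star: "eps (star x) = cnj (eps x)"
  by (induction x rule: qperm_induct)
     (simp_all add: star_one star_mult star_scaleC star_add eps_one eps_mult eps_gen
        clinear_simps[OF clinear_eps] scaleC_complex qperm_gen_relations)

text \<open>The modulus of a character that respects the involution is itself a C*-seminorm.\<close>

lemma eps_bounded: "cmod (eps x) \<le> univ_norm x"
proof (rule cstar_seminorm_le_univ_norm)
  show "cstar_seminorm (\<lambda>x. cmod (eps x))"
    unfolding cstar_seminorm_def
    by (simp add: clinear_simps[OF clinear_eps] scaleC_complex eps_mult eps_star norm_mult norm_triangle_ineq
        power2_eq_square)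
qed

text \<open>Extension by continuity. The limit is taken along a chosen representative;
  \<open>abs\<close> shows that every Cauchy representative yields the same value.\<close>

lemma bounded_extension:
  fixes \<phi> :: "'a::cstar_bounded_algebra \<Rightarrow> complex"
  assumes lin: "clinear \<phi>" and le: "\<And>x. cmod (\<phi> x) \<le> K * univ_norm x"
  shows "\<exists>\<psi> :: 'a cstar_completion \<Rightarrow> complex.
    clinear \<psi> \<and> bounded_linear \<psi> \<and> (\<forall>x. \<psi> (to_completion x) = \<phi> x)"
proof -
  define \<psi> where "\<psi> X = lim (\<lambda>n. \<phi> (rep_cstar_completion X n))" for X
  have conv: "(\<lambda>n. \<phi> (u n)) \<longlonglongrightarrow> lim (\<lambda>n. \<phi> (u n))" if u: "univ_Cauchy u" for u
  proof -
    have "Cauchy (\<lambda>n. \<phi> (u n))"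
    proof (rule CauchyI)
      fix e :: real assume e: "e > 0"
      \<comment> \<open>\<open>K\<close> is not assumed positive, so the divisor is made positive by
        hand.\<close>
      then have "e / (\<bar>K\<bar> + 1) > 0" by simp
      then obtain M where M: "\<And>m n. m \<ge> M \<Longrightarrow> n \<ge> M \<Longrightarrow> univ_norm (u m - u n) < e / (\<bar>K\<bar> + 1)"
        using u unfolding univ_Cauchy_def by blast
      have "norm (\<phi> (u m) - \<phi> (u n)) < e" if "m \<ge> M" "n \<ge> M" for m n
      proof -
        have "norm (\<phi> (u m) - \<phi> (u n)) \<le> K * univ_norm (u m - u n)"
          using le[of "u m - u n"] by (simp add: clinear_simps[OF lin])
        also have "\<dots> \<le> (\<bar>K\<bar> + 1) * univ_norm (u m - u n)"
          by (intro mult_right_mono univ_norm_nonneg) simp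
        also have "\<dots> < e" using M[OF that] by (simp add: field_simps)
        finally show ?thesis .
      qed
      then show "\<exists>M. \<forall>m\<ge>M. \<forall>n\<ge>M. norm (\<phi> (u m) - \<phi> (u n)) < e" by blast
    qed
    then show ?thesis using Cauchy_convergent convergent_LIMSEQ_iff by blast
  qed
  have abs: "(\<lambda>n. \<phi> (u n)) \<longlonglongrightarrow> \<psi> (abs_cstar_completion u)" if u: "univ_Cauchy u" for u
  proof -
    let ?v = "rep_cstar_completion (abs_cstar_completion u)"
    have v: "univ_Cauchy ?v" "univ_null (\<lambda>n. u n - ?v n)"
      using Quotient_rep_abs[OF Quotient_cstar_completion, of u] u univ_null_minus[of "\<lambda>n. ?v n - u n"]
      by (auto simp: univ_null_zero)
    have "(\<lambda>n. \<phi> (u n) - \<phi> (?v n)) \<longlonglongrightarrow> 0"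
      by (rule tendsto_0_le[OF v(2)[unfolded univ_null_def], where K = K])
         (simp add: clinear_simps(5)[OF lin, symmetric] le univ_norm_nonneg mult.commute[of _ K])
    from tendsto_add[OF this conv[OF v(1)]] show ?thesis by (simp add: \<psi>_def)
  qed
  have rep: "\<exists>u. X = abs_cstar_completion u \<and> univ_Cauchy u" for X :: "'a cstar_completion"
    using Quotient_abs_rep[OF Quotient_cstar_completion, of X] Quotient_rep_reflp[OF Quotient_cstar_completion, of X]
    by (intro exI[of _ "rep_cstar_completion X"]) simp
  have add: "\<psi> (X + Y) = \<psi> X + \<psi> Y" for X Y
  proof -
    obtain u v where u: "X = abs_cstar_completion u" "univ_Cauchy u" and v: "Y = abs_cstar_completion v" "univ_Cauchy v"
      using rep by metis
    have "X + Y = abs_cstar_completion (\<lambda>n. u n + v n)"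
      using u v by (simp add: plus_cstar_completion.abs_eq univ_null_zero)
    then have "(\<lambda>n. \<phi> (u n + v n)) \<longlonglongrightarrow> \<psi> (X + Y)"
      using abs[OF univ_Cauchy_add[OF u(2) v(2)]] by simp
    moreover have "(\<lambda>n. \<phi> (u n + v n)) \<longlonglongrightarrow> \<psi> X + \<psi> Y"
      unfolding clinear_simps[OF lin] u(1) v(1) by (intro tendsto_add abs u v)
    ultimately show ?thesis by (rule LIMSEQ_unique)
  qed
  have scale: "\<psi> (c *\<^sub>C X) = c *\<^sub>C \<psi> X" for c X
  proof -
    obtain u where u: "X = abs_cstar_completion u" "univ_Cauchy u" using rep by metis
    have "c *\<^sub>C X = abs_cstar_completion (\<lambda>n. c *\<^sub>C u n)"
      using u by (simp add: scaleC_cstar_completion.abs_eq univ_null_zero)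
    then have "(\<lambda>n. \<phi> (c *\<^sub>C u n)) \<longlonglongrightarrow> \<psi> (c *\<^sub>C X)"
      using abs[OF univ_Cauchy_scale[OF u(2)]] by simp
    moreover have "(\<lambda>n. \<phi> (c *\<^sub>C u n)) \<longlonglongrightarrow> c * \<psi> X"
      unfolding clinear_simps[OF lin] u(1) scaleC_complex by (intro tendsto_mult tendsto_const abs u)
    ultimately show ?thesis unfolding scaleC_complex by (rule LIMSEQ_unique)
  qed
  have "norm (\<psi> X) \<le> norm X * K" for X
  proof -
    obtain u where u: "X = abs_cstar_completion u" "univ_Cauchy u" using rep by metis
    have "norm X = lim (\<lambda>n. univ_norm (u n))"
      using u by (simp add: norm_cstar_completion.abs_eq univ_null_zero)
    then have "(\<lambda>n. K * univ_norm (u n)) \<longlonglongrightarrow> K * norm X"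
      using univ_norm_lim[OF u(2)] by (intro tendsto_mult tendsto_const) simp
    moreover have "(\<lambda>n. norm (\<phi> (u n))) \<longlonglongrightarrow> norm (\<psi> X)"
      unfolding u(1) by (intro tendsto_norm abs u)
    ultimately have "norm (\<psi> X) \<le> K * norm X"
      by (intro LIMSEQ_le) (use le in auto)
    then show ?thesis by (simp add: mult.commute)
  qed
  then have "bounded_linear \<psi>"
    by (intro bounded_linear_intro[of _ K])
       (simp_all add: add scaleR_cstar_completion_def scale scaleC_complex scaleR_conv_of_real)
  moreover have "clinear \<psi>" by (simp add: clinear_iff add scale)
  moreover have "\<psi> (to_completion x) = \<phi> x" for x
  proof -
    have "to_completion x = abs_cstar_completion (\<lambda>n. x)"
      by (simp add: to_completion_def)
    then have "(\<lambda>n. \<phi> x) \<longlonglongrightarrow> \<psi> (to_completion x)"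
      using abs[OF univ_Cauchy_const[of x]] by simp
    then show ?thesis by (rule LIMSEQ_unique) (rule tendsto_const)
  qed
  ultimately show ?thesis by blast
qed

theorem corollary5p7:
  fixes \<phi> :: "'n::finite qperm \<Rightarrow> complex"
    and Irr :: "'n qperm mat set"
  assumes "CARD('n) \<ge> 6"
    and "irr_representatives qperm_comult Irr"
    and "clinear \<phi>" and "tracial \<phi>" and "central Irr \<phi>"
  shows "(\<exists>a b. \<forall>x. \<phi> x = a * counit qperm_comult x + b * haar_state qperm_comult x) \<and>
    (\<exists>\<psi> :: 'n qperm cstar_completion \<Rightarrow> complex.
       clinear \<psi> \<and> bounded_linear \<psi> \<and> (\<forall>x. \<psi> (to_completion x) = \<phi> x))"
proof -
  obtain a b where ab: "\<And>x. \<phi> x = a * eps x + b * haar x"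
    using tracial_central_decomposition[OF assms] by blast
  have "cmod (\<phi> x) \<le> (cmod a + cmod b) * univ_norm x" for x
  proof -
    have "cmod (\<phi> x) \<le> cmod a * cmod (eps x) + cmod b * cmod (haar x)"
      unfolding ab by (metis norm_mult norm_triangle_ineq)
    also have "\<dots> \<le> cmod a * univ_norm x + cmod b * univ_norm x"
      by (intro add_mono mult_left_mono eps_bounded haar_bounded) simp_all
    finally show ?thesis by (simp add: distrib_right)
  qed
  then show ?thesis
    using ab bounded_extension[OF assms(3)] by (auto simp: counit_qperm haar_state_qperm)
qed

end
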